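(* Let $k$ be a commutative unital ring, $m\ge2$, $n=m+1$, $A$ a unital associative $k$-algebra, $c\in A^\times$, and $\sigma\in\mathrm{Aut}_k(A)$ with $\sigma(c)=c$ and $\sigma^m(a)=cac^{-1}$ for all $a\in A$. With the endpoint-anchored envelope $\mathsf U^{\mathrm{an}}_c(A,\sigma,n)$ and the cyclic crossed product $\mathcal C(A,\sigma,c)$ defined in the context, there is a natural isomorphism of $k$-algebras $$\mathsf U^{\mathrm{an}}_c(A,\sigma,n)\cong\mathcal C(A,\sigma,c).$$ Consequently, endpoint-anchored slot modules over $T(A,\sigma,c)$ are naturally the $A$-bimodules $M$ (i.e. $A\otimes_kA^{\mathrm{op}}$-modules) equipped with an invertible $k$-linear operator $S:M\to M$ such that $$S(axb)=\sigma(a)S(x)\sigma(b),\qquad S^m(x)=cxc^{-1}\qquad(a,b\in A,\ x\in M).$$ For such a module, the $i$-th slot action ($0\le i\le m$) is $$\lambda_i(a_0,\ldots,a_{i-1},x,a_{i+1},\ldots,a_m)=p_i\,S^i(x)\,q_i,\qquad p_i=\prod_{j<i}\sigma^j(a_j),\quad q_i=\Bigl(\prod_{j>i}\sigma^j(a_j)\Bigr)c,$$ with products ordered by increasing $j$.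
   Context: The $n$-ary algebra $T(A,\sigma,c)$ is $A$ with the totally associative product $\mu_{\sigma,c}(a_0,\ldots,a_m)=a_0\sigma(a_1)\cdots\sigma^{m-1}(a_{m-1})ca_m$. Slot modules: a slot module over $T(A,\sigma,c)$ is a $k$-module $M$ with multilinear maps $\lambda_i:A^{\otimes i}\otimes M\otimes A^{\otimes(m-i)}\to M$, $0\le i\le m$, such that all evaluations (using $\mu_{\sigma,c}$ on blocks with no entry from $M$ and $\lambda_i$ on blocks whose position-$i$ entry is from $M$) of a planar $n$-ary word containing exactly one entry of $M$ agree under total-associativity moves. It is endpoint-anchored if $\lambda_0(x,1,\ldots,1,c^{-1})=x$ and $\lambda_m(c^{-1},1,\ldots,1,x)=x$ for all $x\in M$. Morphisms are $k$-linear maps commuting with every slot operation. Envelope: a one-hole context is a finite planar rooted full $n$-ary tree (every internal vertex has exactly $n$ ordered inputs) with one distinguished leaf labelled $\star$ and all other (ordinary) leaves labelled by elements of $A$. Take the free $k$-module on one-hole contexts modulo: multilinearity in the ordinary leaf labels; scalar contraction (a vertex all of whose inputs are ordinary leaves $a_0,\ldots,a_m$ may be replaced by one ordinary leaf labelled $\mu_{\sigma,c}(a_0,\ldots,a_m)$); and total associativity (rebracketing of two adjacent vertices). Grafting makes this an associative unital algebra: $CD$ is obtained by grafting $D$ into the hole of $C$, and the unit is the trivial tree $\star$. Imposing moreover (as algebra relations) that the one-vertex contexts with inputs $(\star,1,\ldots,1,c^{-1})$ and $(c^{-1},1,\ldots,1,\star)$ both equal the unit gives $\mathsf U^{\mathrm{an}}_c(A,\sigma,n)$;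 its unital modules are the endpoint-anchored slot modules. Cyclic crossed product: put $A^e=A\otimes_kA^{\mathrm{op}}$, $\sigma^e=\sigma\otimes\sigma^{\mathrm{op}}$ (where $\sigma^{\mathrm{op}}$ is $\sigma$ viewed on $A^{\mathrm{op}}$), $z_c=c\otimes(c^{-1})^{\mathrm{op}}\in(A^e)^\times$. Then $\mathcal C(A,\sigma,c)=\bigoplus_{r=0}^{m-1}A^eu^r$ as a left $A^e$-module, with multiplication $(xu^r)(yu^s)=x(\sigma^e)^r(y)z_c^{\delta}u^{r+s-\delta m}$, $\delta=\lfloor (r+s)/m\rfloor$; equivalently it is $A^e\langle u\rangle/(ux-\sigma^e(x)u\ (x\in A^e),\ u^m-z_c)$. An $A^e$-module is viewed as an $A$-bimodule via $(a\otimes b^{\mathrm{op}})x=axb$. *)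

theory Defs
  imports "HOL-Algebra.QuotRing" "HOL-Algebra.Module"
begin

section \<open>Algebras over a commutative ring\<close>

text \<open>The library locale \<open>algebra\<close> is restricted to commutative algebras, hence this one.
  Zero rings are allowed, both for the base ring and for the algebra.\<close>

locale assoc_algebra = module R A + A: ring A for R (structure) and A (structure) +
  assumes smult_mult_left: "\<lbrakk>r \<in> carrier R; a \<in> carrier A; b \<in> carrier A\<rbrakk>
      \<Longrightarrow> (r \<odot>\<^bsub>A\<^esub> a) \<otimes>\<^bsub>A\<^esub> b = r \<odot>\<^bsub>A\<^esub> (a \<otimes>\<^bsub>A\<^esub> b)"
    and smult_mult_right: "\<lbrakk>r \<in> carrier R; a \<in> carrier A; b \<in> carrier A\<rbrakk>
      \<Longrightarrow> a \<otimes>\<^bsub>A\<^esub> (r \<odot>\<^bsub>A\<^esub> b) = r \<odot>\<^bsub>A\<^esub> (a \<otimes>\<^bsub>A\<^esub> b)"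

definition alg_hom where
  "alg_hom R A B = {h \<in> ring_hom A B.
     \<forall>r \<in> carrier R. \<forall>a \<in> carrier A. h (r \<odot>\<^bsub>A\<^esub> a) = r \<odot>\<^bsub>B\<^esub> h a}"

definition alg_iso where
  "alg_iso R A B = {h \<in> alg_hom R A B. bij_betw h (carrier A) (carrier B)}"

definition lin_map where
  "lin_map R M N = {h \<in> carrier M \<rightarrow> carrier N.
     (\<forall>x \<in> carrier M. \<forall>y \<in> carrier M. h (x \<oplus>\<^bsub>M\<^esub> y) = h x \<oplus>\<^bsub>N\<^esub> h y) \<and>
     (\<forall>r \<in> carrier R. \<forall>x \<in> carrier M. h (r \<odot>\<^bsub>M\<^esub> x) = r \<odot>\<^bsub>N\<^esub> h x)}"

text \<open>A unital left module over the \<open>R\<close>-algebra \<open>B\<close>, on a given \<open>R\<close>-module \<open>M\<close>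
  (the \<open>R\<close>-module structure being the one obtained by restriction of scalars).\<close>

locale alg_module = B: assoc_algebra R B + M: module R M
  for R (structure) and B (structure) and M (structure) +
  fixes act :: "'b \<Rightarrow> 'm \<Rightarrow> 'm"
  constrains B :: "('r, 'b, 'p) module_scheme" and M :: "('r, 'm, 'q) module_scheme"
  assumes act_closed: "\<lbrakk>b \<in> carrier B; x \<in> carrier M\<rbrakk> \<Longrightarrow> act b x \<in> carrier M"
    and act_add: "\<lbrakk>b \<in> carrier B; x \<in> carrier M; y \<in> carrier M\<rbrakk>
      \<Longrightarrow> act b (x \<oplus>\<^bsub>M\<^esub> y) = act b x \<oplus>\<^bsub>M\<^esub> act b y"
    and add_act: "\<lbrakk>b \<in> carrier B; b' \<in> carrier B; x \<in> carrier M\<rbrakk>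
      \<Longrightarrow> act (b \<oplus>\<^bsub>B\<^esub> b') x = act b x \<oplus>\<^bsub>M\<^esub> act b' x"
    and mult_act: "\<lbrakk>b \<in> carrier B; b' \<in> carrier B; x \<in> carrier M\<rbrakk>
      \<Longrightarrow> act (b \<otimes>\<^bsub>B\<^esub> b') x = act b (act b' x)"
    and one_act: "x \<in> carrier M \<Longrightarrow> act \<one>\<^bsub>B\<^esub> x = x"
    and smult_act: "\<lbrakk>r \<in> carrier R; b \<in> carrier B; x \<in> carrier M\<rbrakk>
      \<Longrightarrow> act (r \<odot>\<^bsub>B\<^esub> b) x = r \<odot>\<^bsub>M\<^esub> act b x"

definition opp_alg :: "('r, 'a) module \<Rightarrow> ('r, 'a) module" where
  "opp_alg A = A\<lparr>mult := (\<lambda>a b. b \<otimes>\<^bsub>A\<^esub> a)\<rparr>"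

subsection \<open>Monoid algebras and quotients\<close>

definition basis_el :: "('r, 'x) ring_scheme \<Rightarrow> 'g \<Rightarrow> 'g \<Rightarrow> 'r" where
  "basis_el R g = (\<lambda>h. if h = g then \<one>\<^bsub>R\<^esub> else \<zero>\<^bsub>R\<^esub>)"

text \<open>The free module \<open>R[G]\<close> on the carrier of a monoid \<open>G\<close> (finitely supported functions),
  with the product extending that of \<open>G\<close> bilinearly.\<close>

definition monoid_algebra ::
  "('r, 'x) ring_scheme \<Rightarrow> ('g, 'y) monoid_scheme \<Rightarrow> ('r, 'g \<Rightarrow> 'r) module" where
  "monoid_algebra R G =
    \<lparr>carrier = {f. (\<forall>g. f g \<in> carrier R) \<and> (\<forall>g. g \<notin> carrier G \<longrightarrow> f g = \<zero>\<^bsub>R\<^esub>)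
                   \<and> finite {g. f g \<noteq> \<zero>\<^bsub>R\<^esub>}},
     mult = (\<lambda>f f' g. \<Oplus>\<^bsub>R\<^esub>p \<in> {p. f (fst p) \<noteq> \<zero>\<^bsub>R\<^esub> \<and> f' (snd p) \<noteq> \<zero>\<^bsub>R\<^esub> \<and> fst p \<otimes>\<^bsub>G\<^esub> snd p = g}.
               f (fst p) \<otimes>\<^bsub>R\<^esub> f' (snd p)),
     one = basis_el R \<one>\<^bsub>G\<^esub>,
     zero = (\<lambda>g. \<zero>\<^bsub>R\<^esub>),
     add = (\<lambda>f f' g. f g \<oplus>\<^bsub>R\<^esub> f' g),
     smult = (\<lambda>r f g. r \<otimes>\<^bsub>R\<^esub> f g)\<rparr>"

text \<open>The linear extension of a map of bases.\<close>

definition push_forward :: "('r, 'x) ring_scheme \<Rightarrow> ('g \<Rightarrow> 'h) \<Rightarrow> ('g \<Rightarrow> 'r) \<Rightarrow> 'h \<Rightarrow> 'r" where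
  "push_forward R \<phi> f = (\<lambda>h. \<Oplus>\<^bsub>R\<^esub>g \<in> {g. f g \<noteq> \<zero>\<^bsub>R\<^esub> \<and> \<phi> g = h}. f g)"

definition quotient_algebra :: "('r, 'f, 'x) module_scheme \<Rightarrow> 'f set \<Rightarrow> ('r, 'f set) module" where
  "quotient_algebra F I =
    \<lparr>carrier = carrier (F Quot I), mult = mult (F Quot I), one = one (F Quot I),
     zero = zero (F Quot I), add = add (F Quot I),
     smult = (\<lambda>r X. I <+>\<^bsub>F\<^esub> ((\<lambda>f. r \<odot>\<^bsub>F\<^esub> f) ` X))\<rparr>"

text \<open>The map of quotients \<open>F/J \<rightarrow> F'/I\<close> induced by \<open>h : F \<rightarrow> F'\<close>, if \<open>h\<close> maps \<open>J\<close> into \<open>I\<close>.\<close>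

definition quotient_map :: "('f, 'x) ring_scheme \<Rightarrow> 'f set \<Rightarrow> ('e \<Rightarrow> 'f) \<Rightarrow> 'e set \<Rightarrow> 'f set" where
  "quotient_map F' I h X = I <+>\<^bsub>F'\<^esub> (h ` X)"

subsection \<open>Tensor products and the enveloping algebra\<close>

definition pairs_algebra ::
  "('r, 'x) ring_scheme \<Rightarrow> ('r, 'a) module \<Rightarrow> ('r, 'b) module \<Rightarrow> ('r, 'a \<times> 'b \<Rightarrow> 'r) module" where
  "pairs_algebra R A B = monoid_algebra R (A \<times>\<times> B)"

definition bilinear_rels ::
  "('r, 'x) ring_scheme \<Rightarrow> ('r, 'a) module \<Rightarrow> ('r, 'b) module \<Rightarrow> ('a \<times> 'b \<Rightarrow> 'r) set" where
  "bilinear_rels R A B =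
    (let F = pairs_algebra R A B; \<delta> = (\<lambda>a b. basis_el R (a, b)) in
      {\<delta> (a \<oplus>\<^bsub>A\<^esub> a') b \<ominus>\<^bsub>F\<^esub> (\<delta> a b \<oplus>\<^bsub>F\<^esub> \<delta> a' b) | a a' b.
          a \<in> carrier A \<and> a' \<in> carrier A \<and> b \<in> carrier B} \<union>
      {\<delta> a (b \<oplus>\<^bsub>B\<^esub> b') \<ominus>\<^bsub>F\<^esub> (\<delta> a b \<oplus>\<^bsub>F\<^esub> \<delta> a b') | a b b'.
          a \<in> carrier A \<and> b \<in> carrier B \<and> b' \<in> carrier B} \<union>
      {\<delta> (r \<odot>\<^bsub>A\<^esub> a) b \<ominus>\<^bsub>F\<^esub> (r \<odot>\<^bsub>F\<^esub> \<delta> a b) | r a b.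
          r \<in> carrier R \<and> a \<in> carrier A \<and> b \<in> carrier B} \<union>
      {\<delta> a (r \<odot>\<^bsub>B\<^esub> b) \<ominus>\<^bsub>F\<^esub> (r \<odot>\<^bsub>F\<^esub> \<delta> a b) | r a b.
          r \<in> carrier R \<and> a \<in> carrier A \<and> b \<in> carrier B})"

text \<open>The tensor product of two algebras: the free module on pairs modulo bilinearity, with the
  componentwise product. Left and right multiplication by a pair maps each bilinear relation to a
  bilinear relation, so the ideal taken here coincides with the \<open>R\<close>-submodule spanned by them.\<close>

definition tensor_ideal where
  "tensor_ideal R A B = Idl\<^bsub>pairs_algebra R A B\<^esub> (bilinear_rels R A B)"

definition tensor_algebra ::
  "('r, 'x) ring_scheme \<Rightarrow> ('r, 'a) module \<Rightarrow> ('r, 'b) module \<Rightarrow> ('r, ('a \<times> 'b \<Rightarrow> 'r) set) module" where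
  "tensor_algebra R A B = quotient_algebra (pairs_algebra R A B) (tensor_ideal R A B)"

definition pure_tensor ::
  "('r, 'x) ring_scheme \<Rightarrow> ('r, 'a) module \<Rightarrow> ('r, 'b) module \<Rightarrow> 'a \<Rightarrow> 'b \<Rightarrow> ('a \<times> 'b \<Rightarrow> 'r) set" where
  "pure_tensor R A B a b = tensor_ideal R A B +>\<^bsub>pairs_algebra R A B\<^esub> basis_el R (a, b)"

text \<open>\<open>f \<otimes> g\<close>, as a map into the tensor product of \<open>A\<close> and \<open>B\<close>.\<close>

definition tensor_map ::
  "('r, 'x) ring_scheme \<Rightarrow> ('r, 'a) module \<Rightarrow> ('r, 'b) module \<Rightarrow> ('c \<Rightarrow> 'a) \<Rightarrow> ('d \<Rightarrow> 'b)
    \<Rightarrow> ('c \<times> 'd \<Rightarrow> 'r) set \<Rightarrow> ('a \<times> 'b \<Rightarrow> 'r) set" where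
  "tensor_map R A B f g =
    quotient_map (pairs_algebra R A B) (tensor_ideal R A B) (push_forward R (map_prod f g))"

definition env_alg ::
  "('r, 'x) ring_scheme \<Rightarrow> ('r, 'a) module \<Rightarrow> ('r, ('a \<times> 'a \<Rightarrow> 'r) set) module" where
  "env_alg R A = tensor_algebra R A (opp_alg A)"

abbreviation env_tensor where
  "env_tensor R A \<equiv> pure_tensor R A (opp_alg A)"

abbreviation env_alg_map where
  "env_alg_map R A f \<equiv> tensor_map R A (opp_alg A) f f"

section \<open>The \<open>n\<close>-ary algebra \<open>T(A, \<sigma>, c)\<close>\<close>

locale cyclic_datum = assoc_algebra R A
  for R (structure) and m :: nat and A (structure) +
  fixes \<sigma> :: "'a \<Rightarrow> 'a" and c :: 'a
  constrains R :: "('r, 'x) ring_scheme" and A :: "('r, 'a) module"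
  assumes m_ge_2: "2 \<le> m"
    and c_unit: "c \<in> Units A"
    and \<sigma>_aut: "\<sigma> \<in> alg_iso R A A"
    and \<sigma>_c: "\<sigma> c = c"
    and \<sigma>_pow_m: "a \<in> carrier A \<Longrightarrow> (\<sigma> ^^ m) a = c \<otimes>\<^bsub>A\<^esub> a \<otimes>\<^bsub>A\<^esub> inv\<^bsub>A\<^esub> c"

definition datum_morphism where
  "datum_morphism R A \<sigma> c B \<tau> d f \<longleftrightarrow>
     f \<in> alg_hom R A B \<and> (\<forall>a \<in> carrier A. f (\<sigma> a) = \<tau> (f a)) \<and> f c = d"

text \<open>\<open>twisted_prod A \<sigma> j [b\<^sub>0, \<dots>, b\<^sub>k] = \<sigma>\<^sup>j(b\<^sub>0) \<sigma>\<^sup>j\<^sup>+\<^sup>1(b\<^sub>1) \<cdots> \<sigma>\<^sup>j\<^sup>+\<^sup>k(b\<^sub>k)\<close>.\<close>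

definition twisted_prod :: "('a, 'x) monoid_scheme \<Rightarrow> ('a \<Rightarrow> 'a) \<Rightarrow> nat \<Rightarrow> 'a list \<Rightarrow> 'a" where
  "twisted_prod A \<sigma> j as =
     foldr (\<lambda>x y. x \<otimes>\<^bsub>A\<^esub> y) (map (\<lambda>l. (\<sigma> ^^ (j + l)) (as ! l)) [0..<length as]) \<one>\<^bsub>A\<^esub>"

definition nary_mult :: "('a, 'x) monoid_scheme \<Rightarrow> ('a \<Rightarrow> 'a) \<Rightarrow> 'a \<Rightarrow> 'a list \<Rightarrow> 'a" where
  "nary_mult A \<sigma> c as = twisted_prod A \<sigma> 0 (butlast as) \<otimes>\<^bsub>A\<^esub> c \<otimes>\<^bsub>A\<^esub> last as"

section \<open>One-hole contexts\<close>

datatype 'a ctx = Hole | Leaf 'a | Node "'a ctx list"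

fun full :: "nat \<Rightarrow> 'a ctx \<Rightarrow> bool" where
  "full n (Node ts) \<longleftrightarrow> length ts = n \<and> (\<forall>t \<in> set ts. full n t)"
| "full n _ \<longleftrightarrow> True"

fun holes :: "'a ctx \<Rightarrow> nat" where
  "holes Hole = 1"
| "holes (Leaf a) = 0"
| "holes (Node ts) = sum_list (map holes ts)"

definition contexts :: "('a, 'x) partial_object_scheme \<Rightarrow> nat \<Rightarrow> 'a ctx set" where
  "contexts A n = {t. full n t \<and> holes t = 1 \<and> set_ctx t \<subseteq> carrier A}"

fun graft :: "'a ctx \<Rightarrow> 'a ctx \<Rightarrow> 'a ctx" where
  "graft Hole D = D"
| "graft (Leaf a) D = Leaf a"
| "graft (Node ts) D = Node (map (\<lambda>t. graft t D) ts)"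

definition ctx_monoid :: "('a, 'x) partial_object_scheme \<Rightarrow> nat \<Rightarrow> 'a ctx monoid" where
  "ctx_monoid A n = \<lparr>carrier = contexts A n, mult = graft, one = Hole\<rparr>"

text \<open>The elementary relations between trees, each applied at an arbitrary place of the tree.
  Arities and labels are controlled by requiring all trees involved to lie in \<^const>\<open>contexts\<close>.\<close>

inductive rebracket :: "'a ctx \<Rightarrow> 'a ctx \<Rightarrow> bool" where
  move: "\<lbrakk>us @ vs @ ws = us' @ vs' @ ws'; length vs = length vs'\<rbrakk>
    \<Longrightarrow> rebracket (Node (us @ Node vs # ws)) (Node (us' @ Node vs' # ws'))"
| inside: "rebracket t t' \<Longrightarrow> rebracket (Node (us @ t # ws)) (Node (us @ t' # ws))"

inductive contract :: "('a list \<Rightarrow> 'a) \<Rightarrow> 'a ctx \<Rightarrow> 'a ctx \<Rightarrow> bool" for \<mu> where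
  vertex: "contract \<mu> (Node (map Leaf as)) (Leaf (\<mu> as))"
| inside: "contract \<mu> t t' \<Longrightarrow> contract \<mu> (Node (us @ t # ws)) (Node (us @ t' # ws))"

inductive leaf_sum :: "('a, 'x) ring_scheme \<Rightarrow> 'a ctx \<Rightarrow> 'a ctx \<Rightarrow> 'a ctx \<Rightarrow> bool" for A where
  leaf: "leaf_sum A (Leaf (a \<oplus>\<^bsub>A\<^esub> b)) (Leaf a) (Leaf b)"
| inside: "leaf_sum A t t1 t2
    \<Longrightarrow> leaf_sum A (Node (us @ t # ws)) (Node (us @ t1 # ws)) (Node (us @ t2 # ws))"

inductive leaf_smult :: "('r, 'a, 'x) module_scheme \<Rightarrow> 'r \<Rightarrow> 'a ctx \<Rightarrow> 'a ctx \<Rightarrow> bool" for A r where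
  leaf: "leaf_smult A r (Leaf (r \<odot>\<^bsub>A\<^esub> a)) (Leaf a)"
| inside: "leaf_smult A r t t' \<Longrightarrow> leaf_smult A r (Node (us @ t # ws)) (Node (us @ t' # ws))"

text \<open>The one-vertex context with inputs \<open>(a\<^sub>0, \<dots>, a\<^sub>i\<^sub>-\<^sub>1, \<star>, a\<^sub>i\<^sub>+\<^sub>1, \<dots>, a\<^sub>m)\<close>, where
  \<open>as = [a\<^sub>0, \<dots>, a\<^sub>i\<^sub>-\<^sub>1]\<close> and \<open>bs = [a\<^sub>i\<^sub>+\<^sub>1, \<dots>, a\<^sub>m]\<close>.\<close>

definition slot_ctx :: "'a list \<Rightarrow> 'a list \<Rightarrow> 'a ctx" where
  "slot_ctx as bs = Node (map Leaf as @ Hole # map Leaf bs)"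

definition slot_args :: "('a, 'x) partial_object_scheme \<Rightarrow> nat \<Rightarrow> 'a list \<Rightarrow> 'a list \<Rightarrow> bool" where
  "slot_args A m as bs \<longleftrightarrow>
     set as \<subseteq> carrier A \<and> set bs \<subseteq> carrier A \<and> length as + length bs = m"

section \<open>The endpoint-anchored envelope\<close>

definition ctx_algebra ::
  "('r, 'x) ring_scheme \<Rightarrow> nat \<Rightarrow> ('r, 'a) module \<Rightarrow> ('r, 'a ctx \<Rightarrow> 'r) module" where
  "ctx_algebra R m A = monoid_algebra R (ctx_monoid A (Suc m))"

definition envelope_rels ::
  "('r, 'x) ring_scheme \<Rightarrow> nat \<Rightarrow> ('r, 'a) module \<Rightarrow> ('a \<Rightarrow> 'a) \<Rightarrow> 'a \<Rightarrow> ('a ctx \<Rightarrow> 'r) set" where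
  "envelope_rels R m A \<sigma> c =
    (let F = ctx_algebra R m A; K = contexts A (Suc m); \<delta> = basis_el R in
      {\<delta> t \<ominus>\<^bsub>F\<^esub> (\<delta> t1 \<oplus>\<^bsub>F\<^esub> \<delta> t2) | t t1 t2. t \<in> K \<and> t1 \<in> K \<and> t2 \<in> K \<and> leaf_sum A t t1 t2} \<union>
      {\<delta> t \<ominus>\<^bsub>F\<^esub> (r \<odot>\<^bsub>F\<^esub> \<delta> t') | r t t'. r \<in> carrier R \<and> t \<in> K \<and> t' \<in> K \<and> leaf_smult A r t t'} \<union>
      {\<delta> t \<ominus>\<^bsub>F\<^esub> \<delta> t' | t t'. t \<in> K \<and> t' \<in> K \<and> contract (nary_mult A \<sigma> c) t t'} \<union>
      {\<delta> t \<ominus>\<^bsub>F\<^esub> \<delta> t' | t t'. t \<in> K \<and> t' \<in> K \<and> rebracket t t'})"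

definition anchor_rels ::
  "('r, 'x) ring_scheme \<Rightarrow> nat \<Rightarrow> ('r, 'a) module \<Rightarrow> 'a \<Rightarrow> ('a ctx \<Rightarrow> 'r) set" where
  "anchor_rels R m A c =
    (let F = ctx_algebra R m A in
      {basis_el R (slot_ctx [] (replicate (m - 1) \<one>\<^bsub>A\<^esub> @ [inv\<^bsub>A\<^esub> c])) \<ominus>\<^bsub>F\<^esub> \<one>\<^bsub>F\<^esub>,
       basis_el R (slot_ctx (inv\<^bsub>A\<^esub> c # replicate (m - 1) \<one>\<^bsub>A\<^esub>) []) \<ominus>\<^bsub>F\<^esub> \<one>\<^bsub>F\<^esub>})"

text \<open>Since the relations \<^const>\<open>envelope_rels\<close> are imposed at every place of a tree, grafting maps
  them to relations of the same form and their linear span is already an ideal. Hence dividing out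
  that span first and then the ideal generated by the anchoring relations amounts to a single
  quotient by the ideal generated by all of them.\<close>

definition envelope_ideal where
  "envelope_ideal R m A \<sigma> c =
     Idl\<^bsub>ctx_algebra R m A\<^esub> (envelope_rels R m A \<sigma> c \<union> anchor_rels R m A c)"

definition anchored_envelope ::
  "('r, 'x) ring_scheme \<Rightarrow> nat \<Rightarrow> ('r, 'a) module \<Rightarrow> ('a \<Rightarrow> 'a) \<Rightarrow> 'a
    \<Rightarrow> ('r, ('a ctx \<Rightarrow> 'r) set) module" where
  "anchored_envelope R m A \<sigma> c =
     quotient_algebra (ctx_algebra R m A) (envelope_ideal R m A \<sigma> c)"

definition ctx_class ::
  "('r, 'x) ring_scheme \<Rightarrow> nat \<Rightarrow> ('r, 'a) module \<Rightarrow> ('a \<Rightarrow> 'a) \<Rightarrow> 'a \<Rightarrow> 'a ctx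
    \<Rightarrow> ('a ctx \<Rightarrow> 'r) set" where
  "ctx_class R m A \<sigma> c t = envelope_ideal R m A \<sigma> c +>\<^bsub>ctx_algebra R m A\<^esub> basis_el R t"

text \<open>The map into the envelope of \<open>(B, \<tau>, d)\<close> obtained by applying \<open>f\<close> to the leaf labels.\<close>

definition envelope_map ::
  "('r, 'x) ring_scheme \<Rightarrow> nat \<Rightarrow> ('r, 'b) module \<Rightarrow> ('b \<Rightarrow> 'b) \<Rightarrow> 'b \<Rightarrow> ('a \<Rightarrow> 'b)
    \<Rightarrow> ('a ctx \<Rightarrow> 'r) set \<Rightarrow> ('b ctx \<Rightarrow> 'r) set" where
  "envelope_map R m B \<tau> d f =
     quotient_map (ctx_algebra R m B) (envelope_ideal R m B \<tau> d) (push_forward R (map_ctx f))"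

section \<open>The cyclic crossed product\<close>

text \<open>The element \<open>\<Sum>\<^sub>r x\<^sub>r u\<^sup>r\<close> is represented by the function \<open>r \<mapsto> x\<^sub>r\<close> on \<open>{..<m}\<close>.\<close>

definition crossed_product ::
  "('r, 'x) ring_scheme \<Rightarrow> nat \<Rightarrow> ('r, 'a) module \<Rightarrow> ('a \<Rightarrow> 'a) \<Rightarrow> 'a
    \<Rightarrow> ('r, nat \<Rightarrow> ('a \<times> 'a \<Rightarrow> 'r) set) module" where
  "crossed_product R m A \<sigma> c =
    (let E = env_alg R A; \<sigma>e = env_alg_map R A \<sigma>; z = env_tensor R A c (inv\<^bsub>A\<^esub> c) in
      \<lparr>carrier = {..<m} \<rightarrow>\<^sub>E carrier E,
       mult = (\<lambda>x y. \<lambda>t\<in>{..<m}.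
         \<Oplus>\<^bsub>E\<^esub>p \<in> {(r, s). r < m \<and> s < m \<and> r + s - (r + s) div m * m = t}.
           x (fst p) \<otimes>\<^bsub>E\<^esub> (\<sigma>e ^^ fst p) (y (snd p)) \<otimes>\<^bsub>E\<^esub> z [^]\<^bsub>E\<^esub> ((fst p + snd p) div m)),
       one = (\<lambda>t\<in>{..<m}. if t = 0 then \<one>\<^bsub>E\<^esub> else \<zero>\<^bsub>E\<^esub>),
       zero = (\<lambda>t\<in>{..<m}. \<zero>\<^bsub>E\<^esub>),
       add = (\<lambda>x y. \<lambda>t\<in>{..<m}. x t \<oplus>\<^bsub>E\<^esub> y t),
       smult = (\<lambda>k x. \<lambda>t\<in>{..<m}. k \<odot>\<^bsub>E\<^esub> x t)\<rparr>)"

text \<open>The element \<open>x u\<^sup>r\<close>, for \<open>r < m\<close>.\<close>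

definition crossed_monom ::
  "('r, 'x) ring_scheme \<Rightarrow> nat \<Rightarrow> ('r, 'a) module \<Rightarrow> ('a \<times> 'a \<Rightarrow> 'r) set \<Rightarrow> nat
    \<Rightarrow> nat \<Rightarrow> ('a \<times> 'a \<Rightarrow> 'r) set" where
  "crossed_monom R m A x r = (\<lambda>t\<in>{..<m}. if t = r then x else \<zero>\<^bsub>env_alg R A\<^esub>)"

definition crossed_map ::
  "('r, 'x) ring_scheme \<Rightarrow> nat \<Rightarrow> ('r, 'b) module \<Rightarrow> ('a \<Rightarrow> 'b)
    \<Rightarrow> (nat \<Rightarrow> ('a \<times> 'a \<Rightarrow> 'r) set) \<Rightarrow> nat \<Rightarrow> ('b \<times> 'b \<Rightarrow> 'r) set" where
  "crossed_map R m B f x = (\<lambda>t\<in>{..<m}. env_alg_map R B f (x t))"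

text \<open>The tensor \<open>p\<^sub>i \<otimes> q\<^sub>i\<close>, where \<open>i = length as\<close>.\<close>

definition slot_tensor ::
  "('r, 'x) ring_scheme \<Rightarrow> ('r, 'a) module \<Rightarrow> ('a \<Rightarrow> 'a) \<Rightarrow> 'a \<Rightarrow> 'a list \<Rightarrow> 'a list
    \<Rightarrow> ('a \<times> 'a \<Rightarrow> 'r) set" where
  "slot_tensor R A \<sigma> c as bs =
     env_tensor R A (twisted_prod A \<sigma> 0 as) (twisted_prod A \<sigma> (Suc (length as)) bs \<otimes>\<^bsub>A\<^esub> c)"

text \<open>The isomorphism is normalised by its values \<open>(p\<^sub>i \<otimes> q\<^sub>i) u\<^sup>i\<close> on the one-vertex contexts,
  which generate the envelope. Note that \<open>i = m\<close> is possible, so that \<open>u\<^sup>i\<close> is a power in the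
  crossed product.\<close>

definition canonical_iso ::
  "('r, 'x) ring_scheme \<Rightarrow> nat \<Rightarrow> ('r, 'a) module \<Rightarrow> ('a \<Rightarrow> 'a) \<Rightarrow> 'a
    \<Rightarrow> (('a ctx \<Rightarrow> 'r) set \<Rightarrow> nat \<Rightarrow> ('a \<times> 'a \<Rightarrow> 'r) set) \<Rightarrow> bool" where
  "canonical_iso R m A \<sigma> c \<Phi> \<longleftrightarrow>
    (let C = crossed_product R m A \<sigma> c; u = crossed_monom R m A \<one>\<^bsub>env_alg R A\<^esub> 1 in
      \<Phi> \<in> alg_iso R (anchored_envelope R m A \<sigma> c) C \<and>
      (\<forall>as bs. slot_args A m as bs \<longrightarrow>
         \<Phi> (ctx_class R m A \<sigma> c (slot_ctx as bs)) =
           crossed_monom R m A (slot_tensor R A \<sigma> c as bs) 0 \<otimes>\<^bsub>C\<^esub> u [^]\<^bsub>C\<^esub> length as))"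

section \<open>Slot modules\<close>

text \<open>The family of slot operations is encoded as a single function:
  \<open>\<lambda>\<^sub>i(a\<^sub>0, \<dots>, a\<^sub>i\<^sub>-\<^sub>1, x, a\<^sub>i\<^sub>+\<^sub>1, \<dots>, a\<^sub>m)\<close> is \<open>lam [a\<^sub>0, \<dots>, a\<^sub>i\<^sub>-\<^sub>1] x [a\<^sub>i\<^sub>+\<^sub>1, \<dots>, a\<^sub>m]\<close>.
  Only its values at arguments with \<^const>\<open>slot_args\<close> are meaningful.

  A word with exactly one entry \<open>x\<close> of \<open>M\<close> is a one-hole context with \<open>x\<close> in the hole; its
  evaluation assigns to every subtree an element of \<open>A\<close> (\<^const>\<open>Inl\<close>) or of \<open>M\<close> (\<^const>\<open>Inr\<close>).\<close>

definition eval_vertex ::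
  "('a list \<Rightarrow> 'a) \<Rightarrow> ('a list \<Rightarrow> 'm \<Rightarrow> 'a list \<Rightarrow> 'm) \<Rightarrow> ('a + 'm) list \<Rightarrow> 'a + 'm" where
  "eval_vertex \<mu> lam vs =
    (if list_all isl vs then Inl (\<mu> (map projl vs))
     else let rest = dropWhile isl vs in
       Inr (lam (map projl (takeWhile isl vs)) (projr (hd rest)) (map projl (tl rest))))"

fun eval_ctx ::
  "('a list \<Rightarrow> 'a) \<Rightarrow> ('a list \<Rightarrow> 'm \<Rightarrow> 'a list \<Rightarrow> 'm) \<Rightarrow> 'm \<Rightarrow> 'a ctx \<Rightarrow> 'a + 'm" where
  "eval_ctx \<mu> lam x Hole = Inr x"
| "eval_ctx \<mu> lam x (Leaf a) = Inl a"
| "eval_ctx \<mu> lam x (Node ts) = eval_vertex \<mu> lam (map (eval_ctx \<mu> lam x) ts)"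

locale slot_module = cyclic_datum R m A \<sigma> c + M: module R M
  for R (structure) and m and A (structure) and \<sigma> c and M (structure) +
  fixes lam :: "'a list \<Rightarrow> 'm \<Rightarrow> 'a list \<Rightarrow> 'm"
  constrains R :: "('r, 'x) ring_scheme" and A :: "('r, 'a) module" and M :: "('r, 'm) module"
  assumes lam_closed: "\<lbrakk>slot_args A m as bs; x \<in> carrier M\<rbrakk> \<Longrightarrow> lam as x bs \<in> carrier M"
    and lam_add: "\<lbrakk>slot_args A m as bs; x \<in> carrier M; y \<in> carrier M\<rbrakk>
      \<Longrightarrow> lam as (x \<oplus>\<^bsub>M\<^esub> y) bs = lam as x bs \<oplus>\<^bsub>M\<^esub> lam as y bs"
    and lam_smult: "\<lbrakk>slot_args A m as bs; r \<in> carrier R; x \<in> carrier M\<rbrakk>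
      \<Longrightarrow> lam as (r \<odot>\<^bsub>M\<^esub> x) bs = r \<odot>\<^bsub>M\<^esub> lam as x bs"
    and lam_add_left: "\<lbrakk>slot_args A m (as @ a # as') bs; b \<in> carrier A; x \<in> carrier M\<rbrakk>
      \<Longrightarrow> lam (as @ (a \<oplus>\<^bsub>A\<^esub> b) # as') x bs = lam (as @ a # as') x bs \<oplus>\<^bsub>M\<^esub> lam (as @ b # as') x bs"
    and lam_smult_left: "\<lbrakk>slot_args A m (as @ a # as') bs; r \<in> carrier R; x \<in> carrier M\<rbrakk>
      \<Longrightarrow> lam (as @ (r \<odot>\<^bsub>A\<^esub> a) # as') x bs = r \<odot>\<^bsub>M\<^esub> lam (as @ a # as') x bs"
    and lam_add_right: "\<lbrakk>slot_args A m as (bs @ a # bs'); b \<in> carrier A; x \<in> carrier M\<rbrakk>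
      \<Longrightarrow> lam as x (bs @ (a \<oplus>\<^bsub>A\<^esub> b) # bs') = lam as x (bs @ a # bs') \<oplus>\<^bsub>M\<^esub> lam as x (bs @ b # bs')"
    and lam_smult_right: "\<lbrakk>slot_args A m as (bs @ a # bs'); r \<in> carrier R; x \<in> carrier M\<rbrakk>
      \<Longrightarrow> lam as x (bs @ (r \<odot>\<^bsub>A\<^esub> a) # bs') = r \<odot>\<^bsub>M\<^esub> lam as x (bs @ a # bs')"
    and total_assoc:
      "\<lbrakk>t \<in> contexts A (Suc m); t' \<in> contexts A (Suc m); rebracket t t'; x \<in> carrier M\<rbrakk>
      \<Longrightarrow> eval_ctx (nary_mult A \<sigma> c) lam x t = eval_ctx (nary_mult A \<sigma> c) lam x t'"

locale anchored_slot_module = slot_module R m A \<sigma> c M lam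
  for R (structure) and m and A (structure) and \<sigma> c and M (structure) and lam +
  assumes anchor_first: "x \<in> carrier M
      \<Longrightarrow> lam [] x (replicate (m - 1) \<one>\<^bsub>A\<^esub> @ [inv\<^bsub>A\<^esub> c]) = x"
    and anchor_last: "x \<in> carrier M
      \<Longrightarrow> lam (inv\<^bsub>A\<^esub> c # replicate (m - 1) \<one>\<^bsub>A\<^esub>) x [] = x"

definition slot_morphism where
  "slot_morphism R m A M lam N lam' f \<longleftrightarrow> f \<in> lin_map R M N \<and>
     (\<forall>as bs. \<forall>x \<in> carrier M. slot_args A m as bs \<longrightarrow> f (lam as x bs) = lam' as (f x) bs)"

section \<open>Bimodules with a twisting operator\<close>

text \<open>Bimodules over \<open>A\<close> are modules over \<^const>\<open>env_alg\<close>, the two-sided product \<open>a x b\<close> being the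
  action of \<open>a \<otimes> b\<close> on \<open>x\<close>.\<close>

locale twisted_bimodule = cyclic_datum R m A \<sigma> c + E: alg_module R "env_alg R A" M act
  for R (structure) and m and A (structure) and \<sigma> c and M (structure) and act +
  fixes S :: "'m \<Rightarrow> 'm"
  constrains R :: "('r, 'x) ring_scheme" and A :: "('r, 'a) module" and M :: "('r, 'm) module"
  assumes S_linear: "S \<in> lin_map R M M"
    and S_bij: "bij_betw S (carrier M) (carrier M)"
    and S_semilinear: "\<lbrakk>a \<in> carrier A; b \<in> carrier A; x \<in> carrier M\<rbrakk>
      \<Longrightarrow> S (act (env_tensor R A a b) x) = act (env_tensor R A (\<sigma> a) (\<sigma> b)) (S x)"
    and S_pow_m: "x \<in> carrier M \<Longrightarrow> (S ^^ m) x = act (env_tensor R A c (inv\<^bsub>A\<^esub> c)) x"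

definition bimodule_morphism where
  "bimodule_morphism R A M act S N act' S' f \<longleftrightarrow> f \<in> lin_map R M N \<and>
     (\<forall>e \<in> carrier (env_alg R A). \<forall>x \<in> carrier M. f (act e x) = act' e (f x)) \<and>
     (\<forall>x \<in> carrier M. f (S x) = S' (f x))"

text \<open>The slot operations \<open>x \<mapsto> p\<^sub>i S\<^sup>i(x) q\<^sub>i\<close>.\<close>

definition slot_action ::
  "('r, 'x) ring_scheme \<Rightarrow> ('r, 'a) module \<Rightarrow> ('a \<Rightarrow> 'a) \<Rightarrow> 'a
    \<Rightarrow> (('a \<times> 'a \<Rightarrow> 'r) set \<Rightarrow> 'm \<Rightarrow> 'm) \<Rightarrow> ('m \<Rightarrow> 'm) \<Rightarrow> 'a list \<Rightarrow> 'm \<Rightarrow> 'a list \<Rightarrow> 'm" where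
  "slot_action R A \<sigma> c act S as x bs = act (slot_tensor R A \<sigma> c as bs) ((S ^^ length as) x)"

end

theory Submission
  imports Defs
begin

text \<open>Write \<open>E\<close> for the enveloping algebra \<open>A \<otimes> A\<^sup>o\<^sup>p\<close>, \<open>C\<close> for the crossed product and \<open>U\<close> for the
  anchored envelope. The isomorphism is constructed in both directions, and the statements about
  slot modules are read off from it.

  \<^emph>\<open>From \<open>U\<close> to \<open>C\<close>.\<close> Let \<open>M\<close> be a bimodule with a twisting operator \<open>S\<close>. If the slot operations are
  defined by \<open>p\<^sub>i S\<^sup>i(x) q\<^sub>i\<close>, the value of a bracketed word is \<open>p S\<^sup>l(x) q\<close>, where \<open>l\<close> is the number of labels
  left of \<open>x\<close>, and \<open>p\<close> and \<open>q\<close> are twisted products of the labels, \<open>q\<close> being multiplied by one factor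
  \<open>c\<close> for each vertex (\<open>eval_ctx_eq\<close>). The reason is that \<open>c\<close> moves to the right past a label at
  the price of \<open>\<sigma>\<^sup>m\<close>, and past \<open>S\<^sup>l(x)\<close> at the price of \<open>S\<^sup>m\<close>, which are exactly the shifts caused by
  replacing one input of a vertex by the \<open>m + 1\<close> inputs of another vertex. So the value does not depend on the
  bracketing, and \<open>M\<close> is an anchored slot module. Anchored slot modules are representations of \<open>U\<close>
  (\<open>envelope_representation\<close>). Applied to \<open>C\<close>, on which \<open>E\<close> and \<open>u\<close> act by left
  multiplication, this gives an action of \<open>U\<close> on \<open>C\<close> commuting with right multiplications, that
  is, a homomorphism \<open>\<Phi>\<close> from \<open>U\<close> to \<open>C\<close> with the prescribed values (\<open>U_to_C\<close>).

  \<^emph>\<open>From \<open>C\<close> to \<open>U\<close>.\<close> The product of two one-vertex contexts can be rebracketed so that the inner vertex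
  has no hole and can be contracted (\<open>sl_mult_contract_left\<close>, \<open>sl_mult_contract_right\<close>). With the anchoring
  relations this shows that the contexts \<open>(a c\<inverse>, 1, \<dots>, 1, \<star>)\<close>, \<open>(\<star>, 1, \<dots>, 1, c\<inverse> b)\<close> and
  \<open>(1, \<star>, 1, \<dots>, 1, c\<inverse>)\<close> satisfy the relations of \<open>a \<otimes> 1\<close>, \<open>1 \<otimes> b\<close> and \<open>u\<close> in \<open>C\<close>, and that they
  generate all one-vertex contexts (\<open>sl_generated\<close>), hence \<open>U\<close>. The presentation of \<open>C\<close>
  (\<open>C_lift\<close>) then gives a surjective homomorphism \<open>\<psi>\<close> from \<open>C\<close> to \<open>U\<close>, and \<open>\<Phi> \<psi> = id\<close> is checked on generators.

  \<^emph>\<open>Consequences.\<close> Naturality holds because homomorphisms from \<open>U\<close> are determined by their values on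
  one-vertex contexts (\<open>alg_hom_eq_on_slots\<close>). An anchored slot module is a representation of \<open>U\<close>, thus
  of \<open>C\<close>, and this is a bimodule with a twisting operator (\<open>twisted_bimodule_exists\<close>). Uniqueness
  and the comparison of morphisms hold because the two-sided action and \<open>S\<close> are composites of slot
  operations (\<open>act_eq_lam\<close>, \<open>S_eq_lam\<close>).\<close>

section \<open>Linear spans and homomorphisms\<close>

inductive_set lin_span ::
  "('r, 'x) ring_scheme \<Rightarrow> ('r, 'b, 'y) module_scheme \<Rightarrow> 'b set \<Rightarrow> 'b set"
  for R and B (structure) and S where
  zero: "\<zero> \<in> lin_span R B S"
| base: "s \<in> S \<Longrightarrow> s \<in> lin_span R B S"
| add: "\<lbrakk>x \<in> lin_span R B S; y \<in> lin_span R B S\<rbrakk> \<Longrightarrow> x \<oplus> y \<in> lin_span R B S"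
| smult: "\<lbrakk>r \<in> carrier R; x \<in> lin_span R B S\<rbrakk> \<Longrightarrow> r \<odot> x \<in> lin_span R B S"

lemma lin_mapI:
  assumes "\<And>x. x \<in> carrier M \<Longrightarrow> h x \<in> carrier N"
    and "\<And>x y. \<lbrakk>x \<in> carrier M; y \<in> carrier M\<rbrakk> \<Longrightarrow> h (x \<oplus>\<^bsub>M\<^esub> y) = h x \<oplus>\<^bsub>N\<^esub> h y"
    and "\<And>r x. \<lbrakk>r \<in> carrier R; x \<in> carrier M\<rbrakk> \<Longrightarrow> h (r \<odot>\<^bsub>M\<^esub> x) = r \<odot>\<^bsub>N\<^esub> h x"
  shows "h \<in> lin_map R M N"
  using assms by (auto simp: lin_map_def)

lemma lin_mapD:
  assumes "h \<in> lin_map R M N"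
  shows "x \<in> carrier M \<Longrightarrow> h x \<in> carrier N"
    and "\<lbrakk>x \<in> carrier M; y \<in> carrier M\<rbrakk> \<Longrightarrow> h (x \<oplus>\<^bsub>M\<^esub> y) = h x \<oplus>\<^bsub>N\<^esub> h y"
    and "\<lbrakk>r \<in> carrier R; x \<in> carrier M\<rbrakk> \<Longrightarrow> h (r \<odot>\<^bsub>M\<^esub> x) = r \<odot>\<^bsub>N\<^esub> h x"
  using assms by (auto simp: lin_map_def)

lemma lin_map_comp:
  assumes "h \<in> lin_map R M N" "k \<in> lin_map R N L"
  shows "(\<lambda>x. k (h x)) \<in> lin_map R M L"
  using assms by (intro lin_mapI) (simp_all add: lin_mapD)

lemma lin_map_zero:
  assumes "h \<in> lin_map R M N" "module R M" "module R N"
  shows "h \<zero>\<^bsub>M\<^esub> = \<zero>\<^bsub>N\<^esub>"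
proof -
  interpret M: module R M by fact
  interpret N: module R N by fact
  have "h (\<zero>\<^bsub>R\<^esub> \<odot>\<^bsub>M\<^esub> \<zero>\<^bsub>M\<^esub>) = \<zero>\<^bsub>R\<^esub> \<odot>\<^bsub>N\<^esub> h \<zero>\<^bsub>M\<^esub>"
    by (rule lin_mapD(3)[OF assms(1)]) auto
  then show ?thesis
    using lin_mapD(1)[OF assms(1)] by simp
qed

lemma lin_span_closed:
  assumes "module R B" "S \<subseteq> carrier B"
  shows "lin_span R B S \<subseteq> carrier B"
proof
  interpret B: module R B by fact
  fix x assume "x \<in> lin_span R B S"
  then show "x \<in> carrier B"
    by induction (use assms(2) in auto)
qed

lemma lin_map_eq_on_span:
  assumes "module R M" "module R N" "S \<subseteq> carrier M"
    and "h \<in> lin_map R M N" "k \<in> lin_map R M N" "\<And>s. s \<in> S \<Longrightarrow> h s = k s"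
    and "x \<in> lin_span R M S"
  shows "h x = k x"
  using assms(7)
proof induction
  case zero
  then show ?case using lin_map_zero assms(1,2,4,5) by metis
next
  case (add x y)
  then show ?case
    using lin_span_closed[OF assms(1,3)] by (simp add: lin_mapD[OF assms(4)] lin_mapD[OF assms(5)] subset_iff)
next
  case (smult r x)
  then show ?case
    using lin_span_closed[OF assms(1,3)] by (simp add: lin_mapD[OF assms(4)] lin_mapD[OF assms(5)] subset_iff)
qed (use assms(6) in auto)

lemma lin_map_span:
  assumes "module R M" "module R N" "S \<subseteq> carrier M"
    and "h \<in> lin_map R M N" "\<And>s. s \<in> S \<Longrightarrow> h s \<in> lin_span R N T"
    and "x \<in> lin_span R M S"
  shows "h x \<in> lin_span R N T"
  using assms(6)
proof induction
  case zero
  then show ?case using lin_map_zero[OF assms(4,1,2)] lin_span.zero by metis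
next
  case (add x y)
  then show ?case
    using lin_span_closed[OF assms(1,3)] by (simp add: lin_mapD[OF assms(4)] subset_iff lin_span.add)
next
  case (smult r x)
  then show ?case
    using lin_span_closed[OF assms(1,3)] by (simp add: lin_mapD[OF assms(4)] subset_iff lin_span.smult)
qed (use assms(5) in auto)

lemma (in ring) diff_eq_zero_iff [simp]:
  assumes "x \<in> carrier R" "y \<in> carrier R"
  shows "x \<ominus> y = \<zero> \<longleftrightarrow> x = y"
  using assms by (metis a_minus_def add.inv_closed minus_equality minus_minus r_neg)

lemma assoc_algebra_module: "assoc_algebra R A \<Longrightarrow> module R A"
  by (simp add: assoc_algebra_def)

lemma assoc_algebra_ring: "assoc_algebra R A \<Longrightarrow> ring A"
  by (simp add: assoc_algebra_def)

context assoc_algebra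
begin

lemma mult_left_linear: "a \<in> carrier A \<Longrightarrow> (\<lambda>x. a \<otimes>\<^bsub>A\<^esub> x) \<in> lin_map R A A"
  by (intro lin_mapI) (auto simp: A.r_distr smult_mult_right)

lemma mult_right_linear: "a \<in> carrier A \<Longrightarrow> (\<lambda>x. x \<otimes>\<^bsub>A\<^esub> a) \<in> lin_map R A A"
  by (intro lin_mapI) (auto simp: A.l_distr smult_mult_left)

end

text \<open>Both the crossed product and the endomorphisms of a module are realised as sets of functions with
  values in a module; their linear structure is inherited value by value.\<close>

lemma pointwise_module:
  assumes M: "module R M"
    and ext: "\<And>f g. \<lbrakk>f \<in> carrier N; g \<in> carrier N; \<And>x. x \<in> X \<Longrightarrow> f x = g x\<rbrakk> \<Longrightarrow> f = g"
    and val: "\<And>f x. \<lbrakk>f \<in> carrier N; x \<in> X\<rbrakk> \<Longrightarrow> f x \<in> carrier M"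
    and cl: "\<And>f g. \<lbrakk>f \<in> carrier N; g \<in> carrier N\<rbrakk> \<Longrightarrow> f \<oplus>\<^bsub>N\<^esub> g \<in> carrier N"
      "\<And>r f. \<lbrakk>r \<in> carrier R; f \<in> carrier N\<rbrakk> \<Longrightarrow> r \<odot>\<^bsub>N\<^esub> f \<in> carrier N" "\<zero>\<^bsub>N\<^esub> \<in> carrier N"
    and pt: "\<And>f g x. x \<in> X \<Longrightarrow> (f \<oplus>\<^bsub>N\<^esub> g) x = f x \<oplus>\<^bsub>M\<^esub> g x"
      "\<And>r f x. x \<in> X \<Longrightarrow> (r \<odot>\<^bsub>N\<^esub> f) x = r \<odot>\<^bsub>M\<^esub> f x" "\<And>x. x \<in> X \<Longrightarrow> \<zero>\<^bsub>N\<^esub> x = \<zero>\<^bsub>M\<^esub>"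
  shows "module R N"
proof -
  interpret M: module R M by fact
  note simps = pt val M.M.a_assoc M.smult_l_distr M.smult_r_distr M.smult_assoc1
  have "abelian_group N"
  proof (rule abelian_groupI)
    fix f assume f: "f \<in> carrier N"
    have "(\<ominus>\<^bsub>R\<^esub> \<one>\<^bsub>R\<^esub>) \<odot>\<^bsub>N\<^esub> f \<oplus>\<^bsub>N\<^esub> f = \<zero>\<^bsub>N\<^esub>"
      by (rule ext) (use f in \<open>simp_all add: cl simps M.smult_l_minus M.M.l_neg\<close>)
    then show "\<exists>g\<in>carrier N. g \<oplus>\<^bsub>N\<^esub> f = \<zero>\<^bsub>N\<^esub>" using f cl(2) by blast
    show "\<zero>\<^bsub>N\<^esub> \<oplus>\<^bsub>N\<^esub> f = f" by (rule ext) (use f in \<open>simp_all add: cl simps\<close>)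
    fix g assume g: "g \<in> carrier N"
    show "f \<oplus>\<^bsub>N\<^esub> g = g \<oplus>\<^bsub>N\<^esub> f"
      by (rule ext) (use f g in \<open>simp_all add: cl simps M.M.a_comm\<close>)
    fix h assume h: "h \<in> carrier N"
    show "f \<oplus>\<^bsub>N\<^esub> g \<oplus>\<^bsub>N\<^esub> h = f \<oplus>\<^bsub>N\<^esub> (g \<oplus>\<^bsub>N\<^esub> h)"
      by (rule ext) (use f g h in \<open>simp_all add: cl simps\<close>)
  qed (simp_all add: cl)
  then show ?thesis
    by (rule moduleI[OF M.R.is_cring]) (rule ext cl; simp add: cl simps)+
qed

text \<open>Once a product is known to be bilinear, both sides of the associative law are linear in each
  of their three arguments, and so are the unit laws; hence these laws need only be checked on a
  spanning set.\<close>

lemma assoc_algebraI_span: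
  fixes R (structure) and B (structure)
  assumes mod: "module R B"
    and cl: "\<And>x y. \<lbrakk>x \<in> carrier B; y \<in> carrier B\<rbrakk> \<Longrightarrow> x \<otimes>\<^bsub>B\<^esub> y \<in> carrier B"
    and dl: "\<And>x y w. \<lbrakk>x \<in> carrier B; y \<in> carrier B; w \<in> carrier B\<rbrakk>
      \<Longrightarrow> (x \<oplus>\<^bsub>B\<^esub> y) \<otimes>\<^bsub>B\<^esub> w = x \<otimes>\<^bsub>B\<^esub> w \<oplus>\<^bsub>B\<^esub> y \<otimes>\<^bsub>B\<^esub> w"
    and dr: "\<And>x y w. \<lbrakk>x \<in> carrier B; y \<in> carrier B; w \<in> carrier B\<rbrakk>
      \<Longrightarrow> w \<otimes>\<^bsub>B\<^esub> (x \<oplus>\<^bsub>B\<^esub> y) = w \<otimes>\<^bsub>B\<^esub> x \<oplus>\<^bsub>B\<^esub> w \<otimes>\<^bsub>B\<^esub> y"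
    and sl: "\<And>r x y. \<lbrakk>r \<in> carrier R; x \<in> carrier B; y \<in> carrier B\<rbrakk>
      \<Longrightarrow> (r \<odot>\<^bsub>B\<^esub> x) \<otimes>\<^bsub>B\<^esub> y = r \<odot>\<^bsub>B\<^esub> (x \<otimes>\<^bsub>B\<^esub> y)"
    and sr: "\<And>r x y. \<lbrakk>r \<in> carrier R; x \<in> carrier B; y \<in> carrier B\<rbrakk>
      \<Longrightarrow> x \<otimes>\<^bsub>B\<^esub> (r \<odot>\<^bsub>B\<^esub> y) = r \<odot>\<^bsub>B\<^esub> (x \<otimes>\<^bsub>B\<^esub> y)"
    and one: "\<one>\<^bsub>B\<^esub> \<in> carrier B"
    and S: "S \<subseteq> carrier B" and span: "carrier B \<subseteq> lin_span R B S"
    and assoc: "\<And>x y w. \<lbrakk>x \<in> S; y \<in> S; w \<in> S\<rbrakk> \<Longrightarrow> (x \<otimes>\<^bsub>B\<^esub> y) \<otimes>\<^bsub>B\<^esub> w = x \<otimes>\<^bsub>B\<^esub> (y \<otimes>\<^bsub>B\<^esub> w)"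
    and unit: "\<And>x. x \<in> S \<Longrightarrow> \<one>\<^bsub>B\<^esub> \<otimes>\<^bsub>B\<^esub> x = x" "\<And>x. x \<in> S \<Longrightarrow> x \<otimes>\<^bsub>B\<^esub> \<one>\<^bsub>B\<^esub> = x"
  shows "assoc_algebra R B"
proof -
  interpret B: module R B by fact
  have L: "(\<lambda>x. w \<otimes>\<^bsub>B\<^esub> x) \<in> lin_map R B B" if "w \<in> carrier B" for w
    using that by (intro lin_mapI) (auto simp: cl dr sr)
  have L': "(\<lambda>x. x \<otimes>\<^bsub>B\<^esub> w) \<in> lin_map R B B" if "w \<in> carrier B" for w
    using that by (intro lin_mapI) (auto simp: cl dl sl)
  have I: "(\<lambda>x. x) \<in> lin_map R B B"
    by (intro lin_mapI) auto
  note eq = lin_map_eq_on_span[OF mod mod S]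
  have 1: "\<one>\<^bsub>B\<^esub> \<otimes>\<^bsub>B\<^esub> x = x" if "x \<in> carrier B" for x
    using eq[OF L[OF one] I, of x] span that by (auto simp: unit)
  have 2: "x \<otimes>\<^bsub>B\<^esub> \<one>\<^bsub>B\<^esub> = x" if "x \<in> carrier B" for x
    using eq[OF L'[OF one] I, of x] span that by (auto simp: unit)
  have a1: "(x \<otimes>\<^bsub>B\<^esub> y) \<otimes>\<^bsub>B\<^esub> w = x \<otimes>\<^bsub>B\<^esub> (y \<otimes>\<^bsub>B\<^esub> w)" if "x \<in> S" "y \<in> S" "w \<in> carrier B" for x y w
    by (rule eq[OF L lin_map_comp[OF L L], of "x \<otimes>\<^bsub>B\<^esub> y" y x w])
      (use that S span assoc in \<open>auto intro!: cl\<close>)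
  have a2: "(x \<otimes>\<^bsub>B\<^esub> y) \<otimes>\<^bsub>B\<^esub> w = x \<otimes>\<^bsub>B\<^esub> (y \<otimes>\<^bsub>B\<^esub> w)" if "x \<in> S" "y \<in> carrier B" "w \<in> carrier B" for x y w
    by (rule eq[OF lin_map_comp[OF L L'] lin_map_comp[OF L' L], of x w w x y])
      (use that S span a1 in \<open>auto intro!: cl\<close>)
  have a3: "(x \<otimes>\<^bsub>B\<^esub> y) \<otimes>\<^bsub>B\<^esub> w = x \<otimes>\<^bsub>B\<^esub> (y \<otimes>\<^bsub>B\<^esub> w)" if "x \<in> carrier B" "y \<in> carrier B" "w \<in> carrier B" for x y w
    by (rule eq[OF lin_map_comp[OF L' L'] L', of y w "y \<otimes>\<^bsub>B\<^esub> w" x])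
      (use that S span a2 in \<open>auto intro!: cl\<close>)
  have "ring B"
    by (intro ringI monoidI B.M.abelian_group_axioms) (auto simp: cl one a3 1 2 dl dr)
  then show ?thesis
    by (intro assoc_algebra.intro mod assoc_algebra_axioms.intro) (auto simp: sl sr)
qed

lemma alg_homI:
  assumes "\<And>x. x \<in> carrier B \<Longrightarrow> h x \<in> carrier D"
    and "\<And>x y. \<lbrakk>x \<in> carrier B; y \<in> carrier B\<rbrakk> \<Longrightarrow> h (x \<otimes>\<^bsub>B\<^esub> y) = h x \<otimes>\<^bsub>D\<^esub> h y"
    and "\<And>x y. \<lbrakk>x \<in> carrier B; y \<in> carrier B\<rbrakk> \<Longrightarrow> h (x \<oplus>\<^bsub>B\<^esub> y) = h x \<oplus>\<^bsub>D\<^esub> h y"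
    and "\<And>r x. \<lbrakk>r \<in> carrier R; x \<in> carrier B\<rbrakk> \<Longrightarrow> h (r \<odot>\<^bsub>B\<^esub> x) = r \<odot>\<^bsub>D\<^esub> h x"
    and "h \<one>\<^bsub>B\<^esub> = \<one>\<^bsub>D\<^esub>"
  shows "h \<in> alg_hom R B D"
  using assms by (auto simp: alg_hom_def intro: ring_hom_memI)

lemma alg_homD:
  assumes "h \<in> alg_hom R B D"
  shows "x \<in> carrier B \<Longrightarrow> h x \<in> carrier D"
    and "\<lbrakk>x \<in> carrier B; y \<in> carrier B\<rbrakk> \<Longrightarrow> h (x \<otimes>\<^bsub>B\<^esub> y) = h x \<otimes>\<^bsub>D\<^esub> h y"
    and "\<lbrakk>x \<in> carrier B; y \<in> carrier B\<rbrakk> \<Longrightarrow> h (x \<oplus>\<^bsub>B\<^esub> y) = h x \<oplus>\<^bsub>D\<^esub> h y"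
    and "\<lbrakk>r \<in> carrier R; x \<in> carrier B\<rbrakk> \<Longrightarrow> h (r \<odot>\<^bsub>B\<^esub> x) = r \<odot>\<^bsub>D\<^esub> h x"
    and "h \<one>\<^bsub>B\<^esub> = \<one>\<^bsub>D\<^esub>"
  using assms by (auto simp: alg_hom_def dest: ring_hom_memE)

lemma alg_hom_lin_map: "h \<in> alg_hom R B D \<Longrightarrow> h \<in> lin_map R B D"
  by (intro lin_mapI) (auto simp: alg_homD)

lemma alg_hom_comp:
  "\<lbrakk>h \<in> alg_hom R A B; k \<in> alg_hom R B D\<rbrakk> \<Longrightarrow> (\<lambda>x. k (h x)) \<in> alg_hom R A D"
  by (intro alg_homI) (simp_all add: alg_homD)

lemma alg_hom_pow:
  assumes "h \<in> alg_hom R B D" "monoid B" "monoid D" "x \<in> carrier B"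
  shows "h (x [^]\<^bsub>B\<^esub> (k::nat)) = h x [^]\<^bsub>D\<^esub> k"
proof -
  interpret B: monoid B by fact
  interpret D: monoid D by fact
  show ?thesis
    by (induction k) (use assms(4) in \<open>simp_all add: alg_homD[OF assms(1)]\<close>)
qed

lemma alg_hom_minus:
  assumes h: "h \<in> alg_hom R B D" and B: "assoc_algebra R B" and D: "assoc_algebra R D"
    and xy: "x \<in> carrier B" "y \<in> carrier B"
  shows "h (x \<ominus>\<^bsub>B\<^esub> y) = h x \<ominus>\<^bsub>D\<^esub> h y"
proof -
  have "h \<in> ring_hom B D" using h by (simp add: alg_hom_def)
  then interpret ring_hom_ring B D h
    by (intro ring_hom_ringI2 assoc_algebra_ring[OF B] assoc_algebra_ring[OF D])
  show ?thesis using xy by (simp add: a_minus_def)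
qed

lemma alg_hom_inv:
  assumes h: "h \<in> alg_hom R B D" and B: "monoid B" and D: "monoid D" and c: "c \<in> Units B"
  shows "h c \<in> Units D" and "h (inv\<^bsub>B\<^esub> c) = inv\<^bsub>D\<^esub> (h c)"
proof -
  interpret B: monoid B by fact
  interpret D: monoid D by fact
  have 1: "h c \<otimes>\<^bsub>D\<^esub> h (inv\<^bsub>B\<^esub> c) = \<one>\<^bsub>D\<^esub>" "h (inv\<^bsub>B\<^esub> c) \<otimes>\<^bsub>D\<^esub> h c = \<one>\<^bsub>D\<^esub>"
    using c alg_homD(2)[OF h B.Units_closed[OF c] B.Units_inv_closed[OF c], symmetric]
      alg_homD(2)[OF h B.Units_inv_closed[OF c] B.Units_closed[OF c], symmetric] alg_homD(5)[OF h]
    by (simp_all only: B.Units_l_inv B.Units_r_inv)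
  then show "h c \<in> Units D"
    using alg_homD(1)[OF h B.Units_closed[OF c]] alg_homD(1)[OF h B.Units_inv_closed[OF c]]
    unfolding Units_def by blast
  then show "h (inv\<^bsub>B\<^esub> c) = inv\<^bsub>D\<^esub> (h c)"
    using 1 c by (metis B.Units_closed B.Units_inv_closed D.inv_char alg_homD(1) h)
qed

text \<open>Multiplicativity of a linear map is an identity between bilinear maps.\<close>

lemma alg_homI_span:
  assumes B: "assoc_algebra R B" and D: "assoc_algebra R D" and h: "h \<in> lin_map R B D"
    and S: "S \<subseteq> carrier B" and span: "carrier B \<subseteq> lin_span R B S"
    and mult: "\<And>x y. \<lbrakk>x \<in> S; y \<in> S\<rbrakk> \<Longrightarrow> h (x \<otimes>\<^bsub>B\<^esub> y) = h x \<otimes>\<^bsub>D\<^esub> h y"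
    and one: "h \<one>\<^bsub>B\<^esub> = \<one>\<^bsub>D\<^esub>"
  shows "h \<in> alg_hom R B D"
proof -
  interpret B: assoc_algebra R B by fact
  interpret D: assoc_algebra R D by fact
  note eq = lin_map_eq_on_span[OF B.module_axioms D.module_axioms S]
  note h' = lin_mapD[OF h]
  have a1: "h (x \<otimes>\<^bsub>B\<^esub> y) = h x \<otimes>\<^bsub>D\<^esub> h y" if "x \<in> S" "y \<in> carrier B" for x y
    by (rule eq[OF lin_map_comp[OF B.mult_left_linear h] lin_map_comp[OF h D.mult_left_linear]])
      (use that mult S h' span in auto)
  have a2: "h (x \<otimes>\<^bsub>B\<^esub> y) = h x \<otimes>\<^bsub>D\<^esub> h y" if "x \<in> carrier B" "y \<in> carrier B" for x y
    by (rule eq[OF lin_map_comp[OF B.mult_right_linear h] lin_map_comp[OF h D.mult_right_linear]])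
      (use that a1 S h' span in auto)
  show ?thesis
    by (intro alg_homI) (auto simp: h' a2 one)
qed

lemma alg_iso_inverse:
  assumes B: "assoc_algebra R B" and h: "h \<in> alg_iso R B D"
  shows "inv_into (carrier B) h \<in> alg_hom R D B"
    and "\<And>x. x \<in> carrier B \<Longrightarrow> inv_into (carrier B) h (h x) = x"
proof -
  interpret B: assoc_algebra R B by fact
  let ?k = "inv_into (carrier B) h"
  have hom: "h \<in> alg_hom R B D" and bij: "bij_betw h (carrier B) (carrier D)"
    using h by (auto simp: alg_iso_def)
  have kh: "?k (h x) = x" if "x \<in> carrier B" for x
    using that bij by (simp add: bij_betw_def)
  then show "\<And>x. x \<in> carrier B \<Longrightarrow> ?k (h x) = x" .
  have ex: "\<exists>x\<in>carrier B. y = h x" if "y \<in> carrier D" for y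
    using that bij by (auto simp: bij_betw_def)
  show "?k \<in> alg_hom R D B"
  proof (rule alg_homI)
    fix x y assume xy: "x \<in> carrier D" "y \<in> carrier D"
    then obtain a b where ab: "a \<in> carrier B" "b \<in> carrier B" "x = h a" "y = h b" 
      using ex by metis
    show "?k (x \<otimes>\<^bsub>D\<^esub> y) = ?k x \<otimes>\<^bsub>B\<^esub> ?k y" 
      using ab by (simp add: kh alg_homD(2)[OF hom, symmetric])
    show "?k (x \<oplus>\<^bsub>D\<^esub> y) = ?k x \<oplus>\<^bsub>B\<^esub> ?k y" 
      using ab by (simp add: kh alg_homD(3)[OF hom, symmetric])
  next
    fix x r assume xy: "x \<in> carrier D" "r \<in> carrier R"
    then obtain a where ab: "a \<in> carrier B" "x = h a" 
      using ex by metis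
    then show "?k (r \<odot>\<^bsub>D\<^esub> x) = r \<odot>\<^bsub>B\<^esub> ?k x"
      using xy by (simp add: kh alg_homD(4)[OF hom, symmetric])
  next
    show "?k \<one>\<^bsub>D\<^esub> = \<one>\<^bsub>B\<^esub>"
      using kh[of "\<one>\<^bsub>B\<^esub>"] by (simp add: alg_homD(5)[OF hom])
  qed (use ex kh in metis)
qed

section \<open>Monoid algebras\<close>

text \<open>The product of a monoid algebra is a sum over pairs in the supports of the factors. To compare
  two products, both are rewritten as sums over one finite set of pairs containing all supports
  involved; after that, the bilinearity of the product is an identity between summands.\<close>

locale monoid_ring = R: cring R + G: monoid G for R (structure) and G (structure)
begin

abbreviation RG where "RG \<equiv> monoid_algebra R G"

lemma RG_carrierD:
  assumes "f \<in> carrier RG"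
  shows "f g \<in> carrier R" and "finite {g. f g \<noteq> \<zero>}" and "f g \<noteq> \<zero> \<Longrightarrow> g \<in> carrier G"
  using assms by (auto simp: monoid_algebra_def)

lemma RG_carrierI:
  assumes "\<And>g. f g \<in> carrier R" "finite T" "{g. f g \<noteq> \<zero>} \<subseteq> T" "T \<subseteq> carrier G"
  shows "f \<in> carrier RG"
  using assms by (auto simp: monoid_algebra_def intro: finite_subset)

lemma RG_simps:
  "\<zero>\<^bsub>RG\<^esub> = (\<lambda>g. \<zero>)" "f \<oplus>\<^bsub>RG\<^esub> f' = (\<lambda>g. f g \<oplus> f' g)" "r \<odot>\<^bsub>RG\<^esub> f = (\<lambda>g. r \<otimes> f g)"
  "\<one>\<^bsub>RG\<^esub> = basis_el R \<one>\<^bsub>G\<^esub>"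
  by (simp_all add: monoid_algebra_def)

lemma basis_el_closed: "g \<in> carrier G \<Longrightarrow> basis_el R g \<in> carrier RG"
  by (rule RG_carrierI[of _ "{g}"]) (auto simp: basis_el_def)

lemma RG_module: "module R RG"
proof (rule moduleI)
  have neg: "(\<lambda>g. \<ominus> f g) \<in> carrier RG" if "f \<in> carrier RG" for f
    by (rule RG_carrierI[of _ "{g. f g \<noteq> \<zero>}"]) (use RG_carrierD[OF that] in auto)
  show "abelian_group RG"
  proof (rule abelian_groupI)
    fix f f' assume "f \<in> carrier RG" "f' \<in> carrier RG"
    note f = RG_carrierD[OF this(1)] RG_carrierD[OF this(2)]
    show "f \<oplus>\<^bsub>RG\<^esub> f' \<in> carrier RG"
      by (rule RG_carrierI[of _ "{g. f g \<noteq> \<zero>} \<union> {g. f' g \<noteq> \<zero>}"]) (use f in \<open>auto simp: RG_simps\<close>)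
  next
    show "\<zero>\<^bsub>RG\<^esub> \<in> carrier RG" by (rule RG_carrierI[of _ "{}"]) (auto simp: RG_simps)
  next
    fix f assume f: "f \<in> carrier RG"
    show "\<exists>f'\<in>carrier RG. f' \<oplus>\<^bsub>RG\<^esub> f = \<zero>\<^bsub>RG\<^esub>"
      by (rule bexI[OF _ neg[OF f]]) (use RG_carrierD[OF f] in \<open>auto simp: RG_simps R.l_neg\<close>)
  qed (auto simp: RG_simps RG_carrierD R.a_ac)
next
  fix r f assume r: "r \<in> carrier R" and f: "f \<in> carrier RG"
  show "r \<odot>\<^bsub>RG\<^esub> f \<in> carrier RG"
    by (rule RG_carrierI[of _ "{g. f g \<noteq> \<zero>}"]) (use r RG_carrierD[OF f] in \<open>auto simp: RG_simps\<close>)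
qed (auto simp: RG_simps RG_carrierD R.l_distr R.r_distr R.m_assoc R.is_cring)

text \<open>By induction on a finite set containing the support: clear one value at a time.\<close>

lemma RG_span: "carrier RG \<subseteq> lin_span R RG (basis_el R ` carrier G)"
proof
  fix f assume f: "f \<in> carrier RG"
  have "f \<in> lin_span R RG (basis_el R ` carrier G)"
    if "finite T" "f \<in> carrier RG" "{g. f g \<noteq> \<zero>} \<subseteq> T" for f T
    using that
  proof (induction T arbitrary: f)
    case empty
    then have "f = \<zero>\<^bsub>RG\<^esub>" by (auto simp: RG_simps)
    then show ?case by (simp add: lin_span.zero)
  next
    case (insert g T)
    note f = RG_carrierD[OF insert.prems(1)]
    show ?case
    proof (cases "f g = \<zero>")
      case True
      then show ?thesis using insert by (intro insert.IH) auto
    next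
      case False
      let ?f = "f(g := \<zero>)"
      have f': "?f \<in> carrier RG"
        by (rule RG_carrierI[of _ "{g. f g \<noteq> \<zero>}"]) (use f in auto)
      have "?f \<in> lin_span R RG (basis_el R ` carrier G)"
        by (rule insert.IH[OF f']) (use insert.prems in auto)
      moreover have "f = f g \<odot>\<^bsub>RG\<^esub> basis_el R g \<oplus>\<^bsub>RG\<^esub> ?f"
        using f by (auto simp: RG_simps basis_el_def)
      ultimately show ?thesis
        using f False by (metis lin_span.add lin_span.smult lin_span.base imageI)
    qed
  qed
  then show "f \<in> lin_span R RG (basis_el R ` carrier G)"
    using f RG_carrierD(2)[OF f] by blast
qed

lemma RG_mult_superset:
  assumes f: "f \<in> carrier RG" "f' \<in> carrier RG"
    and T: "finite T" "{g. f g \<noteq> \<zero>} \<times> {g. f' g \<noteq> \<zero>} \<subseteq> T"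
  shows "(f \<otimes>\<^bsub>RG\<^esub> f') k = (\<Oplus>p\<in>{p\<in>T. fst p \<otimes>\<^bsub>G\<^esub> snd p = k}. f (fst p) \<otimes> f' (snd p))"
proof -
  have "(\<Oplus>p\<in>{p. f (fst p) \<noteq> \<zero> \<and> f' (snd p) \<noteq> \<zero> \<and> fst p \<otimes>\<^bsub>G\<^esub> snd p = k}. f (fst p) \<otimes> f' (snd p))
     = (\<Oplus>p\<in>{p\<in>T. fst p \<otimes>\<^bsub>G\<^esub> snd p = k}. f (fst p) \<otimes> f' (snd p))"
    by (rule R.add.finprod_mono_neutral_cong_left)
      (use T in \<open>auto simp: RG_carrierD(1)[OF f(1)] RG_carrierD(1)[OF f(2)]\<close>)
  then show ?thesis by (simp add: monoid_algebra_def)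
qed

lemma RG_mult_closed:
  assumes f: "f \<in> carrier RG" "f' \<in> carrier RG"
  shows "f \<otimes>\<^bsub>RG\<^esub> f' \<in> carrier RG"
proof (rule RG_carrierI)
  let ?T = "{g. f g \<noteq> \<zero>} \<times> {g. f' g \<noteq> \<zero>}"
  let ?U = "(\<lambda>p. fst p \<otimes>\<^bsub>G\<^esub> snd p) ` ?T"
  note f1 = RG_carrierD[OF f(1)] and f2 = RG_carrierD[OF f(2)]
  have fin: "finite ?T" using f1(2) f2(2) by simp
  then show "finite ?U" by simp
  note eq = RG_mult_superset[OF f fin subset_refl]
  show "(f \<otimes>\<^bsub>RG\<^esub> f') k \<in> carrier R" for k
    unfolding eq by (rule R.finsum_closed) (use f1(1) f2(1) in auto)
  show "{k. (f \<otimes>\<^bsub>RG\<^esub> f') k \<noteq> \<zero>} \<subseteq> ?U"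
  proof (rule subsetI, rule ccontr)
    fix k assume "k \<in> {k. (f \<otimes>\<^bsub>RG\<^esub> f') k \<noteq> \<zero>}" and "k \<notin> ?U"
    then have k: "(f \<otimes>\<^bsub>RG\<^esub> f') k \<noteq> \<zero>" and "k \<notin> ?U" by auto
    have "{p\<in>?T. fst p \<otimes>\<^bsub>G\<^esub> snd p = k} = {}"
      using \<open>k \<notin> ?U\<close> by (simp only: image_iff) fast
    then show False using k unfolding eq by (metis R.finsum_empty)
  qed
  show "?U \<subseteq> carrier G" using f1(3) f2(3) by auto
qed

lemma RG_mult_eqI_add:
  assumes f: "f1 \<in> carrier RG" "f1' \<in> carrier RG" "f2 \<in> carrier RG" "f2' \<in> carrier RG"
      "f3 \<in> carrier RG" "f3' \<in> carrier RG"
    and eq: "\<And>g h. f1 g \<otimes> f1' h = f2 g \<otimes> f2' h \<oplus> f3 g \<otimes> f3' h"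
  shows "f1 \<otimes>\<^bsub>RG\<^esub> f1' = f2 \<otimes>\<^bsub>RG\<^esub> f2' \<oplus>\<^bsub>RG\<^esub> f3 \<otimes>\<^bsub>RG\<^esub> f3'"
proof
  fix k
  note cl = RG_carrierD(1)[OF f(1)] RG_carrierD(1)[OF f(2)] RG_carrierD(1)[OF f(3)]
    RG_carrierD(1)[OF f(4)] RG_carrierD(1)[OF f(5)] RG_carrierD(1)[OF f(6)]
  let ?T = "({g. f1 g \<noteq> \<zero>} \<union> {g. f2 g \<noteq> \<zero>} \<union> {g. f3 g \<noteq> \<zero>})
    \<times> ({g. f1' g \<noteq> \<zero>} \<union> {g. f2' g \<noteq> \<zero>} \<union> {g. f3' g \<noteq> \<zero>})"
  have T: "finite ?T" using RG_carrierD(2) f by auto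
  have "(f1 \<otimes>\<^bsub>RG\<^esub> f1') k = (\<Oplus>p\<in>{p\<in>?T. fst p \<otimes>\<^bsub>G\<^esub> snd p = k}.
      f2 (fst p) \<otimes> f2' (snd p) \<oplus> f3 (fst p) \<otimes> f3' (snd p))"
    by (subst RG_mult_superset[OF f(1,2) T]) (auto simp: eq)
  also have "\<dots> = (f2 \<otimes>\<^bsub>RG\<^esub> f2') k \<oplus> (f3 \<otimes>\<^bsub>RG\<^esub> f3') k"
    by (subst RG_mult_superset[OF f(3,4) T], blast, subst RG_mult_superset[OF f(5,6) T], blast)
      (rule R.finsum_addf; use cl in auto)
  finally show "(f1 \<otimes>\<^bsub>RG\<^esub> f1') k = (f2 \<otimes>\<^bsub>RG\<^esub> f2' \<oplus>\<^bsub>RG\<^esub> f3 \<otimes>\<^bsub>RG\<^esub> f3') k"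
    by (simp add: RG_simps)
qed

lemma RG_mult_eqI_smult:
  assumes f: "f1 \<in> carrier RG" "f1' \<in> carrier RG" "f2 \<in> carrier RG" "f2' \<in> carrier RG"
    and r: "r \<in> carrier R" and eq: "\<And>g h. f1 g \<otimes> f1' h = r \<otimes> (f2 g \<otimes> f2' h)"
  shows "f1 \<otimes>\<^bsub>RG\<^esub> f1' = r \<odot>\<^bsub>RG\<^esub> (f2 \<otimes>\<^bsub>RG\<^esub> f2')"
proof
  fix k
  let ?T = "({g. f1 g \<noteq> \<zero>} \<union> {g. f2 g \<noteq> \<zero>}) \<times> ({g. f1' g \<noteq> \<zero>} \<union> {g. f2' g \<noteq> \<zero>})"
  have T: "finite ?T" using RG_carrierD(2) f by auto
  have "(f1 \<otimes>\<^bsub>RG\<^esub> f1') k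
      = (\<Oplus>p\<in>{p\<in>?T. fst p \<otimes>\<^bsub>G\<^esub> snd p = k}. r \<otimes> (f2 (fst p) \<otimes> f2' (snd p)))"
    by (subst RG_mult_superset[OF f(1,2) T]) (auto simp: eq)
  also have "\<dots> = r \<otimes> (f2 \<otimes>\<^bsub>RG\<^esub> f2') k"
    by (subst RG_mult_superset[OF f(3,4) T], blast)
      (rule R.finsum_rdistr[symmetric]; use r T RG_carrierD(1)[OF f(3)] RG_carrierD(1)[OF f(4)] in auto)
  finally show "(f1 \<otimes>\<^bsub>RG\<^esub> f1') k = (r \<odot>\<^bsub>RG\<^esub> (f2 \<otimes>\<^bsub>RG\<^esub> f2')) k"
    by (simp add: RG_simps)
qed

lemma basis_el_mult:
  assumes "g \<in> carrier G" "h \<in> carrier G"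
  shows "basis_el R g \<otimes>\<^bsub>RG\<^esub> basis_el R h = basis_el R (g \<otimes>\<^bsub>G\<^esub> h)"
proof
  fix k
  have "(basis_el R g \<otimes>\<^bsub>RG\<^esub> basis_el R h) k
     = (\<Oplus>p\<in>{p\<in>{(g, h)}. fst p \<otimes>\<^bsub>G\<^esub> snd p = k}. basis_el R g (fst p) \<otimes> basis_el R h (snd p))"
    by (rule RG_mult_superset[OF basis_el_closed[OF assms(1)] basis_el_closed[OF assms(2)]])
      (auto simp: basis_el_def split: if_splits)
  also have "\<dots> = basis_el R (g \<otimes>\<^bsub>G\<^esub> h) k"
  proof (cases "g \<otimes>\<^bsub>G\<^esub> h = k")
    case True
    then have "{p\<in>{(g, h)}. fst p \<otimes>\<^bsub>G\<^esub> snd p = k} = {(g, h)}" by auto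
    then show ?thesis using True by (simp add: basis_el_def)
  next
    case False
    then have "{p\<in>{(g, h)}. fst p \<otimes>\<^bsub>G\<^esub> snd p = k} = {}" by auto
    then show ?thesis using False by (simp only: R.finsum_empty) (simp add: basis_el_def)
  qed
  finally show "(basis_el R g \<otimes>\<^bsub>RG\<^esub> basis_el R h) k = basis_el R (g \<otimes>\<^bsub>G\<^esub> h) k" .
qed

lemma RG_algebra: "assoc_algebra R RG"
proof -
  interpret M: module R RG by (rule RG_module)
  show ?thesis
    by (rule assoc_algebraI_span[OF RG_module RG_mult_closed _ _ _ _ _ _ RG_span];
        (intro RG_mult_eqI_add RG_mult_eqI_smult M.M.a_closed M.smult_closed; assumption?)?)
      (auto simp: basis_el_closed basis_el_mult RG_simps G.m_assoc RG_carrierD R.l_distr R.r_distr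
        R.m_assoc R.m_lcomm)
qed

text \<open>The linear extension of a map defined on the basis. For a multiplicative map it is the algebra
  homomorphism given by the universal property of the monoid algebra.\<close>

definition lin_ext where
  "lin_ext B \<phi> f = (\<Oplus>\<^bsub>B\<^esub>g\<in>{g. f g \<noteq> \<zero>}. f g \<odot>\<^bsub>B\<^esub> \<phi> g)"

lemma RG_lift:
  assumes B: "assoc_algebra R B"
    and cl: "\<And>g. g \<in> carrier G \<Longrightarrow> \<phi> g \<in> carrier B"
    and mult: "\<And>g h. \<lbrakk>g \<in> carrier G; h \<in> carrier G\<rbrakk> \<Longrightarrow> \<phi> (g \<otimes>\<^bsub>G\<^esub> h) = \<phi> g \<otimes>\<^bsub>B\<^esub> \<phi> h"
    and one: "\<phi> \<one>\<^bsub>G\<^esub> = \<one>\<^bsub>B\<^esub>"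
  shows "lin_ext B \<phi> \<in> alg_hom R RG B"
    and "\<And>g. g \<in> carrier G \<Longrightarrow> lin_ext B \<phi> (basis_el R g) = \<phi> g"
proof -
  interpret B: assoc_algebra R B by fact
  let ?h = "lin_ext B \<phi>"
  have sup: "?h f = (\<Oplus>\<^bsub>B\<^esub>g\<in>T. f g \<odot>\<^bsub>B\<^esub> \<phi> g)"
    if f: "f \<in> carrier RG" and T: "finite T" "{g. f g \<noteq> \<zero>} \<subseteq> T" "T \<subseteq> carrier G" for f T
    unfolding lin_ext_def
    by (rule B.M.add.finprod_mono_neutral_cong_left)
      (use T cl RG_carrierD[OF f] in auto)
  show hb: "?h (basis_el R g) = \<phi> g" if "g \<in> carrier G" for g
  proof -
    have "?h (basis_el R g) = (\<Oplus>\<^bsub>B\<^esub>x\<in>{g}. basis_el R g x \<odot>\<^bsub>B\<^esub> \<phi> x)"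
      by (rule sup[OF basis_el_closed[OF that]]) (use that in \<open>auto simp: basis_el_def split: if_splits\<close>)
    then show ?thesis using cl[OF that] by (simp add: basis_el_def)
  qed
  have lin: "?h \<in> lin_map R RG B"
  proof (rule lin_mapI)
    fix f assume f: "f \<in> carrier RG"
    note f' = RG_carrierD[OF f]
    show "?h f \<in> carrier B"
      unfolding lin_ext_def by (rule B.M.finsum_closed) (use f' cl in auto)
    fix f2 assume g: "f2 \<in> carrier RG"
    note g' = RG_carrierD[OF g]
    interpret M: module R RG by (rule RG_module)
    let ?T = "{g. f g \<noteq> \<zero>} \<union> {g. f2 g \<noteq> \<zero>}"
    have T: "finite ?T" "?T \<subseteq> carrier G" using f' g' by auto
    have "?h (f \<oplus>\<^bsub>RG\<^esub> f2) = (\<Oplus>\<^bsub>B\<^esub>g\<in>?T. (f \<oplus>\<^bsub>RG\<^esub> f2) g \<odot>\<^bsub>B\<^esub> \<phi> g)"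
      by (rule sup[OF M.M.a_closed[OF f g] T(1) _ T(2)]) (auto simp: RG_simps)
    also have "\<dots> = (\<Oplus>\<^bsub>B\<^esub>g\<in>?T. f g \<odot>\<^bsub>B\<^esub> \<phi> g \<oplus>\<^bsub>B\<^esub> f2 g \<odot>\<^bsub>B\<^esub> \<phi> g)"
      by (rule B.M.finsum_cong') (use f' g' cl in \<open>auto simp: RG_simps B.smult_l_distr\<close>)
    also have "\<dots> = (\<Oplus>\<^bsub>B\<^esub>g\<in>?T. f g \<odot>\<^bsub>B\<^esub> \<phi> g) \<oplus>\<^bsub>B\<^esub> (\<Oplus>\<^bsub>B\<^esub>g\<in>?T. f2 g \<odot>\<^bsub>B\<^esub> \<phi> g)"
      by (rule B.M.finsum_addf) (use f' g' cl in auto)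
    also have "\<dots> = ?h f \<oplus>\<^bsub>B\<^esub> ?h f2"
      using sup[OF f T(1) _ T(2)] sup[OF g T(1) _ T(2)] by simp
    finally show "?h (f \<oplus>\<^bsub>RG\<^esub> f2) = ?h f \<oplus>\<^bsub>B\<^esub> ?h f2" .
  next
    fix r f assume r: "r \<in> carrier R" and f: "f \<in> carrier RG"
    note f' = RG_carrierD[OF f]
    interpret M: module R RG by (rule RG_module)
    let ?T = "{g. f g \<noteq> \<zero>}"
    have T: "finite ?T" "?T \<subseteq> carrier G" using f' by auto
    have "?h (r \<odot>\<^bsub>RG\<^esub> f) = (\<Oplus>\<^bsub>B\<^esub>g\<in>?T. (r \<odot>\<^bsub>RG\<^esub> f) g \<odot>\<^bsub>B\<^esub> \<phi> g)"
      by (rule sup[OF M.smult_closed[OF r f] T(1) _ T(2)]) (use r in \<open>auto simp: RG_simps\<close>)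
    also have "\<dots> = (\<Oplus>\<^bsub>B\<^esub>g\<in>?T. r \<odot>\<^bsub>B\<^esub> (f g \<odot>\<^bsub>B\<^esub> \<phi> g))"
      by (rule B.M.finsum_cong') (use r f' cl in \<open>auto simp: RG_simps B.smult_assoc1\<close>)
    also have "\<dots> = r \<odot>\<^bsub>B\<^esub> ?h f"
      unfolding lin_ext_def by (rule B.finsum_smult_ldistr[symmetric]) (use r f' cl in auto)
    finally show "?h (r \<odot>\<^bsub>RG\<^esub> f) = r \<odot>\<^bsub>B\<^esub> ?h f" .
  qed
  show "?h \<in> alg_hom R RG B"
    by (rule alg_homI_span[OF RG_algebra B lin _ RG_span])
      (auto simp: basis_el_closed basis_el_mult hb mult one RG_simps)
qed

lemma RG_finsum_apply:
  "\<lbrakk>finite T; \<And>i. i \<in> T \<Longrightarrow> F i \<in> carrier RG\<rbrakk> \<Longrightarrow> (\<Oplus>\<^bsub>RG\<^esub>i\<in>T. F i) k = (\<Oplus>i\<in>T. F i k)"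
proof (induction T rule: finite_induct)
  case (insert i T)
  interpret M: module R RG by (rule RG_module)
  show ?case using insert by (simp add: Pi_iff RG_carrierD RG_simps(2))
qed (simp add: RG_simps module.axioms(2)[OF RG_module] abelian_monoid.finsum_empty[OF abelian_group.axioms(1)])

end

text \<open>The push-forward along \<open>\<phi>\<close> is the linear extension of \<open>g \<mapsto> \<delta>\<^sub>\<phi>\<^sub>(\<^sub>g\<^sub>)\<close>, as one sees by evaluating
  that finite sum of functions at a point.\<close>

lemma push_forward_alg_hom:
  fixes R (structure)
  assumes G: "monoid_ring R G" and H: "monoid_ring R H"
    and cl: "\<And>g. g \<in> carrier G \<Longrightarrow> \<phi> g \<in> carrier H"
    and mult: "\<And>g h. \<lbrakk>g \<in> carrier G; h \<in> carrier G\<rbrakk> \<Longrightarrow> \<phi> (g \<otimes>\<^bsub>G\<^esub> h) = \<phi> g \<otimes>\<^bsub>H\<^esub> \<phi> h"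
    and one: "\<phi> \<one>\<^bsub>G\<^esub> = \<one>\<^bsub>H\<^esub>"
  shows "push_forward R \<phi> \<in> alg_hom R (monoid_algebra R G) (monoid_algebra R H)"
    and "\<And>g. g \<in> carrier G \<Longrightarrow> push_forward R \<phi> (basis_el R g) = basis_el R (\<phi> g)"
proof -
  interpret G: monoid_ring R G by fact
  interpret H: monoid_ring R H by fact
  have in_H: "basis_el R (\<phi> g) \<in> carrier H.RG" if "g \<in> carrier G" for g
    by (rule H.basis_el_closed[OF cl[OF that]])
  let ?h = "G.lin_ext H.RG (\<lambda>g. basis_el R (\<phi> g))"
  have h: "?h \<in> alg_hom R G.RG H.RG" and hb: "\<And>g. g \<in> carrier G \<Longrightarrow> ?h (basis_el R g) = basis_el R (\<phi> g)"
    using G.RG_lift[where \<phi> = "\<lambda>g. basis_el R (\<phi> g)", OF H.RG_algebra in_H] by (simp_all add: mult cl H.basis_el_mult one H.RG_simps)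
  interpret HM: module R H.RG by (rule H.RG_module)
  have eq: "push_forward R \<phi> f = ?h f" if f: "f \<in> carrier G.RG" for f
  proof
    fix k
    note f' = G.RG_carrierD[OF f]
    have "?h f k = (\<Oplus>g\<in>{g. f g \<noteq> \<zero>}. f g \<otimes> basis_el R (\<phi> g) k)"
      unfolding G.lin_ext_def
      by (subst H.RG_finsum_apply) (use f' in_H in \<open>auto simp: H.RG_simps(3)[symmetric] intro!: HM.smult_closed\<close>, simp add: H.RG_simps(3))
    also have "\<dots> = push_forward R \<phi> f k"
      unfolding push_forward_def
      by (rule G.R.add.finprod_mono_neutral_cong_right) (use f' in \<open>auto simp: basis_el_def\<close>)
    finally show "push_forward R \<phi> f k = ?h f k" by simp
  qed
  interpret GA: assoc_algebra R G.RG by (rule G.RG_algebra)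
  show "push_forward R \<phi> \<in> alg_hom R (monoid_algebra R G) (monoid_algebra R H)"
    by (rule alg_homI) (simp_all add: eq alg_homD[OF h])
  show "push_forward R \<phi> (basis_el R g) = basis_el R (\<phi> g)" if "g \<in> carrier G" for g
    using eq[OF G.basis_el_closed[OF that]] hb[OF that] by simp
qed

section \<open>Quotients of algebras\<close>

lemma assoc_algebra_image:
  assumes F: "assoc_algebra R F"
    and surj: "q ` carrier F = carrier Q"
    and q: "\<And>x y. \<lbrakk>x \<in> carrier F; y \<in> carrier F\<rbrakk> \<Longrightarrow> q (x \<otimes>\<^bsub>F\<^esub> y) = q x \<otimes>\<^bsub>Q\<^esub> q y"
      "\<And>x y. \<lbrakk>x \<in> carrier F; y \<in> carrier F\<rbrakk> \<Longrightarrow> q (x \<oplus>\<^bsub>F\<^esub> y) = q x \<oplus>\<^bsub>Q\<^esub> q y"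
      "\<And>r x. \<lbrakk>r \<in> carrier R; x \<in> carrier F\<rbrakk> \<Longrightarrow> q (r \<odot>\<^bsub>F\<^esub> x) = r \<odot>\<^bsub>Q\<^esub> q x"
      "q \<one>\<^bsub>F\<^esub> = \<one>\<^bsub>Q\<^esub>" "q \<zero>\<^bsub>F\<^esub> = \<zero>\<^bsub>Q\<^esub>"
  shows "assoc_algebra R Q" and "q \<in> alg_hom R F Q"
proof -
  interpret F: assoc_algebra R F by fact
  have ex: "\<exists>x\<in>carrier F. X = q x" if "X \<in> carrier Q" for X
    using that surj by auto
  have cl: "q x \<in> carrier Q" if "x \<in> carrier F" for x
    using that surj by auto
  note q' = q[symmetric]
  note s = F.M.a_closed F.A.m_closed F.smult_closed F.M.zero_closed F.A.one_closed
  have "abelian_group Q"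
  proof (rule abelian_groupI)
    fix x assume "x \<in> carrier Q"
    then obtain a where a: "a \<in> carrier F" "x = q a" using ex by blast
    then show "\<exists>y\<in>carrier Q. y \<oplus>\<^bsub>Q\<^esub> x = \<zero>\<^bsub>Q\<^esub>"
      by (intro bexI[of _ "q (\<ominus>\<^bsub>F\<^esub> a)"]) (simp_all add: cl q' F.M.l_neg)
  qed (auto dest!: ex simp: cl q' F.M.a_ac)
  moreover have "monoid Q"
    by (rule monoidI) (auto dest!: ex simp: cl q' F.A.m_assoc)
  ultimately have "ring Q"
    by (rule ringI) (auto dest!: ex simp: cl q' F.A.l_distr F.A.r_distr)
  moreover have "module R Q"
    by (rule moduleI[OF F.R.is_cring \<open>abelian_group Q\<close>])
      (auto dest!: ex simp: cl q' F.smult_l_distr F.smult_r_distr F.smult_assoc1)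
  ultimately show "assoc_algebra R Q"
    by (intro assoc_algebra.intro assoc_algebra_axioms.intro)
      (auto dest!: ex simp: cl q' F.smult_mult_left F.smult_mult_right)
  show "q \<in> alg_hom R F Q"
    by (rule alg_homI) (auto simp: cl q)
qed

locale alg_quotient = F: assoc_algebra R F
  for R (structure) and F :: "('r, 'f, 'y) module_scheme" and S +
  assumes S_subset: "S \<subseteq> carrier F"
begin

abbreviation I where "I \<equiv> Idl\<^bsub>F\<^esub> S"
abbreviation Q where "Q \<equiv> quotient_algebra F I"
abbreviation cls where "cls x \<equiv> I +>\<^bsub>F\<^esub> x"

sublocale I: ideal I F
  by (rule F.A.genideal_ideal[OF S_subset])

text \<open>The scalar action on the quotient is defined on cosets as sets. It is well defined because an ideal
  of an algebra is a submodule: \<open>r i = (r 1) i\<close>.\<close>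

lemma cls_smult:
  assumes r: "r \<in> carrier R" and x: "x \<in> carrier F"
  shows "cls (r \<odot>\<^bsub>F\<^esub> x) = I <+>\<^bsub>F\<^esub> ((\<lambda>f. r \<odot>\<^bsub>F\<^esub> f) ` cls x)"
proof -
  have rI: "r \<odot>\<^bsub>F\<^esub> i \<in> I" if "i \<in> I" for i
  proof -
    have "r \<odot>\<^bsub>F\<^esub> i = (r \<odot>\<^bsub>F\<^esub> \<one>\<^bsub>F\<^esub>) \<otimes>\<^bsub>F\<^esub> i"
      using r that I.Icarr by (simp add: F.smult_mult_left)
    then show ?thesis using r that I.I_l_closed by simp
  qed
  have 1: "i \<oplus>\<^bsub>F\<^esub> r \<odot>\<^bsub>F\<^esub> (j \<oplus>\<^bsub>F\<^esub> x) = (i \<oplus>\<^bsub>F\<^esub> r \<odot>\<^bsub>F\<^esub> j) \<oplus>\<^bsub>F\<^esub> r \<odot>\<^bsub>F\<^esub> x"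
    if "i \<in> I" "j \<in> I" for i j
    using that r x I.Icarr by (simp add: F.smult_r_distr F.M.a_assoc)
  show ?thesis
  proof (intro equalityI subsetI)
    fix y assume "y \<in> cls (r \<odot>\<^bsub>F\<^esub> x)"
    then obtain i where i: "i \<in> I" "y = i \<oplus>\<^bsub>F\<^esub> r \<odot>\<^bsub>F\<^esub> x" by (auto simp: a_r_coset_def')
    moreover have "x \<in> cls x" using x by (rule I.a_rcos_self)
    ultimately show "y \<in> I <+>\<^bsub>F\<^esub> ((\<lambda>f. r \<odot>\<^bsub>F\<^esub> f) ` cls x)"
      unfolding set_add_def' by blast
  next
    fix y assume "y \<in> I <+>\<^bsub>F\<^esub> ((\<lambda>f. r \<odot>\<^bsub>F\<^esub> f) ` cls x)"
    then obtain i j where ij: "i \<in> I" "j \<in> I" "y = i \<oplus>\<^bsub>F\<^esub> r \<odot>\<^bsub>F\<^esub> (j \<oplus>\<^bsub>F\<^esub> x)"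
      by (auto simp: set_add_def' a_r_coset_def')
    then show "y \<in> cls (r \<odot>\<^bsub>F\<^esub> x)"
      using 1[OF ij(1,2)] rI[OF ij(2)] by (auto simp: a_r_coset_def')
  qed
qed

lemma Q_algebra: "assoc_algebra R Q" and cls_alg_hom: "(\<lambda>x. cls x) \<in> alg_hom R F Q"
  and Q_carrier: "carrier Q = (\<lambda>x. cls x) ` carrier F"
proof -
  show c: "carrier Q = (\<lambda>x. cls x) ` carrier F"
    by (auto simp: quotient_algebra_def FactRing_simps)
  have z: "cls \<zero>\<^bsub>F\<^esub> = \<zero>\<^bsub>Q\<^esub>"
    by (simp add: quotient_algebra_def FactRing_def I.a_subset)
  show "assoc_algebra R Q" "(\<lambda>x. cls x) \<in> alg_hom R F Q"
    by (rule assoc_algebra_image[of R F "\<lambda>x. cls x" Q]; (rule F.assoc_algebra_axioms z c[symmetric])?;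
      simp add: quotient_algebra_def FactRing_def I.rcoset_mult_add I.a_rcos_sum cls_smult[simplified])+
qed

lemma cls_eqI:
  assumes "x \<in> carrier F" "y \<in> carrier F" "x \<ominus>\<^bsub>F\<^esub> y \<in> I"
  shows "cls x = cls y"
  using F.A.quotient_eq_iff_same_a_r_cos[OF I.is_ideal assms(1,2)] assms(3) by simp

lemma cls_rel: "\<lbrakk>x \<in> carrier F; y \<in> carrier F; x \<ominus>\<^bsub>F\<^esub> y \<in> S\<rbrakk> \<Longrightarrow> cls x = cls y"
  using cls_eqI F.A.genideal_self[OF S_subset] by blast

lemma kernel_subset:
  assumes B: "assoc_algebra R B" and h: "h \<in> alg_hom R F B" and S0: "\<And>s. s \<in> S \<Longrightarrow> h s = \<zero>\<^bsub>B\<^esub>"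
    and x: "x \<in> I"
  shows "h x = \<zero>\<^bsub>B\<^esub>"
proof -
  have "h \<in> ring_hom F B" using h by (simp add: alg_hom_def)
  then have rh: "ring_hom_ring F B h"
    by (rule ring_hom_ringI2[OF F.A.ring_axioms assoc_algebra_ring[OF B]])
  have "S \<subseteq> a_kernel F B h"
    using S0 S_subset by (auto simp: a_kernel_def')
  then have "I \<subseteq> a_kernel F B h"
    by (rule F.A.genideal_minimal[OF ring_hom_ring.kernel_is_ideal[OF rh]])
  then show ?thesis using x by (auto simp: a_kernel_def')
qed

lemma Q_lift:
  assumes B: "assoc_algebra R B" and h: "h \<in> alg_hom R F B" and S0: "\<And>s. s \<in> S \<Longrightarrow> h s = \<zero>\<^bsub>B\<^esub>"
  shows "\<exists>k \<in> alg_hom R Q B. \<forall>x \<in> carrier F. k (cls x) = h x"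
proof -
  interpret B: assoc_algebra R B by fact
  interpret Q: assoc_algebra R Q by (rule Q_algebra)
  note c = alg_homD[OF cls_alg_hom]
  have eq: "h x = h y" if xy: "x \<in> carrier F" "y \<in> carrier F" and "cls x = cls y" for x y
  proof -
    have "x \<ominus>\<^bsub>F\<^esub> y \<in> I"
      using F.A.quotient_eq_iff_same_a_r_cos[OF I.is_ideal xy] that(3) by simp
    then have "h x \<ominus>\<^bsub>B\<^esub> h y = \<zero>\<^bsub>B\<^esub>"
      using kernel_subset[OF B h S0] alg_hom_minus[OF h F.assoc_algebra_axioms B xy] by simp
    then show ?thesis
      using alg_homD(1)[OF h] xy by simp
  qed
  define k where "k X = h (SOME x. x \<in> carrier F \<and> cls x = X)" for X
  have k: "k (cls x) = h x" if x: "x \<in> carrier F" for x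
  proof -
    have "(SOME y. y \<in> carrier F \<and> cls y = cls x) \<in> carrier F
        \<and> cls (SOME y. y \<in> carrier F \<and> cls y = cls x) = cls x"
      by (rule someI[of _ x]) (use x in simp)
    then show ?thesis unfolding k_def using eq x by blast
  qed
  have "k \<in> alg_hom R Q B"
  proof (rule alg_homI)
    fix X Y assume "X \<in> carrier Q" "Y \<in> carrier Q"
    then obtain x y where xy: "x \<in> carrier F" "y \<in> carrier F" "X = cls x" "Y = cls y"
      unfolding Q_carrier by blast
    show "k (X \<otimes>\<^bsub>Q\<^esub> Y) = k X \<otimes>\<^bsub>B\<^esub> k Y"
      using xy by (simp only: c(2)[symmetric] k F.A.m_closed alg_homD(2)[OF h])
    show "k (X \<oplus>\<^bsub>Q\<^esub> Y) = k X \<oplus>\<^bsub>B\<^esub> k Y"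
      using xy by (simp only: c(3)[symmetric] k F.M.a_closed alg_homD(3)[OF h])
  next
    fix r X assume r: "r \<in> carrier R" and "X \<in> carrier Q"
    then obtain x where x: "x \<in> carrier F" "X = cls x"
      unfolding Q_carrier by blast
    show "k (r \<odot>\<^bsub>Q\<^esub> X) = r \<odot>\<^bsub>B\<^esub> k X"
      using x r by (simp only: c(4)[symmetric] k F.smult_closed alg_homD(4)[OF h])
  next
    fix X assume "X \<in> carrier Q"
    then obtain x where x: "x \<in> carrier F" "X = cls x"
      unfolding Q_carrier by blast
    then show "k X \<in> carrier B" by (simp add: k alg_homD[OF h])
  next
    show "k \<one>\<^bsub>Q\<^esub> = \<one>\<^bsub>B\<^esub>" by (simp only: c(5)[symmetric] k F.A.one_closed alg_homD(5)[OF h])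
  qed
  then show ?thesis using k by blast
qed

lemma Q_span:
  assumes "carrier F \<subseteq> lin_span R F T" "T \<subseteq> carrier F"
  shows "carrier Q \<subseteq> lin_span R Q ((\<lambda>x. cls x) ` T)"
proof
  fix X assume "X \<in> carrier Q"
  then obtain x where x: "x \<in> carrier F" "X = cls x"
    unfolding Q_carrier by blast
  show "X \<in> lin_span R Q ((\<lambda>x. cls x) ` T)"
    unfolding x(2)
    by (rule lin_map_span[OF F.module_axioms assoc_algebra_module[OF Q_algebra] assms(2)
          alg_hom_lin_map[OF cls_alg_hom]])
      (use assms x in \<open>auto intro: lin_span.base\<close>)
qed

end

text \<open>That \<open>h\<close> maps the generators \<open>S\<close> into the ideal generated by \<open>S'\<close> is enough: the preimage of the
  latter, being the kernel of the composite with the quotient map, is an ideal.\<close>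

lemma quotient_map_alg_hom:
  assumes Q: "alg_quotient R F S" and Q': "alg_quotient R F' S'"
    and h: "h \<in> alg_hom R F F'" and hS: "\<And>s. s \<in> S \<Longrightarrow> h s \<in> Idl\<^bsub>F'\<^esub> S'"
  shows "quotient_map F' (Idl\<^bsub>F'\<^esub> S') h
      \<in> alg_hom R (quotient_algebra F (Idl\<^bsub>F\<^esub> S)) (quotient_algebra F' (Idl\<^bsub>F'\<^esub> S'))"
    and "\<And>x. x \<in> carrier F \<Longrightarrow>
      quotient_map F' (Idl\<^bsub>F'\<^esub> S') h (Idl\<^bsub>F\<^esub> S +>\<^bsub>F\<^esub> x) = Idl\<^bsub>F'\<^esub> S' +>\<^bsub>F'\<^esub> h x"
proof -
  interpret Q: alg_quotient R F S by fact
  interpret Q': alg_quotient R F' S' by fact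
  let ?h = "\<lambda>x. Q'.cls (h x)"
  have h': "?h \<in> alg_hom R F Q'.Q"
    by (rule alg_hom_comp[OF h Q'.cls_alg_hom])
  have z: "Q'.cls y = \<zero>\<^bsub>Q'.Q\<^esub>" if "y \<in> Q'.I" for y
    using that Q'.I.a_rcos_const by (simp add: quotient_algebra_def FactRing_def)
  obtain k where k: "k \<in> alg_hom R Q.Q Q'.Q" "\<And>x. x \<in> carrier F \<Longrightarrow> k (Q.cls x) = ?h x"
    using Q.Q_lift[OF Q'.Q_algebra h'] hS z by metis
  have hI: "h x \<in> Q'.I" if "x \<in> Q.I" for x
  proof -
    have "?h x = \<zero>\<^bsub>Q'.Q\<^esub>"
      by (rule Q.kernel_subset[OF Q'.Q_algebra h' _ that]) (use hS z in auto)
    then have "Q'.cls (h x) = Q'.I"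
      by (simp add: quotient_algebra_def FactRing_def)
    moreover have "h x \<in> carrier F'"
      using that Q.I.Icarr alg_homD(1)[OF h] by blast
    ultimately show ?thesis
      using Q'.I.rcos_const_imp_mem by blast
  qed
  show eq: "quotient_map F' Q'.I h (Q.cls x) = ?h x" if x: "x \<in> carrier F" for x
  proof (intro equalityI subsetI)
    fix y assume "y \<in> quotient_map F' Q'.I h (Q.cls x)"
    then obtain i j where ij: "i \<in> Q'.I" "j \<in> Q.I" "y = i \<oplus>\<^bsub>F'\<^esub> h (j \<oplus>\<^bsub>F\<^esub> x)"
      by (auto simp: quotient_map_def set_add_def' a_r_coset_def')
    moreover have "j \<in> carrier F" "i \<in> carrier F'" "h j \<in> carrier F'" "h x \<in> carrier F'"
      using ij Q.I.Icarr Q'.I.Icarr alg_homD(1)[OF h] x by auto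
    ultimately have "y = (i \<oplus>\<^bsub>F'\<^esub> h j) \<oplus>\<^bsub>F'\<^esub> h x"
      using x by (simp add: alg_homD(3)[OF h] Q'.F.M.a_assoc)
    moreover have "i \<oplus>\<^bsub>F'\<^esub> h j \<in> Q'.I" using ij hI by simp
    ultimately show "y \<in> ?h x" by (auto simp: a_r_coset_def')
  next
    fix y assume "y \<in> ?h x"
    then obtain i where "i \<in> Q'.I" "y = i \<oplus>\<^bsub>F'\<^esub> h x"
      by (auto simp: a_r_coset_def')
    moreover have "x \<in> Q.cls x" using x by (rule Q.I.a_rcos_self)
    ultimately show "y \<in> quotient_map F' Q'.I h (Q.cls x)"
      unfolding quotient_map_def set_add_def' by blast
  qed
  have "quotient_map F' Q'.I h X = k X" if "X \<in> carrier Q.Q" for X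
    using that eq k(2) unfolding Q.Q_carrier by auto
  then show "quotient_map F' Q'.I h \<in> alg_hom R Q.Q Q'.Q"
    using alg_homD[OF k(1)] assoc_algebra.axioms(2)[OF Q.Q_algebra]
      assoc_algebra_module[OF Q.Q_algebra]
    by (intro alg_homI) (simp_all add: ring.ring_simprules module.smult_closed)
qed

section \<open>Tensor products\<close>

locale algebra_pair = A: assoc_algebra R A + B: assoc_algebra R B
  for R :: "('r, 'x) ring_scheme" (structure) and A :: "('r, 'a) module" and B :: "('r, 'b) module"
begin

sublocale P: monoid_ring R "A \<times>\<times> B"
  by (intro monoid_ring.intro A.R.is_cring DirProd_monoid A.A.is_monoid B.A.is_monoid)

abbreviation F where "F \<equiv> pairs_algebra R A B"
abbreviation T where "T \<equiv> tensor_algebra R A B"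
abbreviation pure where "pure \<equiv> pure_tensor R A B"

lemma F_algebra: "assoc_algebra R F"
  using P.RG_algebra by (simp add: pairs_algebra_def)

lemma pair_el_closed: "\<lbrakk>a \<in> carrier A; b \<in> carrier B\<rbrakk> \<Longrightarrow> basis_el R (a, b) \<in> carrier F"
  using P.basis_el_closed[of "(a, b)"] by (simp add: pairs_algebra_def)

sublocale F: assoc_algebra R F by (rule F_algebra)

lemma bilinear_relsE:
  assumes "s \<in> bilinear_rels R A B"
  obtains (add_left) a a' b where "a \<in> carrier A" "a' \<in> carrier A" "b \<in> carrier B"
      "s = basis_el R (a \<oplus>\<^bsub>A\<^esub> a', b) \<ominus>\<^bsub>F\<^esub> (basis_el R (a, b) \<oplus>\<^bsub>F\<^esub> basis_el R (a', b))"
    | (add_right) a b b' where "a \<in> carrier A" "b \<in> carrier B" "b' \<in> carrier B"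
      "s = basis_el R (a, b \<oplus>\<^bsub>B\<^esub> b') \<ominus>\<^bsub>F\<^esub> (basis_el R (a, b) \<oplus>\<^bsub>F\<^esub> basis_el R (a, b'))"
    | (smult_left) r a b where "r \<in> carrier R" "a \<in> carrier A" "b \<in> carrier B"
      "s = basis_el R (r \<odot>\<^bsub>A\<^esub> a, b) \<ominus>\<^bsub>F\<^esub> (r \<odot>\<^bsub>F\<^esub> basis_el R (a, b))"
    | (smult_right) r a b where "r \<in> carrier R" "a \<in> carrier A" "b \<in> carrier B"
      "s = basis_el R (a, r \<odot>\<^bsub>B\<^esub> b) \<ominus>\<^bsub>F\<^esub> (r \<odot>\<^bsub>F\<^esub> basis_el R (a, b))"
  using assms unfolding bilinear_rels_def Let_def by (elim UnE CollectE exE conjE) metis+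

lemma bilinear_relsI:
  "\<lbrakk>a \<in> carrier A; a' \<in> carrier A; b \<in> carrier B\<rbrakk> \<Longrightarrow>
    basis_el R (a \<oplus>\<^bsub>A\<^esub> a', b) \<ominus>\<^bsub>F\<^esub> (basis_el R (a, b) \<oplus>\<^bsub>F\<^esub> basis_el R (a', b)) \<in> bilinear_rels R A B"
  "\<lbrakk>a \<in> carrier A; b \<in> carrier B; b' \<in> carrier B\<rbrakk> \<Longrightarrow>
    basis_el R (a, b \<oplus>\<^bsub>B\<^esub> b') \<ominus>\<^bsub>F\<^esub> (basis_el R (a, b) \<oplus>\<^bsub>F\<^esub> basis_el R (a, b')) \<in> bilinear_rels R A B"
  "\<lbrakk>r \<in> carrier R; a \<in> carrier A; b \<in> carrier B\<rbrakk> \<Longrightarrow>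
    basis_el R (r \<odot>\<^bsub>A\<^esub> a, b) \<ominus>\<^bsub>F\<^esub> (r \<odot>\<^bsub>F\<^esub> basis_el R (a, b)) \<in> bilinear_rels R A B"
  "\<lbrakk>r \<in> carrier R; a \<in> carrier A; b \<in> carrier B\<rbrakk> \<Longrightarrow>
    basis_el R (a, r \<odot>\<^bsub>B\<^esub> b) \<ominus>\<^bsub>F\<^esub> (r \<odot>\<^bsub>F\<^esub> basis_el R (a, b)) \<in> bilinear_rels R A B"
  unfolding bilinear_rels_def Let_def
  by (rule UnI1, rule UnI1, rule UnI1, blast, rule UnI1, rule UnI1, rule UnI2, blast,
      rule UnI1, rule UnI2, blast, rule UnI2, blast)

sublocale alg_quotient R F "bilinear_rels R A B"
proof (unfold_locales, rule subsetI)
  fix x assume "x \<in> bilinear_rels R A B"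
  then show "x \<in> carrier F"
    by (cases rule: bilinear_relsE) (simp_all add: pair_el_closed)
qed

lemma T_algebra: "assoc_algebra R T"
  using Q_algebra by (simp add: tensor_algebra_def tensor_ideal_def)

sublocale T: assoc_algebra R T by (rule T_algebra)

lemma pure_eq: "pure a b = cls (basis_el R (a, b))"
  by (simp add: pure_tensor_def tensor_ideal_def)

lemma T_eq: "T = Q"
  by (simp add: tensor_algebra_def tensor_ideal_def)

lemma pure_closed [simp]: "\<lbrakk>a \<in> carrier A; b \<in> carrier B\<rbrakk> \<Longrightarrow> pure a b \<in> carrier T"
  unfolding pure_eq T_eq by (rule alg_homD(1)[OF cls_alg_hom pair_el_closed])

lemma pure_mult:
  assumes "a \<in> carrier A" "a' \<in> carrier A" "b \<in> carrier B" "b' \<in> carrier B"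
  shows "pure a b \<otimes>\<^bsub>T\<^esub> pure a' b' = pure (a \<otimes>\<^bsub>A\<^esub> a') (b \<otimes>\<^bsub>B\<^esub> b')"
  unfolding pure_eq T_eq
  using assms P.basis_el_mult[of "(a, b)" "(a', b')"]
  by (simp add: alg_homD(2)[OF cls_alg_hom, symmetric] pair_el_closed) (simp add: pairs_algebra_def)

lemma pure_one: "\<one>\<^bsub>T\<^esub> = pure \<one>\<^bsub>A\<^esub> \<one>\<^bsub>B\<^esub>"
  unfolding pure_eq T_eq alg_homD(5)[OF cls_alg_hom, symmetric]
  by (simp add: pairs_algebra_def P.RG_simps)

lemma pure_add_left:
  assumes "a \<in> carrier A" "a' \<in> carrier A" "b \<in> carrier B"
  shows "pure (a \<oplus>\<^bsub>A\<^esub> a') b = pure a b \<oplus>\<^bsub>T\<^esub> pure a' b"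
proof -
  have "cls (basis_el R (a \<oplus>\<^bsub>A\<^esub> a', b)) = cls (basis_el R (a, b) \<oplus>\<^bsub>F\<^esub> basis_el R (a', b))"
    by (rule cls_rel) (use assms in \<open>simp_all add: pair_el_closed bilinear_relsI\<close>)
  then show ?thesis
    unfolding pure_eq T_eq using assms by (simp add: alg_homD(3)[OF cls_alg_hom] pair_el_closed)
qed

lemma pure_add_right:
  assumes "a \<in> carrier A" "b \<in> carrier B" "b' \<in> carrier B"
  shows "pure a (b \<oplus>\<^bsub>B\<^esub> b') = pure a b \<oplus>\<^bsub>T\<^esub> pure a b'"
proof -
  have "cls (basis_el R (a, b \<oplus>\<^bsub>B\<^esub> b')) = cls (basis_el R (a, b) \<oplus>\<^bsub>F\<^esub> basis_el R (a, b'))"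
    by (rule cls_rel) (use assms in \<open>simp_all add: pair_el_closed bilinear_relsI\<close>)
  then show ?thesis
    unfolding pure_eq T_eq using assms by (simp add: alg_homD(3)[OF cls_alg_hom] pair_el_closed)
qed

lemma pure_smult_left:
  assumes "r \<in> carrier R" "a \<in> carrier A" "b \<in> carrier B"
  shows "pure (r \<odot>\<^bsub>A\<^esub> a) b = r \<odot>\<^bsub>T\<^esub> pure a b"
proof -
  have "cls (basis_el R (r \<odot>\<^bsub>A\<^esub> a, b)) = cls (r \<odot>\<^bsub>F\<^esub> basis_el R (a, b))"
    by (rule cls_rel) (use assms in \<open>simp_all add: pair_el_closed bilinear_relsI\<close>)
  then show ?thesis
    unfolding pure_eq T_eq using assms by (simp add: alg_homD(4)[OF cls_alg_hom] pair_el_closed)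
qed

lemma pure_smult_right:
  assumes "r \<in> carrier R" "a \<in> carrier A" "b \<in> carrier B"
  shows "pure a (r \<odot>\<^bsub>B\<^esub> b) = r \<odot>\<^bsub>T\<^esub> pure a b"
proof -
  have "cls (basis_el R (a, r \<odot>\<^bsub>B\<^esub> b)) = cls (r \<odot>\<^bsub>F\<^esub> basis_el R (a, b))"
    by (rule cls_rel) (use assms in \<open>simp_all add: pair_el_closed bilinear_relsI\<close>)
  then show ?thesis
    unfolding pure_eq T_eq using assms by (simp add: alg_homD(4)[OF cls_alg_hom] pair_el_closed)
qed

abbreviation pures where "pures \<equiv> {pure a b | a b. a \<in> carrier A \<and> b \<in> carrier B}"

lemma T_span: "carrier T \<subseteq> lin_span R T pures"
proof -
  have "carrier Q \<subseteq> lin_span R Q ((\<lambda>x. cls x) ` basis_el R ` carrier (A \<times>\<times> B))"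
    by (rule Q_span) (use P.RG_span P.basis_el_closed in \<open>auto simp: pairs_algebra_def\<close>)
  moreover have "(\<lambda>x. cls x) ` basis_el R ` carrier (A \<times>\<times> B) = pures"
    by (auto simp: pure_eq image_iff)
  ultimately show ?thesis by (simp add: T_eq)
qed

text \<open>The universal property used here is the one for algebras: as \<open>\<phi>\<close> is multiplicative on pairs, its
  linear extension to the free module on pairs is a homomorphism, so that its kernel is an ideal
  and contains the ideal generated by the bilinearity relations as soon as it contains the
  relations.\<close>

lemma T_lift:
  assumes N: "assoc_algebra R N"
    and cl: "\<And>a b. \<lbrakk>a \<in> carrier A; b \<in> carrier B\<rbrakk> \<Longrightarrow> \<phi> a b \<in> carrier N"
    and l: "\<And>b. b \<in> carrier B \<Longrightarrow> (\<lambda>a. \<phi> a b) \<in> lin_map R A N"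
    and r: "\<And>a. a \<in> carrier A \<Longrightarrow> \<phi> a \<in> lin_map R B N"
    and mult: "\<And>a a' b b'. \<lbrakk>a \<in> carrier A; a' \<in> carrier A; b \<in> carrier B; b' \<in> carrier B\<rbrakk>
      \<Longrightarrow> \<phi> (a \<otimes>\<^bsub>A\<^esub> a') (b \<otimes>\<^bsub>B\<^esub> b') = \<phi> a b \<otimes>\<^bsub>N\<^esub> \<phi> a' b'"
    and one: "\<phi> \<one>\<^bsub>A\<^esub> \<one>\<^bsub>B\<^esub> = \<one>\<^bsub>N\<^esub>"
  shows "\<exists>h \<in> alg_hom R T N. \<forall>a \<in> carrier A. \<forall>b \<in> carrier B. h (pure a b) = \<phi> a b"
proof -
  interpret N: assoc_algebra R N by fact
  define h where "h = P.lin_ext N (\<lambda>(a, b). \<phi> a b)"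
  have h: "h \<in> alg_hom R F N"
    and hb: "\<And>a b. \<lbrakk>a \<in> carrier A; b \<in> carrier B\<rbrakk> \<Longrightarrow> h (basis_el R (a, b)) = \<phi> a b"
    using P.RG_lift[OF N, of "\<lambda>(a, b). \<phi> a b"] cl mult one by (auto simp: pairs_algebra_def h_def)
  note hm = alg_hom_minus[OF h F_algebra N] alg_homD[OF h] pair_el_closed hb
  have "h s = \<zero>\<^bsub>N\<^esub>" if "s \<in> bilinear_rels R A B" for s
    using that
  proof (cases rule: bilinear_relsE)
    case (add_left a a' b)
    then show ?thesis using lin_mapD[OF l] by (simp add: hm cl)
  next
    case (add_right a b b')
    then show ?thesis using lin_mapD[OF r] by (simp add: hm cl)
  next
    case (smult_left k a b)
    then show ?thesis using lin_mapD[OF l] by (simp add: hm cl)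
  next
    case (smult_right k a b)
    then show ?thesis using lin_mapD[OF r] by (simp add: hm cl)
  qed
  from Q_lift[OF N h this] show ?thesis
    unfolding pure_eq T_eq using hb pair_el_closed by metis
qed

end

lemma tensor_map_alg_hom:
  assumes "algebra_pair R A B" "algebra_pair R A' B'"
    and f: "f \<in> alg_hom R A A'" and g: "g \<in> alg_hom R B B'"
  shows "tensor_map R A' B' f g \<in> alg_hom R (tensor_algebra R A B) (tensor_algebra R A' B')"
    and "\<And>a b. \<lbrakk>a \<in> carrier A; b \<in> carrier B\<rbrakk>
      \<Longrightarrow> tensor_map R A' B' f g (pure_tensor R A B a b) = pure_tensor R A' B' (f a) (g b)"
proof -
  interpret P: algebra_pair R A B by fact
  interpret P': algebra_pair R A' B' by fact
  let ?h = "push_forward R (map_prod f g)"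
  note fg = alg_homD[OF f] alg_homD[OF g]
  note pf = push_forward_alg_hom[OF P.P.monoid_ring_axioms P'.P.monoid_ring_axioms,
      where \<phi> = "map_prod f g"]
  have h: "?h \<in> alg_hom R P.F P'.F"
    unfolding pairs_algebra_def by (rule pf) (auto simp: fg)
  have hb: "?h (basis_el R (a, b)) = basis_el R (f a, g b)" if "a \<in> carrier A" "b \<in> carrier B" for a b
    by (subst pf(2)) (use that in \<open>auto simp: fg\<close>)
  note hm = alg_hom_minus[OF h P.F_algebra P'.F_algebra] alg_homD[OF h] P.pair_el_closed hb
  have hS: "?h s \<in> Idl\<^bsub>P'.F\<^esub> (bilinear_rels R A' B')" if "s \<in> bilinear_rels R A B" for s
  proof -
    have "?h s \<in> bilinear_rels R A' B'"
      using that by (cases rule: P.bilinear_relsE) (simp_all add: hm fg P'.bilinear_relsI)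
    then show ?thesis
      using P'.F.A.genideal_self[OF P'.S_subset] by blast
  qed
  note qm = quotient_map_alg_hom[OF P.alg_quotient_axioms P'.alg_quotient_axioms h]
  show "tensor_map R A' B' f g \<in> alg_hom R P.T P'.T"
    using qm(1) hS by (simp add: tensor_map_def tensor_algebra_def tensor_ideal_def)
  show "tensor_map R A' B' f g (P.pure a b) = P'.pure (f a) (g b)"
    if "a \<in> carrier A" "b \<in> carrier B" for a b
    using qm(2)[OF _ P.pair_el_closed[OF that]] hS hb[OF that]
    by (simp add: tensor_map_def pure_tensor_def tensor_ideal_def)
qed

section \<open>The enveloping algebra of a cyclic datum\<close>

lemma opp_alg_simps [simp]:
  "carrier (opp_alg A) = carrier A" "a \<otimes>\<^bsub>opp_alg A\<^esub> b = b \<otimes>\<^bsub>A\<^esub> a"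
  "\<one>\<^bsub>opp_alg A\<^esub> = \<one>\<^bsub>A\<^esub>" "\<zero>\<^bsub>opp_alg A\<^esub> = \<zero>\<^bsub>A\<^esub>"
  "a \<oplus>\<^bsub>opp_alg A\<^esub> b = a \<oplus>\<^bsub>A\<^esub> b" "r \<odot>\<^bsub>opp_alg A\<^esub> a = r \<odot>\<^bsub>A\<^esub> a"
  by (simp_all add: opp_alg_def)

lemma opp_alg_algebra:
  assumes "assoc_algebra R A"
  shows "assoc_algebra R (opp_alg A)"
proof -
  interpret A: assoc_algebra R A by fact
  have ag: "abelian_group (opp_alg A)"
    by (rule abelian_groupI) (auto simp: A.M.a_ac intro: A.M.add.l_inv_ex)
  have "module R (opp_alg A)"
    by (rule moduleI[OF A.R.is_cring ag])
      (auto simp: A.smult_l_distr A.smult_r_distr A.smult_assoc1)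
  moreover have "ring (opp_alg A)"
    by (intro ringI ag monoidI) (auto simp: A.A.m_assoc A.A.l_distr A.A.r_distr)
  ultimately show ?thesis
    by (intro assoc_algebra.intro assoc_algebra_axioms.intro)
      (auto simp: A.smult_mult_left A.smult_mult_right)
qed

lemma opp_alg_hom: "f \<in> alg_hom R A B \<Longrightarrow> f \<in> alg_hom R (opp_alg A) (opp_alg B)"
  by (intro alg_homI) (auto simp: alg_homD)

lemma opp_pair: "assoc_algebra R A \<Longrightarrow> algebra_pair R A (opp_alg A)"
  by (intro algebra_pair.intro opp_alg_algebra)

lemma env_alg_map_hom:
  assumes "assoc_algebra R A" "assoc_algebra R B" "f \<in> alg_hom R A B"
  shows "env_alg_map R B f \<in> alg_hom R (env_alg R A) (env_alg R B)"
    and "\<And>a b. \<lbrakk>a \<in> carrier A; b \<in> carrier A\<rbrakk>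
      \<Longrightarrow> env_alg_map R B f (env_tensor R A a b) = env_tensor R B (f a) (f b)"
  using tensor_map_alg_hom[OF opp_pair[OF assms(1)] opp_pair[OF assms(2)] assms(3) opp_alg_hom[OF assms(3)]]
  by (auto simp: env_alg_def)

lemma funpow_funpow: "(f ^^ i) ((f ^^ j) x) = (f ^^ (i + j)) x"
  by (simp add: funpow_add)

lemma alg_hom_funpow: "h \<in> alg_hom R B B \<Longrightarrow> h ^^ k \<in> alg_hom R B B"
proof (induction k)
  case 0
  show ?case by (rule alg_homI) auto
next
  case (Suc k)
  then show ?case using alg_hom_comp[of "h ^^ k" R B B h] by (simp add: comp_def)
qed

context cyclic_datum
begin

sublocale env: algebra_pair R A "opp_alg A"
  by (rule opp_pair) (rule assoc_algebra_axioms)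

abbreviation E where "E \<equiv> env_alg R A"
abbreviation tens where "tens \<equiv> env_tensor R A"
abbreviation \<sigma>e where "\<sigma>e \<equiv> env_alg_map R A \<sigma>"
abbreviation c' where "c' \<equiv> inv\<^bsub>A\<^esub> c"
abbreviation z where "z \<equiv> tens c c'"

lemma E_algebra: "assoc_algebra R E"
  using env.T_algebra by (simp add: env_alg_def)

sublocale E: assoc_algebra R E by (rule E_algebra)

lemma c_closed [simp]: "c \<in> carrier A" "c' \<in> carrier A"
  using c_unit by auto

lemma c_inv [simp]: "c \<otimes>\<^bsub>A\<^esub> c' = \<one>\<^bsub>A\<^esub>" "c' \<otimes>\<^bsub>A\<^esub> c = \<one>\<^bsub>A\<^esub>"
  using c_unit by auto

lemma c_inv_cancel [simp]:
  assumes "a \<in> carrier A"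
  shows "c \<otimes>\<^bsub>A\<^esub> (c' \<otimes>\<^bsub>A\<^esub> a) = a" "c' \<otimes>\<^bsub>A\<^esub> (c \<otimes>\<^bsub>A\<^esub> a) = a"
  using assms by (simp_all add: A.m_assoc[symmetric])

lemma tens_closed [simp]: "\<lbrakk>a \<in> carrier A; b \<in> carrier A\<rbrakk> \<Longrightarrow> tens a b \<in> carrier E"
  using env.pure_closed by (simp add: env_alg_def)

lemma tens_mult:
  "\<lbrakk>a \<in> carrier A; a' \<in> carrier A; b \<in> carrier A; b' \<in> carrier A\<rbrakk>
    \<Longrightarrow> tens a b \<otimes>\<^bsub>E\<^esub> tens a' b' = tens (a \<otimes>\<^bsub>A\<^esub> a') (b' \<otimes>\<^bsub>A\<^esub> b)"
  using env.pure_mult[of a a' b b'] by (simp add: env_alg_def)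

lemma tens_one: "\<one>\<^bsub>E\<^esub> = tens \<one>\<^bsub>A\<^esub> \<one>\<^bsub>A\<^esub>"
  using env.pure_one by (simp add: env_alg_def)

lemma tens_linear:
  "b \<in> carrier A \<Longrightarrow> (\<lambda>a. tens a b) \<in> lin_map R A E"
  "a \<in> carrier A \<Longrightarrow> (\<lambda>b. tens a b) \<in> lin_map R A E"
  using env.pure_add_left env.pure_smult_left env.pure_add_right env.pure_smult_right
  by (auto intro!: lin_mapI simp: env_alg_def)

abbreviation tensors where "tensors \<equiv> {tens a b | a b. a \<in> carrier A \<and> b \<in> carrier A}"

lemma E_span: "carrier E \<subseteq> lin_span R E tensors"
  using env.T_span by (simp add: env_alg_def)

lemma tensors_subset: "tensors \<subseteq> carrier E"
  by auto

lemma \<sigma>_hom: "\<sigma> \<in> alg_hom R A A"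
  using \<sigma>_aut by (simp add: alg_iso_def)

lemma \<sigma>_pow_hom: "\<sigma> ^^ k \<in> alg_hom R A A"
  by (rule alg_hom_funpow[OF \<sigma>_hom])

lemmas \<sigma>_pow = alg_homD[OF \<sigma>_pow_hom]

lemma \<sigma>_pow_closed [simp]: "a \<in> carrier A \<Longrightarrow> (\<sigma> ^^ k) a \<in> carrier A"
  by (rule \<sigma>_pow)

lemma \<sigma>_closed [simp]: "a \<in> carrier A \<Longrightarrow> \<sigma> a \<in> carrier A"
  by (rule alg_homD[OF \<sigma>_hom])

lemma \<sigma>_c_inv: "\<sigma> c' = c'"
  using alg_hom_inv(2)[OF \<sigma>_hom A.is_monoid A.is_monoid c_unit] \<sigma>_c by simp

lemma \<sigma>_pow_c [simp]: "(\<sigma> ^^ k) c = c" "(\<sigma> ^^ k) c' = c'" "(\<sigma> ^^ k) \<one>\<^bsub>A\<^esub> = \<one>\<^bsub>A\<^esub>"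
  by (induction k) (simp_all add: \<sigma>_c \<sigma>_c_inv alg_homD(5)[OF \<sigma>_hom])

lemma c_commute: "a \<in> carrier A \<Longrightarrow> c \<otimes>\<^bsub>A\<^esub> a = (\<sigma> ^^ m) a \<otimes>\<^bsub>A\<^esub> c"
  by (simp add: \<sigma>_pow_m A.m_assoc)

lemma \<sigma>e_hom: "\<sigma>e \<in> alg_hom R E E"
  by (rule env_alg_map_hom[OF assoc_algebra_axioms assoc_algebra_axioms \<sigma>_hom])

lemma \<sigma>e_tens: "\<lbrakk>a \<in> carrier A; b \<in> carrier A\<rbrakk> \<Longrightarrow> \<sigma>e (tens a b) = tens (\<sigma> a) (\<sigma> b)"
  by (rule env_alg_map_hom[OF assoc_algebra_axioms assoc_algebra_axioms \<sigma>_hom])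

lemma \<sigma>e_pow_tens:
  "\<lbrakk>a \<in> carrier A; b \<in> carrier A\<rbrakk> \<Longrightarrow> (\<sigma>e ^^ k) (tens a b) = tens ((\<sigma> ^^ k) a) ((\<sigma> ^^ k) b)"
  by (induction k) (simp_all add: \<sigma>e_tens)

lemma \<sigma>e_pow_hom: "\<sigma>e ^^ k \<in> alg_hom R E E"
  by (rule alg_hom_funpow[OF \<sigma>e_hom])

lemmas \<sigma>e_pow = alg_homD[OF \<sigma>e_pow_hom]

lemma \<sigma>e_pow_closed [simp]: "x \<in> carrier E \<Longrightarrow> (\<sigma>e ^^ k) x \<in> carrier E"
  by (rule \<sigma>e_pow)

lemma \<sigma>e_pow_z [simp]: "(\<sigma>e ^^ k) (z [^]\<^bsub>E\<^esub> (j::nat)) = z [^]\<^bsub>E\<^esub> j"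
  using alg_hom_pow[OF \<sigma>e_pow_hom E.A.is_monoid E.A.is_monoid, of z k j]
  by (simp add: \<sigma>e_pow_tens)

lemma z_inv: "z \<otimes>\<^bsub>E\<^esub> tens c' c = \<one>\<^bsub>E\<^esub>" "tens c' c \<otimes>\<^bsub>E\<^esub> z = \<one>\<^bsub>E\<^esub>"
  by (simp_all add: tens_mult tens_one)

text \<open>The condition \<open>\<sigma>\<^sup>m(a) = c a c\<inverse>\<close> says on \<open>A \<otimes> A\<^sup>o\<^sup>p\<close> that the \<open>m\<close>-th power of \<open>\<sigma> \<otimes> \<sigma>\<close> is conjugation by
  \<open>c \<otimes> c\<inverse>\<close>: on pure tensors, \<open>(c \<otimes> c\<inverse>)(a \<otimes> b) = c a \<otimes> b c\<inverse> = (\<sigma>\<^sup>m(a) \<otimes> \<sigma>\<^sup>m(b))(c \<otimes> c\<inverse>)\<close>.\<close>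

lemma z_commute: 
  assumes "x \<in> carrier E"
  shows "z \<otimes>\<^bsub>E\<^esub> x = (\<sigma>e ^^ m) x \<otimes>\<^bsub>E\<^esub> z"
proof (rule lin_map_eq_on_span[OF E.module_axioms E.module_axioms tensors_subset
      E.mult_left_linear lin_map_comp[OF alg_hom_lin_map[OF \<sigma>e_pow_hom] E.mult_right_linear]])
  fix s assume "s \<in> tensors"
  then show "z \<otimes>\<^bsub>E\<^esub> s = (\<sigma>e ^^ m) s \<otimes>\<^bsub>E\<^esub> z"
    by (auto simp: \<sigma>e_pow_tens tens_mult \<sigma>_pow_m A.m_assoc)
qed (use assms E_span in auto)

lemma z_pow_commute:
  assumes "x \<in> carrier E"
  shows "z [^]\<^bsub>E\<^esub> (k::nat) \<otimes>\<^bsub>E\<^esub> x = (\<sigma>e ^^ (k * m)) x \<otimes>\<^bsub>E\<^esub> z [^]\<^bsub>E\<^esub> k"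
  using assms
proof (induction k arbitrary: x)
  case (Suc k)
  have "z [^]\<^bsub>E\<^esub> Suc k \<otimes>\<^bsub>E\<^esub> x = z [^]\<^bsub>E\<^esub> k \<otimes>\<^bsub>E\<^esub> ((\<sigma>e ^^ m) x \<otimes>\<^bsub>E\<^esub> z)"
    using Suc.prems by (simp add: E.A.m_assoc z_commute)
  also have "\<dots> = (\<sigma>e ^^ (k * m)) ((\<sigma>e ^^ m) x) \<otimes>\<^bsub>E\<^esub> z [^]\<^bsub>E\<^esub> k \<otimes>\<^bsub>E\<^esub> z"
    using Suc by (simp add: E.A.m_assoc[symmetric])
  also have "(\<sigma>e ^^ (k * m)) ((\<sigma>e ^^ m) x) = (\<sigma>e ^^ (Suc k * m)) x"
    by (simp add: funpow_funpow add.commute)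
  finally show ?case using Suc.prems by (simp add: E.A.m_assoc)
qed simp

section \<open>The cyclic crossed product\<close>

abbreviation C where "C \<equiv> crossed_product R m A \<sigma> c"
abbreviation monom where "monom \<equiv> crossed_monom R m A"
abbreviation u where "u \<equiv> monom \<one>\<^bsub>E\<^esub> 1"
abbreviation (input) C_idx where "C_idx t \<equiv> {p. fst p < m \<and> snd p < m \<and> (fst p + snd p) mod m = t}"

lemma C_simps:
  "carrier C = {..<m} \<rightarrow>\<^sub>E carrier E"
  "x \<oplus>\<^bsub>C\<^esub> y = (\<lambda>t\<in>{..<m}. x t \<oplus>\<^bsub>E\<^esub> y t)"
  "r \<odot>\<^bsub>C\<^esub> x = (\<lambda>t\<in>{..<m}. r \<odot>\<^bsub>E\<^esub> x t)"
  "\<zero>\<^bsub>C\<^esub> = (\<lambda>t\<in>{..<m}. \<zero>\<^bsub>E\<^esub>)"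
  "\<one>\<^bsub>C\<^esub> = monom \<one>\<^bsub>E\<^esub> 0"
  by (simp_all add: crossed_product_def crossed_monom_def Let_def)

lemma C_mult: "x \<otimes>\<^bsub>C\<^esub> y = (\<lambda>t\<in>{..<m}. \<Oplus>\<^bsub>E\<^esub>p\<in>C_idx t.
    x (fst p) \<otimes>\<^bsub>E\<^esub> (\<sigma>e ^^ fst p) (y (snd p)) \<otimes>\<^bsub>E\<^esub> z [^]\<^bsub>E\<^esub> ((fst p + snd p) div m))"
  by (simp add: crossed_product_def Let_def minus_div_mult_eq_mod case_prod_unfold)

lemma C_idx_finite: "finite (C_idx t)"
  by (rule finite_subset[of _ "{..<m} \<times> {..<m}"]) auto

lemma C_memD: "\<lbrakk>x \<in> carrier C; r < m\<rbrakk> \<Longrightarrow> x r \<in> carrier E"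
  by (auto simp: C_simps)

lemma C_memI: "(\<And>r. r < m \<Longrightarrow> f r \<in> carrier E) \<Longrightarrow> (\<lambda>r\<in>{..<m}. f r) \<in> carrier C"
  by (auto simp: C_simps)

lemma C_eqI: "\<lbrakk>x \<in> carrier C; y \<in> carrier C; \<And>r. r < m \<Longrightarrow> x r = y r\<rbrakk> \<Longrightarrow> x = y"
  unfolding C_simps by (erule (1) PiE_ext) simp

lemma monom_closed [simp]: "x \<in> carrier E \<Longrightarrow> monom x r \<in> carrier C"
  unfolding crossed_monom_def by (rule C_memI) auto

lemma C_module: "module R C"
  by (rule pointwise_module[OF E.module_axioms, of _ "{..<m}"]; (rule C_eqI)?)
    (auto simp: C_simps(2-4) C_memD intro!: C_memI)

sublocale CM: module R C by (rule C_module)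

definition C_term where
  "C_term x y p
    = x (fst p) \<otimes>\<^bsub>E\<^esub> (\<sigma>e ^^ fst p) (y (snd p)) \<otimes>\<^bsub>E\<^esub> z [^]\<^bsub>E\<^esub> ((fst p + snd p) div m)"

lemma C_mult_term: "t < m \<Longrightarrow> (x \<otimes>\<^bsub>C\<^esub> y) t = (\<Oplus>\<^bsub>E\<^esub>p\<in>C_idx t. C_term x y p)"
  by (simp add: C_mult C_term_def)

lemma C_term_closed:
  "\<lbrakk>x \<in> carrier C; y \<in> carrier C; p \<in> C_idx t\<rbrakk> \<Longrightarrow> C_term x y p \<in> carrier E"
  by (simp add: C_memD C_term_def)

lemma C_mult_closed: "\<lbrakk>x \<in> carrier C; y \<in> carrier C\<rbrakk> \<Longrightarrow> x \<otimes>\<^bsub>C\<^esub> y \<in> carrier C"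
  unfolding C_mult by (intro C_memI E.M.finsum_closed) (auto simp: C_memD)

lemma C_mult_bilinear:
  assumes w: "w \<in> carrier C"
  shows "(\<lambda>x. x \<otimes>\<^bsub>C\<^esub> w) \<in> lin_map R C C" and "(\<lambda>x. w \<otimes>\<^bsub>C\<^esub> x) \<in> lin_map R C C"
proof -
  have add: "(x1 \<otimes>\<^bsub>C\<^esub> y1) = (x2 \<otimes>\<^bsub>C\<^esub> y2) \<oplus>\<^bsub>C\<^esub> (x3 \<otimes>\<^bsub>C\<^esub> y3)"
    if "\<And>p t. p \<in> C_idx t \<Longrightarrow> C_term x1 y1 p = C_term x2 y2 p \<oplus>\<^bsub>E\<^esub> C_term x3 y3 p"
      and c: "x1 \<in> carrier C" "y1 \<in> carrier C" "x2 \<in> carrier C" "y2 \<in> carrier C"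
        "x3 \<in> carrier C" "y3 \<in> carrier C" for x1 y1 x2 y2 x3 y3
  proof (rule C_eqI)
    fix t assume t: "t < m"
    have "(\<Oplus>\<^bsub>E\<^esub>p\<in>C_idx t. C_term x1 y1 p) = (\<Oplus>\<^bsub>E\<^esub>p\<in>C_idx t. C_term x2 y2 p \<oplus>\<^bsub>E\<^esub> C_term x3 y3 p)"
      by (rule E.M.finsum_cong') (use that(1) C_term_closed[OF c(3,4)] C_term_closed[OF c(5,6)] in auto)
    also have "\<dots> = (\<Oplus>\<^bsub>E\<^esub>p\<in>C_idx t. C_term x2 y2 p) \<oplus>\<^bsub>E\<^esub> (\<Oplus>\<^bsub>E\<^esub>p\<in>C_idx t. C_term x3 y3 p)"
      by (rule E.M.finsum_addf) (use C_term_closed[OF c(3,4)] C_term_closed[OF c(5,6)] in auto)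
    finally show "(x1 \<otimes>\<^bsub>C\<^esub> y1) t = (x2 \<otimes>\<^bsub>C\<^esub> y2 \<oplus>\<^bsub>C\<^esub> x3 \<otimes>\<^bsub>C\<^esub> y3) t"
      using t by (simp add: C_mult_term C_simps(2))
  qed (use c in \<open>auto intro!: C_mult_closed CM.M.a_closed\<close>)
  have smult: "(x1 \<otimes>\<^bsub>C\<^esub> y1) = k \<odot>\<^bsub>C\<^esub> (x2 \<otimes>\<^bsub>C\<^esub> y2)"
    if "\<And>p t. p \<in> C_idx t \<Longrightarrow> C_term x1 y1 p = k \<odot>\<^bsub>E\<^esub> C_term x2 y2 p"
      and c: "x1 \<in> carrier C" "y1 \<in> carrier C" "x2 \<in> carrier C" "y2 \<in> carrier C"
        "k \<in> carrier R" for x1 y1 x2 y2 k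
  proof (rule C_eqI)
    fix t assume t: "t < m"
    have "(\<Oplus>\<^bsub>E\<^esub>p\<in>C_idx t. C_term x1 y1 p) = (\<Oplus>\<^bsub>E\<^esub>p\<in>C_idx t. k \<odot>\<^bsub>E\<^esub> C_term x2 y2 p)"
      by (rule E.M.finsum_cong') (use that(1) C_term_closed[OF c(3,4)] c(5) in auto)
    also have "\<dots> = k \<odot>\<^bsub>E\<^esub> (\<Oplus>\<^bsub>E\<^esub>p\<in>C_idx t. C_term x2 y2 p)"
      by (rule E.finsum_smult_ldistr[OF C_idx_finite, symmetric]) (use C_term_closed[OF c(3,4)] c(5) in auto)
    finally show "(x1 \<otimes>\<^bsub>C\<^esub> y1) t = (k \<odot>\<^bsub>C\<^esub> (x2 \<otimes>\<^bsub>C\<^esub> y2)) t"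
      using t by (simp add: C_mult_term C_simps(3))
  qed (use c in \<open>auto intro!: C_mult_closed CM.smult_closed\<close>)
  show "(\<lambda>x. x \<otimes>\<^bsub>C\<^esub> w) \<in> lin_map R C C"
    by (intro lin_mapI add smult C_mult_closed CM.M.a_closed CM.smult_closed)
      (use w in \<open>auto simp: C_term_def C_simps(2,3) C_memD E.A.l_distr E.smult_mult_left\<close>)
  show "(\<lambda>x. w \<otimes>\<^bsub>C\<^esub> x) \<in> lin_map R C C"
    by (intro lin_mapI add smult C_mult_closed CM.M.a_closed CM.smult_closed)
      (use w in \<open>auto simp: C_term_def C_simps(2,3) C_memD \<sigma>e_pow E.A.l_distr E.A.r_distr
        E.smult_mult_left E.smult_mult_right\<close>)
qed

lemma monom_mult:
  assumes x: "x \<in> carrier E" and y: "y \<in> carrier E" and r: "r < m" and s: "s < m"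
  shows "monom x r \<otimes>\<^bsub>C\<^esub> monom y s
    = monom (x \<otimes>\<^bsub>E\<^esub> (\<sigma>e ^^ r) y \<otimes>\<^bsub>E\<^esub> z [^]\<^bsub>E\<^esub> ((r + s) div m)) ((r + s) mod m)"
    (is "_ = monom ?v _")
proof (rule C_eqI)
  fix t assume t: "t < m"
  have zero: "(\<sigma>e ^^ k) \<zero>\<^bsub>E\<^esub> = \<zero>\<^bsub>E\<^esub>" for k
    by (rule lin_map_zero[OF alg_hom_lin_map[OF \<sigma>e_pow_hom] E.module_axioms E.module_axioms])
  have v: "?v \<in> carrier E" using x y by simp
  have "(monom x r \<otimes>\<^bsub>C\<^esub> monom y s) t = (\<Oplus>\<^bsub>E\<^esub>p\<in>C_idx t. if p = (r, s) then ?v else \<zero>\<^bsub>E\<^esub>)"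
    unfolding C_mult using t
    by (simp only: restrict_apply' lessThan_iff, intro E.M.finsum_cong')
      (use x y v in \<open>auto simp: crossed_monom_def zero\<close>)
  also have "\<dots> = (if (r, s) \<in> C_idx t then ?v else \<zero>\<^bsub>E\<^esub>)"
  proof (cases "(r, s) \<in> C_idx t")
    case True
    then show ?thesis
      using E.M.add.finprod_singleton_swap[OF True C_idx_finite, of "\<lambda>_. ?v"] v by (simp add: Pi_def)
  next
    case False
    then have "(\<Oplus>\<^bsub>E\<^esub>p\<in>C_idx t. if p = (r, s) then ?v else \<zero>\<^bsub>E\<^esub>) = (\<Oplus>\<^bsub>E\<^esub>p\<in>C_idx t. \<zero>\<^bsub>E\<^esub>)"
      by (intro E.M.finsum_cong') auto
    then show ?thesis using False by (simp only: E.M.finsum_zero if_False)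
  qed
  also have "\<dots> = monom ?v ((r + s) mod m) t"
    using r s t by (auto simp: crossed_monom_def)
  finally show "(monom x r \<otimes>\<^bsub>C\<^esub> monom y s) t = monom ?v ((r + s) mod m) t" .
qed (use x y in \<open>auto intro!: C_mult_closed\<close>)

abbreviation monoms where "monoms \<equiv> {monom x r | x r. x \<in> carrier E \<and> r < m}"

lemma monom_linear: "(\<lambda>x. monom x r) \<in> lin_map R E C"
  by (intro lin_mapI C_eqI) (auto intro!: CM.M.a_closed CM.smult_closed, auto simp: C_simps crossed_monom_def)

lemma C_span: "carrier C \<subseteq> lin_span R C monoms"
proof
  fix x assume x: "x \<in> carrier C"
  have "k \<le> m \<Longrightarrow> (\<lambda>r\<in>{..<m}. if r < k then x r else \<zero>\<^bsub>E\<^esub>) \<in> lin_span R C monoms" for k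
  proof (induction k)
    case 0
    have "(\<lambda>r\<in>{..<m}. if r < 0 then x r else \<zero>\<^bsub>E\<^esub>) = \<zero>\<^bsub>C\<^esub>"
      by (simp add: C_simps(4) restrict_def)
    then show ?case using lin_span.zero[of C R monoms] by simp
  next
    case (Suc k)
    have "(\<lambda>r\<in>{..<m}. if r < Suc k then x r else \<zero>\<^bsub>E\<^esub>)
        = (\<lambda>r\<in>{..<m}. if r < k then x r else \<zero>\<^bsub>E\<^esub>) \<oplus>\<^bsub>C\<^esub> monom (x k) k"
      using C_memD[OF x] Suc.prems
      by (auto simp: C_simps crossed_monom_def less_Suc_eq intro!: restrict_ext)
    moreover have "(\<lambda>r\<in>{..<m}. if r < k then x r else \<zero>\<^bsub>E\<^esub>) \<in> lin_span R C monoms"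
      by (rule Suc.IH) (use Suc.prems in simp)
    moreover have "monom (x k) k \<in> lin_span R C monoms"
      using C_memD[OF x, of k] Suc.prems by (intro lin_span.base CollectI exI[of _ "x k"] exI[of _ k]) auto
    ultimately show ?case by (simp only: lin_span.add)
  qed
  from this[of m] have "(\<lambda>r\<in>{..<m}. x r) \<in> lin_span R C monoms"
    by (simp cong: restrict_cong)
  moreover have "(\<lambda>r\<in>{..<m}. x r) = x"
    using x by (auto simp: C_simps PiE_iff extensional_restrict)
  ultimately show "x \<in> lin_span R C monoms" by simp
qed

lemma monoms_subset: "monoms \<subseteq> carrier C"
  by auto

text \<open>On monomials, associativity amounts to two facts. The powers of \<open>z\<close> produced by reducing the
  exponents modulo \<open>m\<close> add up to the same total \<open>(r + s + t) div m\<close> for both bracketings; and moving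
  \<open>z\<close> to the right past a coefficient supplies the power of \<open>\<sigma>\<^sup>e\<close> lost in that reduction.\<close>

lemma C_algebra: "assoc_algebra R C"
proof (rule assoc_algebraI_span[OF C_module C_mult_closed _ _ _ _ _ monoms_subset C_span])
  fix x y w assume "x \<in> monoms" "y \<in> monoms" "w \<in> monoms"
  then obtain a r b s d t where *: "x = monom a r" "y = monom b s" "w = monom d t"
    "a \<in> carrier E" "b \<in> carrier E" "d \<in> carrier E" "r < m" "s < m" "t < m"
    by blast
  let ?p = "(r + s) div m" and ?q = "(s + t) div m"
  have m0: "0 < m" using m_ge_2 by simp
  have carry: "j div m + (j mod m + k) div m = (j + k) div m" for j k
  proof -
    have "j mod m + k + j div m * m = j + k"
      using mod_div_mult_eq[of j m] by linarith
    moreover have "(j mod m + k + j div m * m) div m = j div m + (j mod m + k) div m"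
      by (rule div_mult_self1) (use m0 in simp)
    ultimately show ?thesis by simp
  qed
  have 1: "?p + ((r + s) mod m + t) div m = (r + s + t) div m"
    by (rule carry)
  have 2: "?q + (r + (s + t) mod m) div m = (r + s + t) div m"
    using carry[of "s + t" r] by (simp add: ac_simps)
  have "x \<otimes>\<^bsub>C\<^esub> y \<otimes>\<^bsub>C\<^esub> w
      = monom (a \<otimes>\<^bsub>E\<^esub> (\<sigma>e ^^ r) b \<otimes>\<^bsub>E\<^esub> z [^]\<^bsub>E\<^esub> ?p \<otimes>\<^bsub>E\<^esub> (\<sigma>e ^^ ((r + s) mod m)) d
          \<otimes>\<^bsub>E\<^esub> z [^]\<^bsub>E\<^esub> (((r + s) mod m + t) div m)) ((r + s + t) mod m)"
    using * m0 by (simp add: monom_mult mod_add_left_eq)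
  also have "a \<otimes>\<^bsub>E\<^esub> (\<sigma>e ^^ r) b \<otimes>\<^bsub>E\<^esub> z [^]\<^bsub>E\<^esub> ?p \<otimes>\<^bsub>E\<^esub> (\<sigma>e ^^ ((r + s) mod m)) d
          \<otimes>\<^bsub>E\<^esub> z [^]\<^bsub>E\<^esub> (((r + s) mod m + t) div m)
      = a \<otimes>\<^bsub>E\<^esub> ((\<sigma>e ^^ r) b \<otimes>\<^bsub>E\<^esub> ((z [^]\<^bsub>E\<^esub> ?p \<otimes>\<^bsub>E\<^esub> (\<sigma>e ^^ ((r + s) mod m)) d)
          \<otimes>\<^bsub>E\<^esub> z [^]\<^bsub>E\<^esub> (((r + s) mod m + t) div m)))"
    using * by (simp add: E.A.m_assoc)
  also have "z [^]\<^bsub>E\<^esub> ?p \<otimes>\<^bsub>E\<^esub> (\<sigma>e ^^ ((r + s) mod m)) d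
      = (\<sigma>e ^^ (r + s)) d \<otimes>\<^bsub>E\<^esub> z [^]\<^bsub>E\<^esub> ?p"
    using * by (simp add: z_pow_commute funpow_funpow)
  also have "(\<sigma>e ^^ (r + s)) d \<otimes>\<^bsub>E\<^esub> z [^]\<^bsub>E\<^esub> ?p \<otimes>\<^bsub>E\<^esub> z [^]\<^bsub>E\<^esub> (((r + s) mod m + t) div m)
      = (\<sigma>e ^^ (r + s)) d \<otimes>\<^bsub>E\<^esub> z [^]\<^bsub>E\<^esub> ((r + s + t) div m)"
    using * by (simp add: E.A.m_assoc E.A.nat_pow_mult 1)
  also have "monom (a \<otimes>\<^bsub>E\<^esub> ((\<sigma>e ^^ r) b \<otimes>\<^bsub>E\<^esub> ((\<sigma>e ^^ (r + s)) d \<otimes>\<^bsub>E\<^esub> z [^]\<^bsub>E\<^esub> ((r + s + t) div m))))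
        ((r + s + t) mod m) = x \<otimes>\<^bsub>C\<^esub> (y \<otimes>\<^bsub>C\<^esub> w)"
    using * m0 2[symmetric]
    by (simp add: monom_mult mod_add_right_eq add.assoc \<sigma>e_pow E.A.m_assoc E.A.nat_pow_mult[symmetric] funpow_add)
  finally show "x \<otimes>\<^bsub>C\<^esub> y \<otimes>\<^bsub>C\<^esub> w = x \<otimes>\<^bsub>C\<^esub> (y \<otimes>\<^bsub>C\<^esub> w)" .
next
  have m0: "0 < m" using m_ge_2 by simp
  fix x assume "x \<in> monoms"
  then obtain a r where *: "x = monom a r" "a \<in> carrier E" "r < m" by blast
  then show "\<one>\<^bsub>C\<^esub> \<otimes>\<^bsub>C\<^esub> x = x" "x \<otimes>\<^bsub>C\<^esub> \<one>\<^bsub>C\<^esub> = x"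
    using m0 by (simp_all add: C_simps(5) monom_mult \<sigma>e_pow)
next
  show "\<one>\<^bsub>C\<^esub> \<in> carrier C" by (simp add: C_simps(5))
qed (use C_mult_bilinear[THEN lin_mapD(2)] C_mult_bilinear[THEN lin_mapD(3)] in auto)

sublocale C: assoc_algebra R C by (rule C_algebra)

lemma u_closed [simp]: "u \<in> carrier C"
  by simp

lemma monom0_hom: "(\<lambda>x. monom x 0) \<in> alg_hom R E C"
  using m_ge_2 lin_mapD[OF monom_linear[of 0]]
  by (intro alg_homI) (auto simp: monom_mult C_simps(5))

lemma monom_eq: 
  assumes "x \<in> carrier E" "r < m"
  shows "monom x r = monom x 0 \<otimes>\<^bsub>C\<^esub> u [^]\<^bsub>C\<^esub> r"
proof -
  have "r < m \<Longrightarrow> u [^]\<^bsub>C\<^esub> r = monom \<one>\<^bsub>E\<^esub> r" for r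
  proof (induction r)
    case (Suc r)
    then show ?case using m_ge_2 by (simp add: monom_mult \<sigma>e_pow)
  qed (simp add: C_simps)
  then show ?thesis using assms m_ge_2 by (simp add: monom_mult \<sigma>e_pow)
qed

lemma u_pow_m: "u [^]\<^bsub>C\<^esub> m = monom z 0"
proof -
  define k where "k = m - 1"
  have k: "Suc k = m" "k < m" "0 < m" "1 < m" using m_ge_2 by (auto simp: k_def)
  have "monom \<one>\<^bsub>E\<^esub> k = u [^]\<^bsub>C\<^esub> k"
    using monom_eq[of "\<one>\<^bsub>E\<^esub>" k] k by (simp add: C_simps(5)[symmetric])
  then have "u [^]\<^bsub>C\<^esub> m = monom \<one>\<^bsub>E\<^esub> k \<otimes>\<^bsub>C\<^esub> u"
    using C.A.nat_pow_Suc[of u k] by (simp only: k(1))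
  also have "\<dots> = monom z 0"
    using k by (simp add: monom_mult \<sigma>e_pow)
  finally show ?thesis .
qed

lemma u_commute: "x \<in> carrier E \<Longrightarrow> u \<otimes>\<^bsub>C\<^esub> monom x 0 = monom (\<sigma>e x) 0 \<otimes>\<^bsub>C\<^esub> u"
  using m_ge_2 alg_homD(1)[OF \<sigma>e_hom] by (simp add: monom_mult \<sigma>e_pow)

text \<open>This is the presentation of the crossed product by the relations \<open>u x = \<sigma>\<^sup>e(x) u\<close> and
  \<open>u\<^sup>m = z\<close>, in the form of a universal property.\<close>

lemma C_lift:
  assumes B: "assoc_algebra R B" and \<phi>: "\<phi> \<in> alg_hom R E B" and s: "s \<in> carrier B"
    and comm: "\<And>x. x \<in> carrier E \<Longrightarrow> s \<otimes>\<^bsub>B\<^esub> \<phi> x = \<phi> (\<sigma>e x) \<otimes>\<^bsub>B\<^esub> s"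
    and pow: "s [^]\<^bsub>B\<^esub> m = \<phi> z"
  shows "\<exists>\<psi> \<in> alg_hom R C B. \<forall>x \<in> carrier E. \<forall>r < m. \<psi> (monom x r) = \<phi> x \<otimes>\<^bsub>B\<^esub> s [^]\<^bsub>B\<^esub> r"
proof -
  interpret B: assoc_algebra R B by fact
  note \<phi>' = alg_homD[OF \<phi>]
  define \<psi> where "\<psi> x = (\<Oplus>\<^bsub>B\<^esub>r\<in>{..<m}. \<phi> (x r) \<otimes>\<^bsub>B\<^esub> s [^]\<^bsub>B\<^esub> r)" for x
  have lin: "\<psi> \<in> lin_map R C B"
  proof (rule lin_mapI)
    fix x y assume x: "x \<in> carrier C" and y: "y \<in> carrier C"
    show "\<psi> x \<in> carrier B"
      unfolding \<psi>_def by (rule B.M.finsum_closed) (use C_memD[OF x] s \<phi>' in auto)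
    have "\<psi> (x \<oplus>\<^bsub>C\<^esub> y)
        = (\<Oplus>\<^bsub>B\<^esub>r\<in>{..<m}. \<phi> (x r) \<otimes>\<^bsub>B\<^esub> s [^]\<^bsub>B\<^esub> r \<oplus>\<^bsub>B\<^esub> \<phi> (y r) \<otimes>\<^bsub>B\<^esub> s [^]\<^bsub>B\<^esub> r)"
      unfolding \<psi>_def by (rule B.M.finsum_cong')
        (use C_memD[OF x] C_memD[OF y] s in \<open>auto simp: C_simps(2) \<phi>' B.A.l_distr\<close>)
    also have "\<dots> = \<psi> x \<oplus>\<^bsub>B\<^esub> \<psi> y"
      unfolding \<psi>_def by (rule B.M.finsum_addf)
        (use C_memD[OF x] C_memD[OF y] s in \<open>auto simp: \<phi>'\<close>)
    finally show "\<psi> (x \<oplus>\<^bsub>C\<^esub> y) = \<psi> x \<oplus>\<^bsub>B\<^esub> \<psi> y" .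
  next
    fix k x assume k: "k \<in> carrier R" and x: "x \<in> carrier C"
    have "\<psi> (k \<odot>\<^bsub>C\<^esub> x) = (\<Oplus>\<^bsub>B\<^esub>r\<in>{..<m}. k \<odot>\<^bsub>B\<^esub> (\<phi> (x r) \<otimes>\<^bsub>B\<^esub> s [^]\<^bsub>B\<^esub> r))"
      unfolding \<psi>_def by (rule B.M.finsum_cong')
        (use C_memD[OF x] s k in \<open>auto simp: C_simps(3) \<phi>' B.smult_mult_left\<close>)
    also have "\<dots> = k \<odot>\<^bsub>B\<^esub> \<psi> x"
      unfolding \<psi>_def by (rule B.finsum_smult_ldistr[symmetric])
        (use C_memD[OF x] s k in \<open>auto simp: \<phi>'\<close>)
    finally show "\<psi> (k \<odot>\<^bsub>C\<^esub> x) = k \<odot>\<^bsub>B\<^esub> \<psi> x" .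
  qed
  have \<phi>0: "\<phi> \<zero>\<^bsub>E\<^esub> = \<zero>\<^bsub>B\<^esub>"
    by (rule lin_map_zero[OF alg_hom_lin_map[OF \<phi>] E.module_axioms B.module_axioms])
  have mono: "\<psi> (monom x r) = \<phi> x \<otimes>\<^bsub>B\<^esub> s [^]\<^bsub>B\<^esub> r" if x: "x \<in> carrier E" and r: "r < m" for x r
  proof -
    have "\<psi> (monom x r) = (\<Oplus>\<^bsub>B\<^esub>t\<in>{..<m}. if t = r then \<phi> x \<otimes>\<^bsub>B\<^esub> s [^]\<^bsub>B\<^esub> t else \<zero>\<^bsub>B\<^esub>)"
      unfolding \<psi>_def
      by (rule B.M.finsum_cong') (use x s in \<open>auto simp: crossed_monom_def \<phi>' \<phi>0\<close>)
    also have "\<dots> = \<phi> x \<otimes>\<^bsub>B\<^esub> s [^]\<^bsub>B\<^esub> r"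
      using B.M.add.finprod_singleton_swap[of r "{..<m}" "\<lambda>t. \<phi> x \<otimes>\<^bsub>B\<^esub> s [^]\<^bsub>B\<^esub> t"] x r s
      by (simp add: Pi_def \<phi>')
    finally show ?thesis .
  qed
  have comm_pow: "s [^]\<^bsub>B\<^esub> r \<otimes>\<^bsub>B\<^esub> \<phi> x = \<phi> ((\<sigma>e ^^ r) x) \<otimes>\<^bsub>B\<^esub> s [^]\<^bsub>B\<^esub> r" if "x \<in> carrier E" for x and r :: nat
    using that
  proof (induction r arbitrary: x)
    case (Suc r)
    have \<sigma>x: "\<sigma>e x \<in> carrier E" using alg_homD(1)[OF \<sigma>e_hom] Suc.prems by simp
    have "s [^]\<^bsub>B\<^esub> Suc r \<otimes>\<^bsub>B\<^esub> \<phi> x = s [^]\<^bsub>B\<^esub> r \<otimes>\<^bsub>B\<^esub> \<phi> (\<sigma>e x) \<otimes>\<^bsub>B\<^esub> s"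
      using Suc.prems s \<sigma>x by (simp add: B.A.m_assoc comm \<phi>')
    also have "\<dots> = \<phi> ((\<sigma>e ^^ r) (\<sigma>e x)) \<otimes>\<^bsub>B\<^esub> s [^]\<^bsub>B\<^esub> Suc r"
      using Suc \<sigma>x s by (simp add: B.A.m_assoc \<phi>')
    finally show ?case by (simp add: funpow_swap1)
  qed (simp add: \<phi>' s)
  have "\<psi> \<in> alg_hom R C B"
  proof (rule alg_homI_span[OF C_algebra B lin monoms_subset C_span])
    fix x y assume "x \<in> monoms" "y \<in> monoms"
    then obtain a r b t where *: "x = monom a r" "y = monom b t"
      "a \<in> carrier E" "b \<in> carrier E" "r < m" "t < m"
      by blast
    have p: "\<phi> (z [^]\<^bsub>E\<^esub> ((r + t) div m)) \<otimes>\<^bsub>B\<^esub> s [^]\<^bsub>B\<^esub> ((r + t) mod m) = s [^]\<^bsub>B\<^esub> (r + t)"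
      using s by (simp add: alg_hom_pow[OF \<phi> E.A.is_monoid B.A.is_monoid] pow[symmetric]
          B.A.nat_pow_pow B.A.nat_pow_mult)
    have "\<psi> (x \<otimes>\<^bsub>C\<^esub> y) = \<phi> a \<otimes>\<^bsub>B\<^esub> \<phi> ((\<sigma>e ^^ r) b) \<otimes>\<^bsub>B\<^esub> (\<phi> (z [^]\<^bsub>E\<^esub> ((r + t) div m)) \<otimes>\<^bsub>B\<^esub> s [^]\<^bsub>B\<^esub> ((r + t) mod m))"
      using * s m_ge_2 by (simp add: monom_mult mono \<phi>' B.A.m_assoc)
    also have "\<dots> = \<phi> a \<otimes>\<^bsub>B\<^esub> ((\<phi> ((\<sigma>e ^^ r) b) \<otimes>\<^bsub>B\<^esub> s [^]\<^bsub>B\<^esub> r) \<otimes>\<^bsub>B\<^esub> s [^]\<^bsub>B\<^esub> t)"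
      using * s unfolding p by (simp add: B.A.nat_pow_mult[symmetric] \<phi>' B.A.m_assoc)
    also have "\<dots> = \<psi> x \<otimes>\<^bsub>B\<^esub> \<psi> y"
      using * s by (simp add: comm_pow[symmetric] mono \<phi>' B.A.m_assoc)
    finally show "\<psi> (x \<otimes>\<^bsub>C\<^esub> y) = \<psi> x \<otimes>\<^bsub>B\<^esub> \<psi> y" .
  next
    show "\<psi> \<one>\<^bsub>C\<^esub> = \<one>\<^bsub>B\<^esub>"
      using m_ge_2 by (simp add: C_simps(5) mono \<phi>')
  qed
  then show ?thesis using mono by blast
qed

end

section \<open>Twisted products\<close>

lemma twisted_prod_Nil [simp]: "twisted_prod A \<sigma> j [] = \<one>\<^bsub>A\<^esub>"
  by (simp add: twisted_prod_def)

lemma twisted_prod_Cons: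
  "twisted_prod A \<sigma> j (a # as) = (\<sigma> ^^ j) a \<otimes>\<^bsub>A\<^esub> twisted_prod A \<sigma> (Suc j) as"
  by (simp add: twisted_prod_def map_upt_Suc del: upt_Suc)

context cyclic_datum
begin

lemma A_zero_closed: "\<zero>\<^bsub>A\<^esub> \<in> carrier A"
  by (rule ring.ring_simprules(2)[OF A.ring_axioms])

abbreviation tp where "tp \<equiv> twisted_prod A \<sigma>"
abbreviation \<mu> where "\<mu> \<equiv> nary_mult A \<sigma> c"

lemma tp_closed [simp]: "set as \<subseteq> carrier A \<Longrightarrow> tp j as \<in> carrier A"
  by (induction as arbitrary: j) (auto simp: twisted_prod_Cons)

lemma tp_append:
  "\<lbrakk>set as \<subseteq> carrier A; set bs \<subseteq> carrier A\<rbrakk> \<Longrightarrow> tp j (as @ bs) = tp j as \<otimes>\<^bsub>A\<^esub> tp (j + length as) bs"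
  by (induction as arbitrary: j) (auto simp: twisted_prod_Cons A.m_assoc)

lemma \<sigma>_pow_tp: "set as \<subseteq> carrier A \<Longrightarrow> (\<sigma> ^^ k) (tp j as) = tp (j + k) as"
  by (induction as arbitrary: j) (auto simp: twisted_prod_Cons \<sigma>_pow funpow_funpow add.commute)

lemma tp_ones [simp]: "tp j (replicate k \<one>\<^bsub>A\<^esub>) = \<one>\<^bsub>A\<^esub>"
  by (induction k arbitrary: j) (auto simp: twisted_prod_Cons)

lemma c_tp: "set as \<subseteq> carrier A \<Longrightarrow> c \<otimes>\<^bsub>A\<^esub> tp j as = tp (j + m) as \<otimes>\<^bsub>A\<^esub> c"
  by (simp add: c_commute \<sigma>_pow_tp)

lemma c_inv_pow: "c' [^]\<^bsub>A\<^esub> (k::nat) \<otimes>\<^bsub>A\<^esub> c [^]\<^bsub>A\<^esub> k = \<one>\<^bsub>A\<^esub>"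
proof (induction k)
  case (Suc k)
  have "c' [^]\<^bsub>A\<^esub> Suc k \<otimes>\<^bsub>A\<^esub> c [^]\<^bsub>A\<^esub> Suc k = c' [^]\<^bsub>A\<^esub> k \<otimes>\<^bsub>A\<^esub> c' \<otimes>\<^bsub>A\<^esub> (c \<otimes>\<^bsub>A\<^esub> c [^]\<^bsub>A\<^esub> k)"
    unfolding A.nat_pow_Suc2[OF c_closed(1)] by simp
  then show ?case using Suc by (simp add: A.m_assoc)
qed simp

lemma c_pow_tp:
  "set as \<subseteq> carrier A \<Longrightarrow> c [^]\<^bsub>A\<^esub> (k::nat) \<otimes>\<^bsub>A\<^esub> tp j as = tp (j + m * k) as \<otimes>\<^bsub>A\<^esub> c [^]\<^bsub>A\<^esub> k"
proof (induction k arbitrary: j)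
  case (Suc k)
  have "c [^]\<^bsub>A\<^esub> Suc k \<otimes>\<^bsub>A\<^esub> tp j as = c [^]\<^bsub>A\<^esub> k \<otimes>\<^bsub>A\<^esub> tp (j + m) as \<otimes>\<^bsub>A\<^esub> c"
    using Suc.prems by (simp add: A.m_assoc c_tp)
  also have "\<dots> = tp (j + m + m * k) as \<otimes>\<^bsub>A\<^esub> c [^]\<^bsub>A\<^esub> Suc k"
    unfolding Suc.IH[OF Suc.prems] using Suc.prems by (simp add: A.m_assoc)
  finally show ?case by (simp add: add.assoc)
qed simp

text \<open>Moving \<open>c\<close> to the end past the last factor twists that factor by \<open>\<sigma>\<^sup>m\<close>, so all factors of the
  \<open>n\<close>-ary product follow one rule. This is why iterated products are again twisted products.\<close>

lemma nary_mult_eq: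
  assumes "set as \<subseteq> carrier A" "length as = Suc m"
  shows "\<mu> as = tp 0 as \<otimes>\<^bsub>A\<^esub> c"
proof -
  obtain bs b where as: "as = bs @ [b]"
    using assms(2) by (metis append_butlast_last_id length_0_conv nat.distinct(1))
  then show ?thesis
    using assms by (simp add: nary_mult_def tp_append twisted_prod_Cons c_commute A.m_assoc)
qed

lemma nary_mult_closed: "\<lbrakk>set as \<subseteq> carrier A; length as = Suc m\<rbrakk> \<Longrightarrow> \<mu> as \<in> carrier A"
  by (simp add: nary_mult_eq)

lemma tp_linear:
  assumes "set as \<subseteq> carrier A" "set bs \<subseteq> carrier A"
  shows "(\<lambda>a. tp j (as @ a # bs)) \<in> lin_map R A A"
  by (rule lin_mapI) (use assms in \<open>auto simp: tp_append twisted_prod_Cons \<sigma>_pow A.l_distr A.r_distr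
      smult_mult_left smult_mult_right\<close>)

lemma nary_mult_linear:
  assumes "set as \<subseteq> carrier A" "set bs \<subseteq> carrier A" "length as + length bs = m"
  shows "(\<lambda>a. \<mu> (as @ a # bs)) \<in> lin_map R A A"
proof -
  note l = lin_map_comp[OF tp_linear[OF assms(1,2), of 0] mult_right_linear[OF c_closed(1)]]
  show ?thesis
    by (rule lin_mapI) (use assms lin_mapD[OF l] in \<open>auto simp: nary_mult_eq\<close>)
qed

end

section \<open>Ordinary trees and contexts\<close>

definition trees :: "('a, 'x) partial_object_scheme \<Rightarrow> nat \<Rightarrow> 'a ctx set" where
  "trees A n = {t. full n t \<and> holes t = 0 \<and> set_ctx t \<subseteq> carrier A}"

fun tree_value :: "('a list \<Rightarrow> 'a) \<Rightarrow> 'a ctx \<Rightarrow> 'a" where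
  "tree_value \<mu> Hole = undefined"
| "tree_value \<mu> (Leaf a) = a"
| "tree_value \<mu> (Node ts) = \<mu> (map (tree_value \<mu>) ts)"

lemma split_at_hole:
  "sum_list (map holes ts) = 1 \<Longrightarrow> \<exists>us t ws. ts = us @ t # ws \<and> holes t = 1 \<and> (\<forall>s\<in>set us \<union> set ws. holes s = 0)"
proof (induction ts)
  case (Cons t ts)
  show ?case
  proof (cases "holes t = 0")
    case True
    then obtain us s ws where "ts = us @ s # ws" "holes s = 1" "\<forall>s\<in>set us \<union> set ws. holes s = 0"
      using Cons by auto
    then show ?thesis using True by (intro exI[of _ "t # us"]) auto
  next
    case False
    moreover have "holes t + sum_list (map holes ts) = 1" using Cons.prems by simp
    ultimately have "holes t = 1" "sum_list (map holes ts) = 0" by linarith+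
    then have "holes t = 1" "\<forall>s\<in>set ts. holes s = 0" by (simp_all add: sum_list_eq_0_iff)
    then show ?thesis by (intro exI[of _ "[]"]) auto
  qed
qed simp

text \<open>In a context the path to the hole passes through exactly one child of each vertex on it; the
  other children are ordinary trees. Contexts are analysed along this path.\<close>

lemma Node_in_contexts:
  assumes "\<forall>s\<in>set us \<union> set ws. holes s = 0"
  shows "Node (us @ t # ws) \<in> contexts A n \<longleftrightarrow>
    set us \<subseteq> trees A n \<and> set ws \<subseteq> trees A n \<and> t \<in> contexts A n \<and> Suc (length us + length ws) = n"
  using assms by (auto simp: contexts_def trees_def sum_list_eq_0_iff[THEN iffD2] subset_iff)

lemma Node_in_trees:
  "Node ts \<in> trees A n \<longleftrightarrow> set ts \<subseteq> trees A n \<and> length ts = n"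
  by (auto simp: trees_def sum_list_eq_0_iff subset_iff)

lemma Leaf_in_trees [simp]: "Leaf a \<in> trees A n \<longleftrightarrow> a \<in> carrier A"
  by (auto simp: trees_def)

lemma Leafs_in_trees [simp]: "Leaf ` X \<subseteq> trees A n \<longleftrightarrow> X \<subseteq> carrier A"
  by auto

lemma Hole_in_contexts [simp]: "Hole \<in> contexts A n"
  by (simp add: contexts_def)

lemma Leaf_notin_contexts [simp]: "Leaf a \<notin> contexts A n"
  by (simp add: contexts_def)

lemma contexts_induct [consumes 1, case_names Hole Node]:
  assumes "t \<in> contexts A n" and "P Hole"
    and "\<And>us t ws. \<lbrakk>set us \<subseteq> trees A n; set ws \<subseteq> trees A n; t \<in> contexts A n;
      Suc (length us + length ws) = n; P t\<rbrakk> \<Longrightarrow> P (Node (us @ t # ws))"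
  shows "P t"
  using assms(1)
proof (induction t)
  case (Node ts)
  then have "sum_list (map holes ts) = 1" by (simp add: contexts_def)
  then obtain us s ws where ts: "ts = us @ s # ws" "\<forall>s\<in>set us \<union> set ws. holes s = 0"
    using split_at_hole by blast
  then show ?case
    using Node assms(3)[of us ws s] Node_in_contexts[OF ts(2), of s A n] by auto
qed (use assms(2) in auto)

lemma eval_vertex_tree:
  "eval_vertex \<mu> lam (map Inl as) = Inl (\<mu> as)"
  by (simp add: eval_vertex_def list_all_iff comp_def)

lemma eval_vertex_slot:
  "eval_vertex \<mu> lam (map Inl as @ Inr y # map Inl bs) = Inr (lam as y bs)"
proof -
  have "takeWhile isl (map Inl as @ Inr y # zs) = map Inl as"
    "dropWhile isl (map Inl as @ Inr y # zs) = Inr y # zs" for zs :: "('a + 'b) list"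
    by (induction as) auto
  then show ?thesis by (simp add: eval_vertex_def comp_def)
qed

lemma eval_ctx_tree: "holes t = 0 \<Longrightarrow> eval_ctx \<mu> lam x t = Inl (tree_value \<mu> t)"
proof (induction t)
  case (Node ts)
  then have "map (eval_ctx \<mu> lam x) ts = map Inl (map (tree_value \<mu>) ts)"
    by (simp add: sum_list_eq_0_iff)
  then show ?case by (simp only: eval_ctx.simps eval_vertex_tree tree_value.simps)
qed auto

lemma eval_ctx_trees:
  "\<forall>s\<in>set us. holes s = 0 \<Longrightarrow> map (eval_ctx \<mu> lam x) us = map Inl (map (tree_value \<mu>) us)"
  by (simp add: eval_ctx_tree)

lemma eval_ctx_slot:
  assumes "\<forall>s\<in>set us \<union> set ws. holes s = 0" "eval_ctx \<mu> lam x t = Inr y"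
  shows "eval_ctx \<mu> lam x (Node (us @ t # ws))
    = Inr (lam (map (tree_value \<mu>) us) y (map (tree_value \<mu>) ws))"
  using eval_ctx_trees[of us \<mu> lam x] eval_ctx_trees[of ws \<mu> lam x] assms
  by (simp add: eval_vertex_slot[unfolded map_map] del: map_map)

lemma eval_ctx_graft:
  assumes "eval_ctx \<mu> lam x D = Inr y"
  shows "eval_ctx \<mu> lam x (graft C D) = eval_ctx \<mu> lam y C"
proof (induction C)
  case (Node ts)
  then have "map (eval_ctx \<mu> lam x) (map (\<lambda>t. graft t D) ts) = map (eval_ctx \<mu> lam y) ts"
    by simp
  then show ?case by (simp only: graft.simps eval_ctx.simps)
qed (use assms in auto)

lemma trees_holes: "set us \<subseteq> trees A n \<Longrightarrow> \<forall>s\<in>set us. holes s = 0"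
  by (auto simp: trees_def)

text \<open>Evaluations will turn out to depend only on the following two invariants of rebracketing, the
  word of a tree, in which \<^const>\<open>None\<close> marks the hole, and the number of its vertices.\<close>

fun frontier :: "'a ctx \<Rightarrow> 'a option list" where
  "frontier Hole = [None]"
| "frontier (Leaf a) = [Some a]"
| "frontier (Node ts) = concat (map frontier ts)"

fun nodes :: "'a ctx \<Rightarrow> nat" where
  "nodes (Node ts) = Suc (sum_list (map nodes ts))"
| "nodes _ = 0"

lemma rebracket_frontier: "rebracket t t' \<Longrightarrow> frontier t = frontier t' \<and> nodes t = nodes t'"
proof (induction rule: rebracket.induct)
  case (move us vs ws us' vs' ws')
  have 1: "frontier (Node (us @ Node vs # ws)) = concat (map frontier (us @ vs @ ws))"
    "nodes (Node (us @ Node vs # ws)) = Suc (Suc (sum_list (map nodes (us @ vs @ ws))))" for us vs ws :: "'a ctx list"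
    by simp_all
  show ?case unfolding 1 by (simp only: move)
qed simp_all

lemma map_Some_None_eqD:
  "map Some L @ None # map Some K = map Some L' @ None # map Some K' \<Longrightarrow> L = L' \<and> K = K'"
proof (induction L arbitrary: L')
  case Nil
  then show ?case by (cases L') (auto simp: inj_map_eq_map)
next
  case (Cons a L)
  then show ?case by (cases L') auto
qed

text \<open>Meaningful for trees without a hole.\<close>

abbreviation labels :: "'a ctx \<Rightarrow> 'a list" where
  "labels t \<equiv> map the (frontier t)"

context cyclic_datum
begin

abbreviation val where "val \<equiv> tree_value \<mu>"

lemma val_closed: "t \<in> trees A (Suc m) \<Longrightarrow> val t \<in> carrier A"
proof (induction t)
  case (Node ts)
  then have "set (map val ts) \<subseteq> carrier A" "length (map val ts) = Suc m"
    by (auto simp: Node_in_trees)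
  then show ?case unfolding tree_value.simps by (rule nary_mult_closed)
qed (auto simp: trees_def)

lemma vals_closed: "set ts \<subseteq> trees A (Suc m) \<Longrightarrow> set (map val ts) \<subseteq> carrier A"
  using val_closed by auto

text \<open>A subtree with \<open>k\<close> vertices has \<open>1 + m k\<close> labels and its value ends in \<open>c\<^sup>k\<close>. Passing this power to the
  right shifts the twist of all later labels by \<open>m k\<close>, which is exactly the shift caused by
  replacing one input by \<open>1 + m k\<close> labels. So the nested product is the twisted product of the
  concatenated labels.\<close>

lemma tp_vals:
  assumes "\<And>t. t \<in> set ts \<Longrightarrow> set (labels t) \<subseteq> carrier A \<and> length (labels t) = Suc (m * nodes t)
      \<and> val t = tp 0 (labels t) \<otimes>\<^bsub>A\<^esub> c [^]\<^bsub>A\<^esub> nodes t"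
  shows "set (concat (map labels ts)) \<subseteq> carrier A
    \<and> length (concat (map labels ts)) = length ts + m * sum_list (map nodes ts)
    \<and> tp j (map val ts) = tp j (concat (map labels ts)) \<otimes>\<^bsub>A\<^esub> c [^]\<^bsub>A\<^esub> sum_list (map nodes ts)"
  using assms
proof (induction ts arbitrary: j)
  case (Cons t ts)
  let ?L = "concat (map labels ts)" and ?k = "nodes t" and ?K = "sum_list (map nodes ts)"
  have t: "set (labels t) \<subseteq> carrier A" "length (labels t) = Suc (m * ?k)"
    "val t = tp 0 (labels t) \<otimes>\<^bsub>A\<^esub> c [^]\<^bsub>A\<^esub> ?k"
    using Cons.prems[of t] by auto
  have IH: "set ?L \<subseteq> carrier A" "length ?L = length ts + m * ?K"
     "tp (Suc j) (map val ts) = tp (Suc j) ?L \<otimes>\<^bsub>A\<^esub> c [^]\<^bsub>A\<^esub> ?K"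
    using Cons.IH[of "Suc j"] Cons.prems by auto
  have "tp j (map val (t # ts)) = tp j (labels t) \<otimes>\<^bsub>A\<^esub> (c [^]\<^bsub>A\<^esub> ?k \<otimes>\<^bsub>A\<^esub> tp (Suc j) ?L) \<otimes>\<^bsub>A\<^esub> c [^]\<^bsub>A\<^esub> ?K"
    using t(1) IH(1) alg_hom_pow[OF \<sigma>_pow_hom A.is_monoid A.is_monoid c_closed(1)]
    by (simp add: twisted_prod_Cons t(3) IH(3) \<sigma>_pow \<sigma>_pow_tp A.m_assoc)
  also have "\<dots> = tp j (labels t) \<otimes>\<^bsub>A\<^esub> tp (j + length (labels t)) ?L \<otimes>\<^bsub>A\<^esub> c [^]\<^bsub>A\<^esub> (?k + ?K)"
    unfolding t(2) using t(1) IH(1) by (simp add: c_pow_tp A.m_assoc A.nat_pow_mult)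
  also have "\<dots> = tp j (labels t @ ?L) \<otimes>\<^bsub>A\<^esub> c [^]\<^bsub>A\<^esub> (?k + ?K)"
    using t(1) IH(1) by (simp only: tp_append)
  finally show ?case
    using t IH by (auto simp: algebra_simps)
qed simp

lemma val_eq:
  assumes "t \<in> trees A (Suc m)"
  shows "set (labels t) \<subseteq> carrier A \<and> length (labels t) = Suc (m * nodes t)
      \<and> val t = tp 0 (labels t) \<otimes>\<^bsub>A\<^esub> c [^]\<^bsub>A\<^esub> nodes t"
  using assms
proof (induction t)
  case (Node ts)
  then have ts: "set ts \<subseteq> trees A (Suc m)" "length ts = Suc m"
    by (auto simp: Node_in_trees)
  have lab: "labels (Node ts) = concat (map labels ts)"
    by (simp add: map_concat comp_def)
  have *: "set (concat (map labels ts)) \<subseteq> carrier A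
    \<and> length (concat (map labels ts)) = length ts + m * sum_list (map nodes ts)
    \<and> tp 0 (map val ts) = tp 0 (concat (map labels ts)) \<otimes>\<^bsub>A\<^esub> c [^]\<^bsub>A\<^esub> sum_list (map nodes ts)"
    by (rule tp_vals) (use Node ts in blast)
  have "val (Node ts) = tp 0 (map val ts) \<otimes>\<^bsub>A\<^esub> c"
    using nary_mult_eq[OF vals_closed[OF ts(1)]] ts(2) by simp
  then show ?case
    unfolding lab using * ts(2) by (auto simp: A.m_assoc)
qed (auto simp: trees_def twisted_prod_Cons)

lemma tree_frontier: "t \<in> trees A n \<Longrightarrow> frontier t = map Some (labels t)"
proof (induction t)
  case (Node ts)
  then have "map frontier ts = map (\<lambda>t. map Some (labels t)) ts"
    by (auto simp: Node_in_trees)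
  then have "frontier (Node ts) = concat (map (\<lambda>t. map Some (labels t)) ts)"
    by (simp only: frontier.simps)
  then show ?case by (simp add: map_concat comp_def)
qed (auto simp: trees_def)

lemma trees_frontier:
  "set ts \<subseteq> trees A n \<Longrightarrow> concat (map frontier ts) = map Some (concat (map labels ts))"
proof (induction ts)
  case (Cons t ts)
  then have "t \<in> trees A n" "concat (map frontier ts) = map Some (concat (map labels ts))" by auto
  then show ?case by (simp only: concat.simps list.map map_append tree_frontier[symmetric])
qed simp

end

section \<open>Twisted bimodules are slot modules\<close>

context twisted_bimodule
begin

abbreviation lam where "lam \<equiv> slot_action R A \<sigma> c act S"

lemma act_linear: "e \<in> carrier E \<Longrightarrow> act e \<in> lin_map R M M"
proof (rule lin_mapI)
  fix r x assume e: "e \<in> carrier E" and r: "r \<in> carrier R" and x: "x \<in> carrier M"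
  have "act e (r \<odot>\<^bsub>M\<^esub> x) = act e (act (r \<odot>\<^bsub>E\<^esub> \<one>\<^bsub>E\<^esub>) x)"
    using r x by (simp add: E.smult_act E.one_act)
  also have "\<dots> = act (r \<odot>\<^bsub>E\<^esub> e) x"
    using e r x by (simp add: E.mult_act[symmetric] E.smult_mult_right)
  finally show "act e (r \<odot>\<^bsub>M\<^esub> x) = r \<odot>\<^bsub>M\<^esub> act e x"
    using e r x by (simp add: E.smult_act)
qed (auto simp: E.act_closed E.act_add)

lemma act_linear_left: "x \<in> carrier M \<Longrightarrow> (\<lambda>e. act e x) \<in> lin_map R E M"
  by (rule lin_mapI) (auto simp: E.act_closed E.add_act E.smult_act)

lemma S_pow_linear: "S ^^ k \<in> lin_map R M M"
proof (induction k)
  case 0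
  show ?case by (rule lin_mapI) auto
next
  case (Suc k)
  then show ?case using lin_map_comp[OF Suc S_linear] by (simp add: comp_def)
qed

lemma S_pow_closed [simp]: "x \<in> carrier M \<Longrightarrow> (S ^^ k) x \<in> carrier M"
  using lin_mapD(1)[OF S_pow_linear] .

lemma S_pow_act:
  "\<lbrakk>a \<in> carrier A; b \<in> carrier A; x \<in> carrier M\<rbrakk>
    \<Longrightarrow> (S ^^ k) (act (tens a b) x) = act (tens ((\<sigma> ^^ k) a) ((\<sigma> ^^ k) b)) ((S ^^ k) x)"
  by (induction k) (simp_all add: S_semilinear)

lemma z_pow: "z [^]\<^bsub>E\<^esub> (k::nat) = tens (c [^]\<^bsub>A\<^esub> k) (c' [^]\<^bsub>A\<^esub> k)"
  by (induction k) (simp_all add: tens_one tens_mult A.nat_pow_Suc2[symmetric])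

lemma S_pow_mult: "x \<in> carrier M \<Longrightarrow> (S ^^ (m * k)) x = act (tens (c [^]\<^bsub>A\<^esub> k) (c' [^]\<^bsub>A\<^esub> k)) x"
proof (induction k)
  case (Suc k)
  have "(S ^^ (m * Suc k)) x = act z (act (z [^]\<^bsub>E\<^esub> k) x)"
    using Suc by (simp add: funpow_add S_pow_m z_pow E.act_closed)
  also have "\<dots> = act (z [^]\<^bsub>E\<^esub> Suc k) x"
    unfolding E.A.nat_pow_Suc2[OF tens_closed[OF c_closed]]
    using Suc.prems by (simp add: E.mult_act)
  finally show ?case by (simp only: z_pow)
qed (simp add: tens_one[symmetric] E.one_act)

lemma lam_eq:
  "lam as x bs = act (tens (tp 0 as) (tp (Suc (length as)) bs \<otimes>\<^bsub>A\<^esub> c)) ((S ^^ length as) x)"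
  by (simp add: slot_action_def slot_tensor_def)

text \<open>The value of a word is \<open>p S\<^sup>l(x) q\<close>, where \<open>p\<close> and \<open>q\<close> are the twisted products of the
  labels on either side of the hole, \<open>l\<close> is the position of the hole, and \<open>q\<close> carries one factor
  \<open>c\<close> for each internal vertex. Nothing here refers to the shape of the tree; this is total
  associativity. In the inductive step a factor \<open>c\<^sup>K\<close> coming from the subtrees left of the hole is
  moved across \<open>S\<^sup>l(x)\<close>, which produces the missing power \<open>S\<^sup>m\<^sup>K\<close>.\<close>

lemma eval_ctx_eq:
  assumes "t \<in> contexts A (Suc m)" and x: "x \<in> carrier M"
  shows "\<exists>L K. frontier t = map Some L @ None # map Some K
    \<and> set L \<subseteq> carrier A \<and> set K \<subseteq> carrier A \<and> length L + length K = m * nodes t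
    \<and> eval_ctx \<mu> lam x t
      = Inr (act (tens (tp 0 L) (tp (Suc (length L)) K \<otimes>\<^bsub>A\<^esub> c [^]\<^bsub>A\<^esub> nodes t)) ((S ^^ length L) x))"
  using assms(1)
proof (induction rule: contexts_induct)
  case Hole
  show ?case
    by (rule exI[of _ "[]"], rule exI[of _ "[]"]) (use x in \<open>simp add: tens_one[symmetric] E.one_act\<close>)
next
  case (Node us t ws)
  then obtain L K where LK: "frontier t = map Some L @ None # map Some K"
    "set L \<subseteq> carrier A" "set K \<subseteq> carrier A" "length L + length K = m * nodes t"
    "eval_ctx \<mu> lam x t
      = Inr (act (tens (tp 0 L) (tp (Suc (length L)) K \<otimes>\<^bsub>A\<^esub> c [^]\<^bsub>A\<^esub> nodes t)) ((S ^^ length L) x))"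
    by blast
  define Lu where "Lu = concat (map labels us)"
  define Kw where "Kw = concat (map labels ws)"
  define i j k l where ijkl: "i = sum_list (map nodes us)" "j = sum_list (map nodes ws)"
    "k = nodes t" "l = length L"
  define h where "h = length us"
  have u: "set Lu \<subseteq> carrier A" "length Lu = h + m * i"
    "tp 0 (map val us) = tp 0 Lu \<otimes>\<^bsub>A\<^esub> c [^]\<^bsub>A\<^esub> i"
    using tp_vals[of us 0] val_eq Node(1) unfolding Lu_def ijkl h_def by blast+
  have w: "set Kw \<subseteq> carrier A" "length Kw = length ws + m * j"
    "tp (Suc h) (map val ws) = tp (Suc h) Kw \<otimes>\<^bsub>A\<^esub> c [^]\<^bsub>A\<^esub> j"
    using tp_vals[of ws "Suc h"] val_eq Node(2) unfolding Kw_def ijkl by blast+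
  note LK' = LK(2-4)[folded ijkl]
  let ?y = "(S ^^ (h + l)) x"
  let ?Q = "tp (Suc l + h) K \<otimes>\<^bsub>A\<^esub> c [^]\<^bsub>A\<^esub> k \<otimes>\<^bsub>A\<^esub> (tp (Suc h) Kw \<otimes>\<^bsub>A\<^esub> c [^]\<^bsub>A\<^esub> j \<otimes>\<^bsub>A\<^esub> c)"
  let ?QR = "tp (Suc (length (Lu @ L))) (K @ Kw) \<otimes>\<^bsub>A\<^esub> c [^]\<^bsub>A\<^esub> Suc (i + k + j)"
  have cpow: "(\<sigma> ^^ h) (c [^]\<^bsub>A\<^esub> k) = c [^]\<^bsub>A\<^esub> k"
    using alg_hom_pow[OF \<sigma>_pow_hom A.is_monoid A.is_monoid c_closed(1)] by simp
  have P: "tp 0 Lu \<otimes>\<^bsub>A\<^esub> c [^]\<^bsub>A\<^esub> i \<otimes>\<^bsub>A\<^esub> tp h L = tp 0 (Lu @ L) \<otimes>\<^bsub>A\<^esub> c [^]\<^bsub>A\<^esub> i"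
    using u LK' by (simp add: tp_append A.m_assoc c_pow_tp)
  have "c [^]\<^bsub>A\<^esub> i \<otimes>\<^bsub>A\<^esub> ?Q
      = tp (Suc l + h + m * i) K \<otimes>\<^bsub>A\<^esub> (c [^]\<^bsub>A\<^esub> (i + k) \<otimes>\<^bsub>A\<^esub> tp (Suc h) Kw) \<otimes>\<^bsub>A\<^esub> c [^]\<^bsub>A\<^esub> Suc j"
  proof -
    have "c [^]\<^bsub>A\<^esub> i \<otimes>\<^bsub>A\<^esub> ?Q = (c [^]\<^bsub>A\<^esub> i \<otimes>\<^bsub>A\<^esub> tp (Suc l + h) K) \<otimes>\<^bsub>A\<^esub> (c [^]\<^bsub>A\<^esub> k \<otimes>\<^bsub>A\<^esub> (tp (Suc h) Kw \<otimes>\<^bsub>A\<^esub> c [^]\<^bsub>A\<^esub> Suc j))"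
      using LK' w by (simp add: A.m_assoc)
    also have "c [^]\<^bsub>A\<^esub> i \<otimes>\<^bsub>A\<^esub> tp (Suc l + h) K = tp (Suc l + h + m * i) K \<otimes>\<^bsub>A\<^esub> c [^]\<^bsub>A\<^esub> i"
      using LK' by (simp only: c_pow_tp)
    finally show ?thesis
      using LK' w by (simp add: A.m_assoc A.nat_pow_mult[symmetric])
  qed
  also have "\<dots> = tp (Suc l + h + m * i) K \<otimes>\<^bsub>A\<^esub> tp (Suc h + m * (i + k)) Kw \<otimes>\<^bsub>A\<^esub> c [^]\<^bsub>A\<^esub> Suc (i + k + j)"
  proof -
    have "c [^]\<^bsub>A\<^esub> (i + k) \<otimes>\<^bsub>A\<^esub> c [^]\<^bsub>A\<^esub> Suc j = c [^]\<^bsub>A\<^esub> Suc (i + k + j)"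
      by (simp add: A.m_assoc[symmetric] A.nat_pow_mult)
    then show ?thesis
      using LK' w by (simp add: A.m_assoc c_pow_tp del: A.nat_pow_Suc)
  qed
  \<comment> \<open>The twist of the labels right of the hole agrees with their position in the whole word.\<close>
  also have "Suc h + m * (i + k) = Suc (length (Lu @ L)) + length K"
    using LK' u by (simp add: ijkl algebra_simps)
  also have "Suc l + h + m * i = Suc (length (Lu @ L))"
    using u by (simp add: ijkl)
  finally have "c [^]\<^bsub>A\<^esub> i \<otimes>\<^bsub>A\<^esub> ?Q = ?QR"
    using LK' w by (simp only: tp_append)
  moreover have "c' [^]\<^bsub>A\<^esub> i \<otimes>\<^bsub>A\<^esub> (c [^]\<^bsub>A\<^esub> i \<otimes>\<^bsub>A\<^esub> ?Q) = ?Q"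
    using LK' w by (simp add: A.m_assoc[symmetric] c_inv_pow)
  ultimately have Q: "?Q = c' [^]\<^bsub>A\<^esub> i \<otimes>\<^bsub>A\<^esub> ?QR" by simp
  have carr: "tp 0 (Lu @ L) \<in> carrier A" "?Q \<in> carrier A" "?QR \<in> carrier A"
    using LK' u w by auto
  have "eval_ctx \<mu> lam x (Node (us @ t # ws))
      = Inr (lam (map val us) (act (tens (tp 0 L) (tp (Suc l) K \<otimes>\<^bsub>A\<^esub> c [^]\<^bsub>A\<^esub> k)) ((S ^^ l) x)) (map val ws))"
    using LK(5) trees_holes[OF Node(1)] trees_holes[OF Node(2)] unfolding ijkl
    by (intro eval_ctx_slot) auto
  also have "\<dots> = Inr (act (tens (tp 0 Lu \<otimes>\<^bsub>A\<^esub> c [^]\<^bsub>A\<^esub> i \<otimes>\<^bsub>A\<^esub> tp h L) ?Q) ?y)"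
    using LK' u w x
    by (simp add: lam_eq h_def[symmetric] S_pow_act \<sigma>_pow \<sigma>_pow_tp cpow funpow_funpow
        E.mult_act[symmetric] tens_mult)
  also have "\<dots> = Inr (act (tens (tp 0 (Lu @ L) \<otimes>\<^bsub>A\<^esub> c [^]\<^bsub>A\<^esub> i) (c' [^]\<^bsub>A\<^esub> i \<otimes>\<^bsub>A\<^esub> ?QR)) ?y)"
    by (simp only: P Q)
  also have "\<dots> = Inr (act (tens (tp 0 (Lu @ L)) ?QR) (act (tens (c [^]\<^bsub>A\<^esub> i) (c' [^]\<^bsub>A\<^esub> i)) ?y))"
    using carr x by (simp only: E.mult_act[symmetric] tens_mult tens_closed A.nat_pow_closed c_closed S_pow_closed)
  also have "act (tens (c [^]\<^bsub>A\<^esub> i) (c' [^]\<^bsub>A\<^esub> i)) ?y = (S ^^ length (Lu @ L)) x"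
    using u x by (simp add: S_pow_mult[symmetric] funpow_funpow ijkl ac_simps)
  finally have "eval_ctx \<mu> lam x (Node (us @ t # ws)) = Inr (act (tens (tp 0 (Lu @ L)) ?QR) ((S ^^ length (Lu @ L)) x))" .
  moreover have "frontier (Node (us @ t # ws)) = map Some (Lu @ L) @ None # map Some (K @ Kw)"
    using trees_frontier[OF Node(1)] trees_frontier[OF Node(2)] LK(1) by (simp add: Lu_def Kw_def)
  moreover have "nodes (Node (us @ t # ws)) = Suc (i + k + j)"
    by (simp add: ijkl)
  moreover have "length (Lu @ L) + length (K @ Kw) = m * Suc (i + k + j)"
  proof -
    have "length (Lu @ L) + length (K @ Kw) = (h + length ws) + m * i + (length L + length K) + m * j"
      using u w by simp
    also have "h + length ws = m" using Node(4) by (simp add: h_def)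
    also have "length L + length K = m * k" using LK(4) by (simp only: ijkl)
    finally show ?thesis by (simp add: algebra_simps)
  qed
  ultimately show ?case
    using u(1) w(1) LK' by (intro exI[of _ "Lu @ L"] exI[of _ "K @ Kw"]) (auto simp del: A.nat_pow_Suc)
qed

lemma lam_linear_mid:
  "slot_args A m as bs \<Longrightarrow> (\<lambda>x. lam as x bs) \<in> lin_map R M M"
  unfolding lam_eq
  by (rule lin_map_comp[OF S_pow_linear act_linear]) (simp add: slot_args_def)

lemma lam_linear_left:
  assumes "set as \<subseteq> carrier A" "set as' \<subseteq> carrier A" "set bs \<subseteq> carrier A" "x \<in> carrier M"
  shows "(\<lambda>a. lam (as @ a # as') x bs) \<in> lin_map R A M"
proof -
  have "(\<lambda>a. act (tens (tp 0 (as @ a # as')) b) y) \<in> lin_map R A M" if "b \<in> carrier A" "y \<in> carrier M" for b y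
    by (rule lin_map_comp[OF lin_map_comp[OF tp_linear tens_linear(1)] act_linear_left])
      (use assms that in auto)
  from this[of "tp (Suc (length as + Suc (length as'))) bs \<otimes>\<^bsub>A\<^esub> c" "(S ^^ (length as + Suc (length as'))) x"]
  show ?thesis using assms lin_mapD(1)[OF S_linear] by (simp add: lam_eq)
qed

lemma lam_linear_right:
  assumes "set as \<subseteq> carrier A" "set bs \<subseteq> carrier A" "set bs' \<subseteq> carrier A" "x \<in> carrier M"
  shows "(\<lambda>a. lam as x (bs @ a # bs')) \<in> lin_map R A M"
  unfolding lam_eq
  by (rule lin_map_comp[OF lin_map_comp[OF lin_map_comp[OF tp_linear mult_right_linear] tens_linear(2)] act_linear_left])
    (use assms in auto)

text \<open>Rebracketing preserves the word and the number of vertices, hence the value. The anchoring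
  conditions hold because \<open>q\<^sub>0 = \<sigma>\<^sup>m(c\<inverse>) c = 1\<close> and \<open>c\<inverse> S\<^sup>m(x) c = x\<close>.\<close>

lemma anchored: "anchored_slot_module R m A \<sigma> c M lam"
proof (intro anchored_slot_module.intro slot_module.intro slot_module_axioms.intro
    anchored_slot_module_axioms.intro)
  show "cyclic_datum R m A \<sigma> c" ..
  show "module R M" ..
next
  fix t t' x assume t: "t \<in> contexts A (Suc m)" "t' \<in> contexts A (Suc m)" "rebracket t t'"
    and x: "x \<in> carrier M"
  show "eval_ctx \<mu> lam x t = eval_ctx \<mu> lam x t'"
    using eval_ctx_eq[OF t(1) x] eval_ctx_eq[OF t(2) x] rebracket_frontier[OF t(3)]
    by (metis map_Some_None_eqD)
next
  fix x assume x: "x \<in> carrier M"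
  have m: "Suc (m - Suc 0) = m" using m_ge_2 by simp
  have "tp (Suc 0) (replicate (m - 1) \<one>\<^bsub>A\<^esub> @ [c']) = c'"
    by (simp add: tp_append twisted_prod_Cons set_replicate_conv_if \<sigma>_c_inv)
  then show "lam [] x (replicate (m - 1) \<one>\<^bsub>A\<^esub> @ [c']) = x"
    using x by (simp add: lam_eq tens_one[symmetric] E.one_act)
  have "tp 0 (c' # replicate (m - 1) \<one>\<^bsub>A\<^esub>) = c'"
    by (simp add: twisted_prod_Cons)
  then show "lam (c' # replicate (m - 1) \<one>\<^bsub>A\<^esub>) x [] = x"
    using x by (simp add: lam_eq S_pow_m E.mult_act[symmetric] tens_mult tens_one[symmetric] E.one_act m
        del: funpow.simps)
qed (simp_all add: slot_args_def lin_mapD[OF lam_linear_mid] lin_mapD[OF lam_linear_left] lin_mapD[OF lam_linear_right])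

end

section \<open>Linearity of the evaluation of contexts\<close>

text \<open>A place for a label in a tree is encoded as the function that inserts a label there. Then the
  additivity and the homogeneity relations both say that a map is linear in the inserted label.\<close>

inductive leaf_place :: "('a \<Rightarrow> 'a ctx) \<Rightarrow> bool" where
  leaf: "leaf_place Leaf"
| inside: "leaf_place K \<Longrightarrow> leaf_place (\<lambda>a. Node (us @ K a # ws))"

lemma leaf_sum_place:
  "leaf_sum A t t1 t2 \<Longrightarrow> \<exists>K a b. leaf_place K \<and> t = K (a \<oplus>\<^bsub>A\<^esub> b) \<and> t1 = K a \<and> t2 = K b"
proof (induction rule: leaf_sum.induct)
  case (inside t t1 t2 us ws)
  then obtain K a b where "leaf_place K" "t = K (a \<oplus>\<^bsub>A\<^esub> b)" "t1 = K a" "t2 = K b" by blast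
  then show ?case using leaf_place.inside[of K us ws] by blast
qed (use leaf_place.leaf in blast)

lemma leaf_smult_place:
  "leaf_smult A r t t' \<Longrightarrow> \<exists>K a. leaf_place K \<and> t = K (r \<odot>\<^bsub>A\<^esub> a) \<and> t' = K a"
proof (induction rule: leaf_smult.induct)
  case (inside t t' us ws)
  then obtain K a where "leaf_place K" "t = K (r \<odot>\<^bsub>A\<^esub> a)" "t' = K a" by blast
  then show ?case using leaf_place.inside[of K us ws] by blast
qed (use leaf_place.leaf in blast)

lemma leaf_place_label: "leaf_place K \<Longrightarrow> a \<in> set_ctx (K a)"
  by (induction rule: leaf_place.induct) auto

lemma leaf_place_change:
  "leaf_place K \<Longrightarrow> holes (K b) = holes (K a) \<and> full n (K b) = full n (K a)
    \<and> set_ctx (K b) \<subseteq> insert b (set_ctx (K a))"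
  by (induction rule: leaf_place.induct) auto

lemma leaf_place_contexts:
  assumes "leaf_place K" "K a \<in> contexts A n" "b \<in> carrier A"
  shows "K b \<in> contexts A n"
  using leaf_place_change[OF assms(1), of b a n] assms(2,3) by (auto simp: contexts_def)

lemma contract_eval:
  "contract \<mu> t t' \<Longrightarrow> eval_ctx \<mu> lam x t = eval_ctx \<mu> lam x t'"
proof (induction rule: contract.induct)
  case (vertex as)
  show ?case using eval_vertex_tree[of \<mu> lam as] by (simp add: comp_def)
qed simp

lemma (in cyclic_datum) val_place_linear:
  assumes "leaf_place K" "\<And>a. a \<in> carrier A \<Longrightarrow> K a \<in> trees A (Suc m)"
  shows "(\<lambda>a. val (K a)) \<in> lin_map R A A"
  using assms
proof (induction rule: leaf_place.induct)
  case leaf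
  show ?case by (rule lin_mapI) auto
next
  case (inside K us ws)
  then have K: "\<And>a. a \<in> carrier A \<Longrightarrow> K a \<in> trees A (Suc m)"
    and uw: "set us \<subseteq> trees A (Suc m)" "set ws \<subseteq> trees A (Suc m)" "length us + length ws = m"
    using inside.prems[OF A_zero_closed] by (auto simp: Node_in_trees)
  show ?case
    using lin_map_comp[OF inside.IH nary_mult_linear[OF vals_closed[OF uw(1)] vals_closed[OF uw(2)]]] K uw(3)
    by simp
qed

context slot_module
begin

definition op where "op t x = projr (eval_ctx \<mu> lam x t)"

lemma args_vals:
  "\<lbrakk>set us \<subseteq> trees A (Suc m); set ws \<subseteq> trees A (Suc m); length us + length ws = m\<rbrakk>
    \<Longrightarrow> slot_args A m (map val us) (map val ws)"
  using vals_closed by (simp add: slot_args_def)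

lemma lam_linear_mid: "slot_args A m as bs \<Longrightarrow> (\<lambda>x. lam as x bs) \<in> lin_map R M M"
  by (rule lin_mapI) (auto simp: lam_closed lam_add lam_smult)

lemma lam_linear_left:
  assumes "set as \<subseteq> carrier A" "set as' \<subseteq> carrier A" "set bs \<subseteq> carrier A" "x \<in> carrier M"
    "Suc (length as + length as' + length bs) = m"
  shows "(\<lambda>a. lam (as @ a # as') x bs) \<in> lin_map R A M"
proof -
  have "slot_args A m (as @ a # as') bs" if "a \<in> carrier A" for a
    using assms that by (simp add: slot_args_def)
  then show ?thesis
    using assms(4) by (intro lin_mapI) (simp_all add: lam_closed lam_add_left lam_smult_left)
qed

lemma lam_linear_right:
  assumes "set as \<subseteq> carrier A" "set bs \<subseteq> carrier A" "set bs' \<subseteq> carrier A" "x \<in> carrier M"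
    "Suc (length as + length bs + length bs') = m"
  shows "(\<lambda>a. lam as x (bs @ a # bs')) \<in> lin_map R A M"
proof -
  have "slot_args A m as (bs @ a # bs')" if "a \<in> carrier A" for a
    using assms that by (simp add: slot_args_def)
  then show ?thesis
    using assms(4) by (intro lin_mapI) (simp_all add: lam_closed lam_add_right lam_smult_right)
qed

lemma eval_op_closed:
  assumes "t \<in> contexts A (Suc m)" "x \<in> carrier M"
  shows "eval_ctx \<mu> lam x t = Inr (op t x) \<and> op t x \<in> carrier M"
  using assms(1)
proof (induction rule: contexts_induct)
  case Hole
  show ?case using assms(2) by (simp add: op_def)
next
  case (Node us t ws)
  then have "eval_ctx \<mu> lam x (Node (us @ t # ws)) = Inr (lam (map val us) (op t x) (map val ws))"
    using trees_holes[OF Node(1)] trees_holes[OF Node(2)] by (intro eval_ctx_slot) auto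
  moreover have "lam (map val us) (op t x) (map val ws) \<in> carrier M"
    using Node by (intro lam_closed args_vals) auto
  ultimately show ?case by (simp add: op_def)
qed

lemmas eval_op = eval_op_closed[THEN conjunct1] and op_closed = eval_op_closed[THEN conjunct2]

lemma op_Hole [simp]: "op Hole x = x"
  by (simp add: op_def)

lemma op_Node:
  assumes "set us \<subseteq> trees A (Suc m)" "set ws \<subseteq> trees A (Suc m)" "t \<in> contexts A (Suc m)" "x \<in> carrier M"
  shows "op (Node (us @ t # ws)) x = lam (map val us) (op t x) (map val ws)"
proof -
  have "eval_ctx \<mu> lam x (Node (us @ t # ws)) = Inr (lam (map val us) (op t x) (map val ws))"
    using trees_holes[OF assms(1)] trees_holes[OF assms(2)] eval_op[OF assms(3,4)] by (intro eval_ctx_slot) auto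
  then show ?thesis by (simp add: op_def)
qed

lemma op_slot:
  assumes "slot_args A m as bs" "x \<in> carrier M"
  shows "op (slot_ctx as bs) x = lam as x bs"
proof -
  have "op (Node (map Leaf as @ Hole # map Leaf bs)) x
      = lam (map val (map Leaf as)) (op Hole x) (map val (map Leaf bs))"
    by (rule op_Node) (use assms in \<open>auto simp: slot_args_def\<close>)
  then show ?thesis by (simp add: slot_ctx_def comp_def)
qed

lemma op_graft:
  "\<lbrakk>D \<in> contexts A (Suc m); x \<in> carrier M\<rbrakk> \<Longrightarrow> op (graft t D) x = op t (op D x)"
  unfolding op_def[of "graft t D"] op_def[of t] by (simp add: eval_ctx_graft[OF eval_op])

lemma op_linear: "t \<in> contexts A (Suc m) \<Longrightarrow> op t \<in> lin_map R M M"
proof (induction rule: contexts_induct)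
  case Hole
  show ?case by (rule lin_mapI) auto
next
  case (Node us t ws)
  have "(\<lambda>x. lam (map val us) (op t x) (map val ws)) \<in> lin_map R M M"
    using Node by (intro lin_map_comp[OF Node(5) lam_linear_mid] args_vals) auto
  then show ?case
    using op_Node[OF Node(1,2,3)] by (auto simp: lin_map_def)
qed

lemma op_rebracket:
  "\<lbrakk>t \<in> contexts A (Suc m); t' \<in> contexts A (Suc m); rebracket t t'; x \<in> carrier M\<rbrakk> \<Longrightarrow> op t x = op t' x"
  unfolding op_def by (simp add: total_assoc)

lemma op_contract: "contract \<mu> t t' \<Longrightarrow> op t x = op t' x"
  unfolding op_def by (simp add: contract_eval)

text \<open>Follow the path from the root to the place. As long as it coincides with the path to the hole, the
  operations are linear in their middle argument. Where the two paths part, the label enters an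
  ordinary subtree, whose value is linear in the label, and that value is an argument of a slot
  operation to the left or to the right of the hole.\<close>

lemma op_place_linear:
  assumes "leaf_place K" "\<And>a. a \<in> carrier A \<Longrightarrow> K a \<in> contexts A (Suc m)" and x: "x \<in> carrier M"
  shows "(\<lambda>a. op (K a) x) \<in> lin_map R A M"
  using assms(1,2)
proof (induction rule: leaf_place.induct)
  case leaf
  from leaf[OF A_zero_closed] show ?case by simp
next
  case (inside K us ws)
  note ctx = inside.prems
  let ?h = "holes (K \<zero>\<^bsub>A\<^esub>)"
  have h: "holes (K a) = ?h" for a
    using leaf_place_change[OF inside.hyps] by blast
  have "sum_list (map holes us) + (?h + sum_list (map holes ws)) = 1"
    using ctx[OF A_zero_closed] by (simp add: contexts_def)
  then have "?h = 1 \<and> sum_list (map holes us) = 0 \<and> sum_list (map holes ws) = 0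
    \<or> ?h = 0 \<and> sum_list (map holes us) = 1 \<and> sum_list (map holes ws) = 0
    \<or> ?h = 0 \<and> sum_list (map holes us) = 0 \<and> sum_list (map holes ws) = 1"
    by linarith
  then consider (mid) "?h = 1" "\<forall>s\<in>set us \<union> set ws. holes s = 0"
    | (left) "?h = 0" "sum_list (map holes us) = 1" "\<forall>s\<in>set ws. holes s = 0"
    | (right) "?h = 0" "\<forall>s\<in>set us. holes s = 0" "sum_list (map holes ws) = 1"
    by (auto simp: sum_list_eq_0_iff)
  then show ?case
  proof cases
    case mid
    have *: "set us \<subseteq> trees A (Suc m)" "set ws \<subseteq> trees A (Suc m)" "length us + length ws = m"
      "\<And>a. a \<in> carrier A \<Longrightarrow> K a \<in> contexts A (Suc m)"
      using ctx[unfolded Node_in_contexts[OF mid(2)]]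
        ctx[OF A_zero_closed, unfolded Node_in_contexts[OF mid(2)]] by auto
    have "(\<lambda>a. lam (map val us) (op (K a) x) (map val ws)) \<in> lin_map R A M"
      by (rule lin_map_comp[OF inside.IH lam_linear_mid[OF args_vals]]) (use * in auto)
    then show ?thesis
      using op_Node[OF *(1,2) *(4) x] by (auto simp: lin_map_def)
  next
    case left
    then obtain u1 s u2 where us: "us = u1 @ s # u2" "\<forall>s\<in>set u1 \<union> set u2. holes s = 0"
      using split_at_hole by blast
    have eq: "Node (us @ K a # ws) = Node (u1 @ s # (u2 @ K a # ws))" for a
      by (simp add: us)
    have "\<forall>s\<in>set u1 \<union> set (u2 @ K a # ws). holes s = 0" for a
      using us left h by auto
    note iff = Node_in_contexts[OF this]
    have *: "set u1 \<subseteq> trees A (Suc m)" "set u2 \<subseteq> trees A (Suc m)" "set ws \<subseteq> trees A (Suc m)"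
      "Suc (length u1 + length u2 + length ws) = m" "s \<in> contexts A (Suc m)"
      "\<And>a. a \<in> carrier A \<Longrightarrow> K a \<in> trees A (Suc m)"
      using ctx[unfolded eq iff] ctx[OF A_zero_closed, unfolded eq iff] by auto
    have "(\<lambda>a. lam (map val u1) (op s x) (map val u2 @ val (K a) # map val ws)) \<in> lin_map R A M"
      by (rule lin_map_comp[OF val_place_linear[OF inside.hyps] lam_linear_right])
        (use * vals_closed op_closed[OF *(5) x] in auto)
    moreover have "op (Node (us @ K a # ws)) x = lam (map val u1) (op s x) (map val u2 @ val (K a) # map val ws)"
      if "a \<in> carrier A" for a
      unfolding eq by (subst op_Node) (use * that x in auto)
    ultimately show ?thesis by (auto simp: lin_map_def)
  next
    case right
    then obtain w1 s w2 where ws: "ws = w1 @ s # w2" "\<forall>s\<in>set w1 \<union> set w2. holes s = 0"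
      using split_at_hole by blast
    have eq: "Node (us @ K a # ws) = Node ((us @ K a # w1) @ s # w2)" for a
      by (simp add: ws)
    have "\<forall>s\<in>set (us @ K a # w1) \<union> set w2. holes s = 0" for a
      using ws right h by auto
    note iff = Node_in_contexts[OF this]
    have *: "set us \<subseteq> trees A (Suc m)" "set w1 \<subseteq> trees A (Suc m)" "set w2 \<subseteq> trees A (Suc m)"
      "Suc (length us + length w1 + length w2) = m" "s \<in> contexts A (Suc m)"
      "\<And>a. a \<in> carrier A \<Longrightarrow> K a \<in> trees A (Suc m)"
      using ctx[unfolded eq iff] ctx[OF A_zero_closed, unfolded eq iff] by auto
    have "(\<lambda>a. lam (map val us @ val (K a) # map val w1) (op s x) (map val w2)) \<in> lin_map R A M"
      by (rule lin_map_comp[OF val_place_linear[OF inside.hyps], where k = "\<lambda>v. lam (map val us @ v # map val w1) (op s x) (map val w2)"], (rule *(6), assumption))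
        (rule lam_linear_left, use * vals_closed op_closed[OF *(5) x] in auto)
    moreover have "op (Node (us @ K a # ws)) x = lam (map val us @ val (K a) # map val w1) (op s x) (map val w2)"
      if "a \<in> carrier A" for a
      unfolding eq by (subst op_Node) (use * that x in auto)
    ultimately show ?thesis by (auto simp: lin_map_def)
  qed
qed

end

section \<open>The algebra of endomorphisms of a module\<close>

text \<open>Endomorphisms are made extensional, so that equality in this algebra is equality on the
  carrier of the module.\<close>

definition end_algebra :: "('r, 'x) ring_scheme \<Rightarrow> ('r, 'm, 'y) module_scheme \<Rightarrow> ('r, 'm \<Rightarrow> 'm) module" where
  "end_algebra R M =
    \<lparr>carrier = lin_map R M M \<inter> extensional (carrier M),
     mult = compose (carrier M),
     one = (\<lambda>x\<in>carrier M. x),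
     zero = (\<lambda>x\<in>carrier M. \<zero>\<^bsub>M\<^esub>),
     add = (\<lambda>f g. \<lambda>x\<in>carrier M. f x \<oplus>\<^bsub>M\<^esub> g x),
     smult = (\<lambda>r f. \<lambda>x\<in>carrier M. r \<odot>\<^bsub>M\<^esub> f x)\<rparr>"

context module
begin

abbreviation EndM where "EndM \<equiv> end_algebra R M"

lemma End_apply:
  assumes "x \<in> carrier M"
  shows "(f \<otimes>\<^bsub>EndM\<^esub> g) x = f (g x)" "\<one>\<^bsub>EndM\<^esub> x = x" "\<zero>\<^bsub>EndM\<^esub> x = \<zero>\<^bsub>M\<^esub>"
    "(f \<oplus>\<^bsub>EndM\<^esub> g) x = f x \<oplus>\<^bsub>M\<^esub> g x" "(r \<odot>\<^bsub>EndM\<^esub> f) x = r \<odot>\<^bsub>M\<^esub> f x"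
  using assms by (simp_all add: end_algebra_def compose_def)

lemma End_lin: "f \<in> carrier EndM \<Longrightarrow> f \<in> lin_map R M M"
  by (simp add: end_algebra_def)

lemmas EndD = lin_mapD[OF End_lin]

lemma End_eqI: "\<lbrakk>f \<in> carrier EndM; g \<in> carrier EndM; \<And>x. x \<in> carrier M \<Longrightarrow> f x = g x\<rbrakk> \<Longrightarrow> f = g"
  by (auto simp: end_algebra_def intro: extensionalityI)

lemma restrict_in_End: "f \<in> lin_map R M M \<Longrightarrow> restrict f (carrier M) \<in> carrier EndM"
  by (auto simp: end_algebra_def lin_map_def)

lemma End_algebra: "assoc_algebra R EndM"
proof -
  have add: "(\<lambda>x. f x \<oplus>\<^bsub>M\<^esub> g x) \<in> lin_map R M M" if "f \<in> lin_map R M M" "g \<in> lin_map R M M" for f g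
    by (rule lin_mapI) (simp_all add: lin_mapD[OF that(1)] lin_mapD[OF that(2)] M.a_ac smult_r_distr)
  have smult: "(\<lambda>x. r \<odot>\<^bsub>M\<^esub> f x) \<in> lin_map R M M" if "r \<in> carrier R" "f \<in> lin_map R M M" for r f
    by (rule lin_mapI)
      (use that(1) in \<open>simp_all add: lin_mapD[OF that(2)] smult_r_distr smult_assoc1[symmetric] R.m_comm\<close>)
  have const: "(\<lambda>x. \<zero>\<^bsub>M\<^esub>) \<in> lin_map R M M" "(\<lambda>x. x) \<in> lin_map R M M"
    by (rule lin_mapI; simp)+
  have cl: "\<zero>\<^bsub>EndM\<^esub> \<in> carrier EndM" "\<one>\<^bsub>EndM\<^esub> \<in> carrier EndM"
    "\<And>f g. \<lbrakk>f \<in> carrier EndM; g \<in> carrier EndM\<rbrakk> \<Longrightarrow> f \<oplus>\<^bsub>EndM\<^esub> g \<in> carrier EndM"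
    "\<And>f g. \<lbrakk>f \<in> carrier EndM; g \<in> carrier EndM\<rbrakk> \<Longrightarrow> f \<otimes>\<^bsub>EndM\<^esub> g \<in> carrier EndM"
    "\<And>r f. \<lbrakk>r \<in> carrier R; f \<in> carrier EndM\<rbrakk> \<Longrightarrow> r \<odot>\<^bsub>EndM\<^esub> f \<in> carrier EndM"
    using restrict_in_End[OF const(1)] restrict_in_End[OF const(2)]
      restrict_in_End[OF add[OF End_lin End_lin]] restrict_in_End[OF lin_map_comp[OF End_lin End_lin]]
      restrict_in_End[OF smult[OF _ End_lin]]
    by (simp_all add: end_algebra_def compose_def)
  note simps = End_apply EndD smult_r_distr
  have md: "module R EndM"
    by (rule pointwise_module[OF module_axioms, of _ "carrier M"]; (rule End_eqI cl EndD)?)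
      (simp_all add: End_apply)
  have ri: "ring EndM"
  proof (intro ringI monoidI)
    show "abelian_group EndM" using md by (rule module.axioms)
  qed (auto intro!: End_eqI cl simp: simps cl)
  show ?thesis
    by (intro assoc_algebra.intro md ri assoc_algebra_axioms.intro)
      (auto intro!: End_eqI cl simp: simps cl)
qed

lemma End_pow: "\<lbrakk>f \<in> carrier EndM; x \<in> carrier M\<rbrakk> \<Longrightarrow> (f [^]\<^bsub>EndM\<^esub> (k::nat)) x = (f ^^ k) x"
proof (induction k arbitrary: x)
  case (Suc k)
  interpret End: assoc_algebra R EndM by (rule End_algebra)
  have "(f [^]\<^bsub>EndM\<^esub> Suc k) x = (f [^]\<^bsub>EndM\<^esub> k) (f x)"
    using Suc.prems by (simp add: End_apply)
  then show ?case using Suc by (simp add: EndD funpow_swap1)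
qed (simp add: End_apply nat_pow_def)

end

section \<open>The monoid of contexts\<close>

lemma holes_graft: "holes (graft t D) = holes t * holes D"
proof (induction t)
  case (Node ts)
  then show ?case by (induction ts) (auto simp: algebra_simps)
qed auto

lemma full_graft: "\<lbrakk>full n t; full n D\<rbrakk> \<Longrightarrow> full n (graft t D)"
  by (induction t) auto

lemma set_ctx_graft: "set_ctx (graft t D) \<subseteq> set_ctx t \<union> set_ctx D"
  by (induction t) auto

lemma graft_assoc: "graft (graft t D) D' = graft t (graft D D')"
  by (induction t) auto

lemma graft_Hole [simp]: "graft t Hole = t"
  by (induction t) (auto intro: map_idI)

lemma graft_closed: "\<lbrakk>t \<in> contexts A n; D \<in> contexts A n\<rbrakk> \<Longrightarrow> graft t D \<in> contexts A n"
  using set_ctx_graft[of t D] by (auto simp: contexts_def holes_graft full_graft)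

lemma ctx_monoid_simps [simp]:
  "carrier (ctx_monoid A n) = contexts A n" "t \<otimes>\<^bsub>ctx_monoid A n\<^esub> D = graft t D" "\<one>\<^bsub>ctx_monoid A n\<^esub> = Hole"
  by (simp_all add: ctx_monoid_def)

lemma ctx_monoid: "monoid (ctx_monoid A n)"
  by (rule monoidI) (auto simp: graft_closed graft_assoc)

lemma slot_ctx_contexts: "slot_args A m as bs \<Longrightarrow> slot_ctx as bs \<in> contexts A (Suc m)"
  unfolding slot_ctx_def
  by (subst Node_in_contexts) (auto simp: slot_args_def)

lemma graft_slot_ctx: "graft (slot_ctx as bs) D = Node (map Leaf as @ D # map Leaf bs)"
  by (simp add: slot_ctx_def)

section \<open>The anchored envelope\<close>

lemma place_leaf_sum: "leaf_place K \<Longrightarrow> leaf_sum A (K (a \<oplus>\<^bsub>A\<^esub> b)) (K a) (K b)"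
  by (induction rule: leaf_place.induct) (auto intro: leaf_sum.intros)

lemma place_leaf_smult: "leaf_place K \<Longrightarrow> leaf_smult A r (K (r \<odot>\<^bsub>A\<^esub> a)) (K a)"
  by (induction rule: leaf_place.induct) (auto intro: leaf_smult.intros)

lemma contract_inside_star:
  "(contract \<mu>)\<^sup>*\<^sup>* t t' \<Longrightarrow> (contract \<mu>)\<^sup>*\<^sup>* (Node (us @ t # ws)) (Node (us @ t' # ws))"
proof (induction rule: rtranclp_induct)
  case (step y z)
  then show ?case by (meson contract.inside rtranclp.rtrancl_into_rtrancl)
qed simp

lemma contract_children:
  "(\<And>t. t \<in> set ts \<Longrightarrow> (contract \<mu>)\<^sup>*\<^sup>* t (g t))
    \<Longrightarrow> (contract \<mu>)\<^sup>*\<^sup>* (Node (us @ ts @ ws)) (Node (us @ map g ts @ ws))"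
proof (induction ts arbitrary: us)
  case (Cons t ts)
  have "(contract \<mu>)\<^sup>*\<^sup>* (Node (us @ t # (ts @ ws))) (Node (us @ g t # (ts @ ws)))"
    by (rule contract_inside_star) (use Cons.prems in simp)
  moreover have "(contract \<mu>)\<^sup>*\<^sup>* (Node ((us @ [g t]) @ ts @ ws)) (Node ((us @ [g t]) @ map g ts @ ws))"
    by (rule Cons.IH) (use Cons.prems in simp)
  ultimately show ?case by simp
qed simp

text \<open>Contracting from the leaves towards the root evaluates an ordinary tree.\<close>

lemma contract_tree: "holes t = 0 \<Longrightarrow> (contract \<mu>)\<^sup>*\<^sup>* t (Leaf (tree_value \<mu> t))"
proof (induction t)
  case (Node ts)
  then have "(contract \<mu>)\<^sup>*\<^sup>* (Node ([] @ ts @ [])) (Node ([] @ map (\<lambda>t. Leaf (tree_value \<mu> t)) ts @ []))"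
    by (intro contract_children) (simp add: sum_list_eq_0_iff)
  also have "contract \<mu> (Node ([] @ map (\<lambda>t. Leaf (tree_value \<mu> t)) ts @ [])) (Leaf (\<mu> (map (tree_value \<mu>) ts)))"
    using contract.vertex[of \<mu> "map (tree_value \<mu>) ts"] by (simp add: comp_def)
  finally show ?case by simp
qed auto

context cyclic_datum
begin

sublocale K: monoid_ring R "ctx_monoid A (Suc m)"
  by (intro monoid_ring.intro R.is_cring ctx_monoid)

abbreviation KF where "KF \<equiv> ctx_algebra R m A"
abbreviation Ctx where "Ctx \<equiv> contexts A (Suc m)"
abbreviation U where "U \<equiv> anchored_envelope R m A \<sigma> c"
abbreviation cl where "cl \<equiv> ctx_class R m A \<sigma> c"
abbreviation sl where "sl as bs \<equiv> cl (slot_ctx as bs)"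

lemma KF_algebra: "assoc_algebra R KF"
  using K.RG_algebra by (simp add: ctx_algebra_def)

sublocale KF: assoc_algebra R KF by (rule KF_algebra)

lemma ctx_el_closed: "t \<in> Ctx \<Longrightarrow> basis_el R t \<in> carrier KF"
  using K.basis_el_closed[of t] by (simp add: ctx_algebra_def)

lemma ones_closed [simp]: "set (replicate k \<one>\<^bsub>A\<^esub>) \<subseteq> carrier A"
  by auto

lemma first_anchor_args: "a \<in> carrier A \<Longrightarrow> slot_args A m [] (replicate (m - 1) \<one>\<^bsub>A\<^esub> @ [a])"
  using m_ge_2 by (auto simp: slot_args_def)

lemma last_anchor_args: "a \<in> carrier A \<Longrightarrow> slot_args A m (a # replicate (m - 1) \<one>\<^bsub>A\<^esub>) []"
  using m_ge_2 by (auto simp: slot_args_def)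

lemma envelope_relsE:
  assumes "f \<in> envelope_rels R m A \<sigma> c \<union> anchor_rels R m A c"
  obtains (sum) t t1 t2 where "t \<in> Ctx" "t1 \<in> Ctx" "t2 \<in> Ctx" "leaf_sum A t t1 t2"
      "f = basis_el R t \<ominus>\<^bsub>KF\<^esub> (basis_el R t1 \<oplus>\<^bsub>KF\<^esub> basis_el R t2)"
    | (smult) r t t' where "r \<in> carrier R" "t \<in> Ctx" "t' \<in> Ctx" "leaf_smult A r t t'"
      "f = basis_el R t \<ominus>\<^bsub>KF\<^esub> (r \<odot>\<^bsub>KF\<^esub> basis_el R t')"
    | (contract) t t' where "t \<in> Ctx" "t' \<in> Ctx" "contract \<mu> t t'"
      "f = basis_el R t \<ominus>\<^bsub>KF\<^esub> basis_el R t'"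
    | (rebracket) t t' where "t \<in> Ctx" "t' \<in> Ctx" "rebracket t t'"
      "f = basis_el R t \<ominus>\<^bsub>KF\<^esub> basis_el R t'"
    | (first) "f = basis_el R (slot_ctx [] (replicate (m - 1) \<one>\<^bsub>A\<^esub> @ [c'])) \<ominus>\<^bsub>KF\<^esub> \<one>\<^bsub>KF\<^esub>"
    | (last) "f = basis_el R (slot_ctx (c' # replicate (m - 1) \<one>\<^bsub>A\<^esub>) []) \<ominus>\<^bsub>KF\<^esub> \<one>\<^bsub>KF\<^esub>"
  using assms unfolding envelope_rels_def anchor_rels_def Let_def
  by (elim UnE CollectE exE conjE insertE emptyE) metis+

lemma envelope_relsI:
  "\<lbrakk>t \<in> Ctx; t1 \<in> Ctx; t2 \<in> Ctx; leaf_sum A t t1 t2\<rbrakk>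
    \<Longrightarrow> basis_el R t \<ominus>\<^bsub>KF\<^esub> (basis_el R t1 \<oplus>\<^bsub>KF\<^esub> basis_el R t2) \<in> envelope_rels R m A \<sigma> c \<union> anchor_rels R m A c"
  "\<lbrakk>r \<in> carrier R; t \<in> Ctx; t' \<in> Ctx; leaf_smult A r t t'\<rbrakk>
    \<Longrightarrow> basis_el R t \<ominus>\<^bsub>KF\<^esub> (r \<odot>\<^bsub>KF\<^esub> basis_el R t') \<in> envelope_rels R m A \<sigma> c \<union> anchor_rels R m A c"
  "\<lbrakk>t \<in> Ctx; t' \<in> Ctx; contract \<mu> t t'\<rbrakk>
    \<Longrightarrow> basis_el R t \<ominus>\<^bsub>KF\<^esub> basis_el R t' \<in> envelope_rels R m A \<sigma> c \<union> anchor_rels R m A c"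
  "\<lbrakk>t \<in> Ctx; t' \<in> Ctx; rebracket t t'\<rbrakk>
    \<Longrightarrow> basis_el R t \<ominus>\<^bsub>KF\<^esub> basis_el R t' \<in> envelope_rels R m A \<sigma> c \<union> anchor_rels R m A c"
  "basis_el R (slot_ctx [] (replicate (m - 1) \<one>\<^bsub>A\<^esub> @ [c'])) \<ominus>\<^bsub>KF\<^esub> \<one>\<^bsub>KF\<^esub>
    \<in> envelope_rels R m A \<sigma> c \<union> anchor_rels R m A c"
  "basis_el R (slot_ctx (c' # replicate (m - 1) \<one>\<^bsub>A\<^esub>) []) \<ominus>\<^bsub>KF\<^esub> \<one>\<^bsub>KF\<^esub>
    \<in> envelope_rels R m A \<sigma> c \<union> anchor_rels R m A c"
  unfolding envelope_rels_def anchor_rels_def Let_def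
  by (rule UnI1, rule UnI1, rule UnI1, rule UnI1, blast, rule UnI1, rule UnI1, rule UnI1, rule UnI2, blast,
      rule UnI1, rule UnI1, rule UnI2, blast, rule UnI1, rule UnI2, blast, rule UnI2, blast, rule UnI2, blast)

sublocale Uq: alg_quotient R KF "envelope_rels R m A \<sigma> c \<union> anchor_rels R m A c"
proof (unfold_locales, rule subsetI)
  fix f assume "f \<in> envelope_rels R m A \<sigma> c \<union> anchor_rels R m A c"
  then show "f \<in> carrier KF"
    by (cases rule: envelope_relsE)
      (simp_all add: ctx_el_closed slot_ctx_contexts first_anchor_args last_anchor_args del: One_nat_def)
qed

lemma U_eq: "U = Uq.Q"
  by (simp add: anchored_envelope_def envelope_ideal_def)

lemma cl_eq: "cl t = Uq.cls (basis_el R t)"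
  by (simp add: ctx_class_def envelope_ideal_def)

lemma U_algebra: "assoc_algebra R U"
  unfolding U_eq by (rule Uq.Q_algebra)

sublocale U: assoc_algebra R U by (rule U_algebra)

lemmas cls_hom = Uq.cls_alg_hom[folded U_eq]

lemma cl_closed [simp]: "t \<in> Ctx \<Longrightarrow> cl t \<in> carrier U"
  unfolding cl_eq by (rule alg_homD(1)[OF cls_hom ctx_el_closed])

lemma cl_graft: "\<lbrakk>t \<in> Ctx; D \<in> Ctx\<rbrakk> \<Longrightarrow> cl (graft t D) = cl t \<otimes>\<^bsub>U\<^esub> cl D"
  using K.basis_el_mult[of t D] unfolding cl_eq
  by (simp add: alg_homD(2)[OF cls_hom, symmetric] ctx_el_closed) (simp add: ctx_algebra_def)

lemma cl_Hole: "cl Hole = \<one>\<^bsub>U\<^esub>"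
  unfolding cl_eq alg_homD(5)[OF cls_hom, symmetric]
  by (simp add: ctx_algebra_def K.RG_simps)

lemma cl_contract: "\<lbrakk>t \<in> Ctx; t' \<in> Ctx; contract \<mu> t t'\<rbrakk> \<Longrightarrow> cl t = cl t'"
  unfolding cl_eq by (rule Uq.cls_rel) (simp_all add: ctx_el_closed envelope_relsI(3) del: Un_iff)

lemma cl_rebracket: "\<lbrakk>t \<in> Ctx; t' \<in> Ctx; rebracket t t'\<rbrakk> \<Longrightarrow> cl t = cl t'"
  unfolding cl_eq by (rule Uq.cls_rel) (simp_all add: ctx_el_closed envelope_relsI(4) del: Un_iff)

lemma cl_sum:
  assumes "t \<in> Ctx" "t1 \<in> Ctx" "t2 \<in> Ctx" "leaf_sum A t t1 t2"
  shows "cl t = cl t1 \<oplus>\<^bsub>U\<^esub> cl t2"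
proof -
  have "cl t = Uq.cls (basis_el R t1 \<oplus>\<^bsub>KF\<^esub> basis_el R t2)"
    unfolding cl_eq by (rule Uq.cls_rel) (use assms in \<open>simp_all add: ctx_el_closed envelope_relsI(1) del: Un_iff\<close>)
  then show ?thesis
    unfolding cl_eq using assms by (simp add: alg_homD(3)[OF cls_hom] ctx_el_closed)
qed

lemma cl_smult:
  assumes "r \<in> carrier R" "t \<in> Ctx" "t' \<in> Ctx" "leaf_smult A r t t'"
  shows "cl t = r \<odot>\<^bsub>U\<^esub> cl t'"
proof -
  have "cl t = Uq.cls (r \<odot>\<^bsub>KF\<^esub> basis_el R t')"
    unfolding cl_eq by (rule Uq.cls_rel) (use assms in \<open>simp_all add: ctx_el_closed envelope_relsI(2) del: Un_iff\<close>)
  then show ?thesis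
    unfolding cl_eq using assms by (simp add: alg_homD(4)[OF cls_hom] ctx_el_closed)
qed

lemma cl_anchors:
  "sl [] (replicate (m - 1) \<one>\<^bsub>A\<^esub> @ [c']) = \<one>\<^bsub>U\<^esub>" "sl (c' # replicate (m - 1) \<one>\<^bsub>A\<^esub>) [] = \<one>\<^bsub>U\<^esub>"
proof -
  show "sl [] (replicate (m - 1) \<one>\<^bsub>A\<^esub> @ [c']) = \<one>\<^bsub>U\<^esub>"
    unfolding cl_eq alg_homD(5)[OF cls_hom, symmetric]
    by (rule Uq.cls_rel[OF _ _ envelope_relsI(5)])
      (simp_all add: ctx_el_closed slot_ctx_contexts first_anchor_args del: One_nat_def)
  show "sl (c' # replicate (m - 1) \<one>\<^bsub>A\<^esub>) [] = \<one>\<^bsub>U\<^esub>"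
    unfolding cl_eq alg_homD(5)[OF cls_hom, symmetric]
    by (rule Uq.cls_rel[OF _ _ envelope_relsI(6)])
      (simp_all add: ctx_el_closed slot_ctx_contexts last_anchor_args del: One_nat_def)
qed

lemma U_span: "carrier U \<subseteq> lin_span R U (cl ` Ctx)"
proof -
  have "carrier Uq.Q \<subseteq> lin_span R Uq.Q ((\<lambda>x. Uq.cls x) ` basis_el R ` Ctx)"
    by (rule Uq.Q_span) (use K.RG_span K.basis_el_closed in \<open>auto simp: ctx_algebra_def\<close>)
  then show ?thesis by (simp add: U_eq image_image cl_eq)
qed

lemma U_lift:
  assumes N: "assoc_algebra R N"
    and cls: "\<And>t. t \<in> Ctx \<Longrightarrow> \<phi> t \<in> carrier N"
    and mult: "\<And>t D. \<lbrakk>t \<in> Ctx; D \<in> Ctx\<rbrakk> \<Longrightarrow> \<phi> (graft t D) = \<phi> t \<otimes>\<^bsub>N\<^esub> \<phi> D"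
    and one: "\<phi> Hole = \<one>\<^bsub>N\<^esub>"
    and sum: "\<And>t t1 t2. \<lbrakk>t \<in> Ctx; t1 \<in> Ctx; t2 \<in> Ctx; leaf_sum A t t1 t2\<rbrakk> \<Longrightarrow> \<phi> t = \<phi> t1 \<oplus>\<^bsub>N\<^esub> \<phi> t2"
    and smult: "\<And>r t t'. \<lbrakk>r \<in> carrier R; t \<in> Ctx; t' \<in> Ctx; leaf_smult A r t t'\<rbrakk> \<Longrightarrow> \<phi> t = r \<odot>\<^bsub>N\<^esub> \<phi> t'"
    and contract: "\<And>t t'. \<lbrakk>t \<in> Ctx; t' \<in> Ctx; contract \<mu> t t'\<rbrakk> \<Longrightarrow> \<phi> t = \<phi> t'"
    and rebracket: "\<And>t t'. \<lbrakk>t \<in> Ctx; t' \<in> Ctx; rebracket t t'\<rbrakk> \<Longrightarrow> \<phi> t = \<phi> t'"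
    and first: "\<phi> (slot_ctx [] (replicate (m - 1) \<one>\<^bsub>A\<^esub> @ [c'])) = \<one>\<^bsub>N\<^esub>"
    and last: "\<phi> (slot_ctx (c' # replicate (m - 1) \<one>\<^bsub>A\<^esub>) []) = \<one>\<^bsub>N\<^esub>"
  shows "\<exists>h \<in> alg_hom R U N. \<forall>t \<in> Ctx. h (cl t) = \<phi> t"
proof -
  interpret N: assoc_algebra R N by fact
  define h where "h = K.lin_ext N \<phi>"
  have h: "h \<in> alg_hom R KF N" and hb: "\<And>t. t \<in> Ctx \<Longrightarrow> h (basis_el R t) = \<phi> t"
    using K.RG_lift[OF N, of \<phi>] cls mult one by (auto simp: ctx_algebra_def h_def)
  note hm = alg_hom_minus[OF h KF_algebra N] alg_homD[OF h] ctx_el_closed hb cls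
    slot_ctx_contexts[OF first_anchor_args] slot_ctx_contexts[OF last_anchor_args]
  have "h f = \<zero>\<^bsub>N\<^esub>" if "f \<in> envelope_rels R m A \<sigma> c \<union> anchor_rels R m A c" for f
    using that
  proof (cases rule: envelope_relsE)
    case (sum t t1 t2)
    then show ?thesis using assms(5)[OF sum(1-4)] by (simp add: hm)
  next
    case (smult r t t')
    then show ?thesis using assms(6)[OF smult(1-4)] by (simp add: hm)
  next
    case (contract t t')
    then show ?thesis using assms(7)[OF contract(1-3)] by (simp add: hm)
  next
    case (rebracket t t')
    then show ?thesis using assms(8)[OF rebracket(1-3)] by (simp add: hm)
  qed (use first last in \<open>simp_all add: hm del: One_nat_def\<close>)
  from Uq.Q_lift[OF N h this] show ?thesis
    unfolding U_eq cl_eq using hb ctx_el_closed by metis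
qed

subsection \<open>Generation by one-vertex contexts\<close>

lemma contract_preserves:
  "\<lbrakk>contract \<mu> t t'; full (Suc m) t; set_ctx t \<subseteq> carrier A\<rbrakk>
    \<Longrightarrow> full (Suc m) t' \<and> set_ctx t' \<subseteq> carrier A \<and> holes t' = holes t"
proof (induction rule: contract.induct)
  case (vertex as)
  then have "\<mu> as \<in> carrier A" by (intro nary_mult_closed) auto
  then show ?case by (simp add: comp_def)
qed auto

lemma contract_star_preserves:
  "\<lbrakk>(contract \<mu>)\<^sup>*\<^sup>* t t'; t \<in> Ctx\<rbrakk> \<Longrightarrow> t' \<in> Ctx \<and> cl t' = cl t"
proof (induction rule: rtranclp_induct)
  case (step y w)
  then have "w \<in> Ctx" using contract_preserves[OF step(2)] by (auto simp: contexts_def)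
  then show ?case using step cl_contract[of y w] by auto
qed simp

text \<open>Contracting all ordinary subtrees hanging off a vertex turns that vertex into a one-vertex
  context. So the class of a context is the product of one-vertex contexts along the path to the
  hole, and the envelope is generated by them.\<close>

lemma cl_Node:
  assumes us: "set us \<subseteq> trees A (Suc m)" and ws: "set ws \<subseteq> trees A (Suc m)"
    and t: "t \<in> Ctx" and len: "length us + length ws = m"
  shows "cl (Node (us @ t # ws)) = sl (map val us) (map val ws) \<otimes>\<^bsub>U\<^esub> cl t"
proof -
  let ?g = "\<lambda>t. Leaf (val t)"
  have 0: "\<forall>s\<in>set us \<union> set ws. holes s = 0"
    using trees_holes[OF us] trees_holes[OF ws] by blast
  have "(contract \<mu>)\<^sup>*\<^sup>* (Node ([] @ us @ (t # ws))) (Node ([] @ map ?g us @ (t # ws)))"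
    by (rule contract_children) (use 0 contract_tree in blast)
  moreover have "(contract \<mu>)\<^sup>*\<^sup>* (Node ((map ?g us @ [t]) @ ws @ [])) (Node ((map ?g us @ [t]) @ map ?g ws @ []))"
    by (rule contract_children) (use 0 contract_tree in blast)
  ultimately have "(contract \<mu>)\<^sup>*\<^sup>* (Node (us @ t # ws)) (Node (map ?g us @ t # map ?g ws))"
    by simp
  moreover have "Node (us @ t # ws) \<in> Ctx"
    unfolding Node_in_contexts[OF 0] using assms by simp
  ultimately have "cl (Node (us @ t # ws)) = cl (Node (map ?g us @ t # map ?g ws))"
    using contract_star_preserves by metis
  also have "Node (map ?g us @ t # map ?g ws) = graft (slot_ctx (map val us) (map val ws)) t"
    by (simp add: graft_slot_ctx comp_def)
  also have "cl \<dots> = sl (map val us) (map val ws) \<otimes>\<^bsub>U\<^esub> cl t"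
    by (rule cl_graft[OF slot_ctx_contexts t])
      (use len vals_closed[OF us] vals_closed[OF ws] in \<open>simp add: slot_args_def\<close>)
  finally show ?thesis .
qed

lemma cl_induct [consumes 1, case_names one slot]:
  assumes "t \<in> Ctx" and "P \<one>\<^bsub>U\<^esub>"
    and "\<And>as bs X. \<lbrakk>slot_args A m as bs; X \<in> carrier U; P X\<rbrakk> \<Longrightarrow> P (sl as bs \<otimes>\<^bsub>U\<^esub> X)"
  shows "P (cl t)"
  using assms(1)
proof (induction rule: contexts_induct)
  case Hole
  show ?case using assms(2) by (simp add: cl_Hole)
next
  case (Node us t ws)
  then have len: "length us + length ws = m" by simp
  show ?case
    unfolding cl_Node[OF Node(1-3) len]
    by (rule assms(3)) (use vals_closed[OF Node(1)] vals_closed[OF Node(2)] Node(3,5) len in \<open>simp_all add: slot_args_def\<close>)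
qed

lemma alg_hom_eq_on_slots:
  assumes N: "assoc_algebra R N" and h: "h \<in> alg_hom R U N" and k: "k \<in> alg_hom R U N"
    and eq: "\<And>as bs. slot_args A m as bs \<Longrightarrow> h (sl as bs) = k (sl as bs)"
    and X: "X \<in> carrier U"
  shows "h X = k X"
proof (rule lin_map_eq_on_span[OF U.module_axioms assoc_algebra_module[OF N] _ alg_hom_lin_map[OF h] alg_hom_lin_map[OF k]])
  fix Y assume "Y \<in> cl ` Ctx"
  then obtain t where t: "t \<in> Ctx" "Y = cl t" by blast
  show "h Y = k Y"
    unfolding t(2) using t(1)
  proof (induction rule: cl_induct)
    case one
    show ?case by (simp add: alg_homD(5)[OF h] alg_homD(5)[OF k])
  next
    case (slot as bs X)
    then show ?case
      by (simp add: alg_homD(2)[OF h] alg_homD(2)[OF k] slot_ctx_contexts eq)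
  qed
qed (use U_span X in auto)

end

section \<open>Slot modules are modules over the envelope\<close>

text \<open>The evaluation of contexts respects each of the relations that define the envelope: the linear ones by
  \<open>op_place_linear\<close>, contraction by the definition of the evaluation, and rebracketing and
  anchoring by the axioms of an anchored slot module.\<close>

lemma (in anchored_slot_module) envelope_representation:
  "\<exists>\<rho> \<in> alg_hom R U (end_algebra R M). \<forall>t \<in> Ctx. \<forall>x \<in> carrier M. \<rho> (cl t) x = op t x"
proof -
  interpret End: assoc_algebra R M.EndM by (rule M.End_algebra)
  let ?op = "\<lambda>t. restrict (op t) (carrier M)"
  have op_cl: "?op t \<in> carrier M.EndM" if "t \<in> Ctx" for t
    by (rule M.restrict_in_End[OF op_linear[OF that]])
  have "\<exists>h \<in> alg_hom R U M.EndM. \<forall>t \<in> Ctx. h (cl t) = ?op t"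
  proof (rule U_lift[OF M.End_algebra op_cl])
    fix t D assume tD: "t \<in> Ctx" "D \<in> Ctx"
    show "?op (graft t D) = ?op t \<otimes>\<^bsub>M.EndM\<^esub> ?op D"
      by (rule M.End_eqI)
        (use tD op_closed in \<open>auto simp: M.End_apply op_graft intro!: End.A.m_closed op_cl graft_closed\<close>)
  next
    show "?op Hole = \<one>\<^bsub>M.EndM\<^esub>"
      by (rule M.End_eqI) (auto simp: M.End_apply intro!: op_cl)
  next
    fix t t1 t2 assume t: "t \<in> Ctx" "t1 \<in> Ctx" "t2 \<in> Ctx" and "leaf_sum A t t1 t2"
    then obtain K a b where K: "leaf_place K" "t = K (a \<oplus>\<^bsub>A\<^esub> b)" "t1 = K a" "t2 = K b"
      using leaf_sum_place by blast
    have ab: "a \<in> carrier A" "b \<in> carrier A"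
      using leaf_place_label[OF K(1)] t K by (auto simp: contexts_def)
    have KC: "K a \<in> Ctx" if "a \<in> carrier A" for a
      using leaf_place_contexts[OF K(1) _ that] t(2) K(3) by blast
    show "?op t = ?op t1 \<oplus>\<^bsub>M.EndM\<^esub> ?op t2"
    proof (rule M.End_eqI)
      fix x assume x: "x \<in> carrier M"
      show "?op t x = (?op t1 \<oplus>\<^bsub>M.EndM\<^esub> ?op t2) x"
        using lin_mapD(2)[OF op_place_linear[OF K(1) KC x]] ab x by (simp add: M.End_apply K)
    qed (auto intro!: op_cl t End.M.a_closed)
  next
    fix r t t' assume r: "r \<in> carrier R" and t: "t \<in> Ctx" "t' \<in> Ctx" and ls: "leaf_smult A r t t'"
    obtain K a where K: "leaf_place K" "t = K (r \<odot>\<^bsub>A\<^esub> a)" "t' = K a"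
      using leaf_smult_place[OF ls] by (elim exE conjE) (rule that)
    have a: "a \<in> carrier A"
      using leaf_place_label[OF K(1)] t K by (auto simp: contexts_def)
    have KC: "K a \<in> Ctx" if "a \<in> carrier A" for a
      using leaf_place_contexts[OF K(1) _ that] t(2) K(3) by blast
    show "?op t = r \<odot>\<^bsub>M.EndM\<^esub> ?op t'"
    proof (rule M.End_eqI)
      fix x assume x: "x \<in> carrier M"
      show "?op t x = (r \<odot>\<^bsub>M.EndM\<^esub> ?op t') x"
        using lin_mapD(3)[OF op_place_linear[OF K(1) KC x]] r a x by (simp add: M.End_apply K)
    qed (auto intro!: op_cl t r End.smult_closed)
  next
    fix t t' assume t: "t \<in> Ctx" "t' \<in> Ctx" "contract \<mu> t t'"
    then show "?op t = ?op t'" using op_contract by (intro restrict_ext) blast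
  next
    fix t t' assume t: "t \<in> Ctx" "t' \<in> Ctx" "rebracket t t'"
    then show "?op t = ?op t'" using op_rebracket by (intro restrict_ext) blast
  next
    show "?op (slot_ctx [] (replicate (m - 1) \<one>\<^bsub>A\<^esub> @ [c'])) = \<one>\<^bsub>M.EndM\<^esub>"
      by (rule M.End_eqI)
        (auto simp: M.End_apply op_slot first_anchor_args anchor_first simp del: One_nat_def
          intro!: op_cl slot_ctx_contexts)
    show "?op (slot_ctx (c' # replicate (m - 1) \<one>\<^bsub>A\<^esub>) []) = \<one>\<^bsub>M.EndM\<^esub>"
      by (rule M.End_eqI)
        (auto simp: M.End_apply op_slot last_anchor_args anchor_last simp del: One_nat_def
          intro!: op_cl slot_ctx_contexts)
  qed
  then show ?thesis by (metis restrict_apply')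
qed

section \<open>Relations in the anchored envelope\<close>

context cyclic_datum
begin

lemma slot_argsI:
  "\<lbrakk>set as \<subseteq> carrier A; set bs \<subseteq> carrier A; length as + length bs = m\<rbrakk> \<Longrightarrow> slot_args A m as bs"
  by (simp add: slot_args_def)

lemma sl_closed [simp]: "slot_args A m as bs \<Longrightarrow> sl as bs \<in> carrier U"
  by (simp add: slot_ctx_contexts)

lemma sl_mult:
  assumes "slot_args A m as bs" "slot_args A m as' bs'"
  shows "sl as bs \<otimes>\<^bsub>U\<^esub> sl as' bs' = cl (Node (map Leaf as @ Node (map Leaf as' @ Hole # map Leaf bs') # map Leaf bs))"
    and "Node (map Leaf as @ Node (map Leaf as' @ Hole # map Leaf bs') # map Leaf bs) \<in> Ctx"
proof -
  have "graft (slot_ctx as bs) (slot_ctx as' bs') = Node (map Leaf as @ Node (map Leaf as' @ Hole # map Leaf bs') # map Leaf bs)"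
    by (simp add: graft_slot_ctx) (simp add: slot_ctx_def)
  then show "sl as bs \<otimes>\<^bsub>U\<^esub> sl as' bs' = cl (Node (map Leaf as @ Node (map Leaf as' @ Hole # map Leaf bs') # map Leaf bs))"
    "Node (map Leaf as @ Node (map Leaf as' @ Hole # map Leaf bs') # map Leaf bs) \<in> Ctx"
    using cl_graft[OF slot_ctx_contexts[OF assms(1)] slot_ctx_contexts[OF assms(2)]]
      graft_closed[OF slot_ctx_contexts[OF assms(1)] slot_ctx_contexts[OF assms(2)]] by auto
qed

text \<open>The product of two one-vertex contexts has two vertices, and there are three ways of
  rebracketing it: the inner vertex may be moved so that it still contains the hole, or to the left
  or to the right of the hole, and in the last two cases it can be contracted.\<close>

lemma sl_mult_swap:
  assumes "slot_args A m as bs" "slot_args A m as' bs'"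
    and eq: "as @ as' = P @ P'" "bs' @ bs = Q' @ Q" and len: "length P + length Q = m"
  shows "sl as bs \<otimes>\<^bsub>U\<^esub> sl as' bs' = sl P Q \<otimes>\<^bsub>U\<^esub> sl P' Q'"
proof -
  have "length as + length as' + (length bs' + length bs) = 2 * m"
    using assms(1,2) by (simp add: slot_args_def)
  moreover have "length as + length as' = length P + length P'" "length bs' + length bs = length Q' + length Q"
    using arg_cong[OF eq(1), of length] arg_cong[OF eq(2), of length] by simp_all
  ultimately have len': "length P' + length Q' = m" using len by simp
  have sets: "set (as @ as') \<subseteq> carrier A" "set (bs' @ bs) \<subseteq> carrier A"
    using assms(1,2) by (auto simp: slot_args_def)
  have PQ: "slot_args A m P Q" "slot_args A m P' Q'"
    using sets len len' unfolding eq by (auto simp: slot_args_def)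
  have "map Leaf as @ (map Leaf as' @ Hole # map Leaf bs') @ map Leaf bs
      = map Leaf (as @ as') @ Hole # map Leaf (bs' @ bs)"
    by simp
  also have "\<dots> = map Leaf P @ (map Leaf P' @ Hole # map Leaf Q') @ map Leaf Q"
    unfolding eq by simp
  finally have "rebracket (Node (map Leaf as @ Node (map Leaf as' @ Hole # map Leaf bs') # map Leaf bs))
      (Node (map Leaf P @ Node (map Leaf P' @ Hole # map Leaf Q') # map Leaf Q))"
    using assms(2) len' by (intro rebracket.move) (auto simp: slot_args_def)
  then show ?thesis
    using cl_rebracket sl_mult[OF assms(1,2)] sl_mult[OF PQ] by metis
qed

lemma sl_mult_contract_left:
  assumes "slot_args A m as bs" "slot_args A m as' bs'"
    and eq: "as @ as' = X @ Y" and len: "length X = Suc m"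
  shows "sl as bs \<otimes>\<^bsub>U\<^esub> sl as' bs' = sl (\<mu> X # Y) (bs' @ bs)"
proof -
  let ?t = "Node (map Leaf as @ Node (map Leaf as' @ Hole # map Leaf bs') # map Leaf bs)"
  let ?t' = "Node ([] @ Node (map Leaf X) # (map Leaf Y @ Hole # map Leaf (bs' @ bs)))"
  have l: "length as + length as' + (length bs' + length bs) = 2 * m"
    using assms(1,2) by (simp add: slot_args_def)
  have l': "length as + length as' = Suc m + length Y"
    using arg_cong[OF eq, of length] len by simp
  have s: "set (as @ as') \<subseteq> carrier A" "set (bs' @ bs) \<subseteq> carrier A"
    using assms(1,2) by (auto simp: slot_args_def)
  have sX: "set X \<subseteq> carrier A" "set Y \<subseteq> carrier A"
    using s(1) unfolding eq by auto
  note \<mu>X = nary_mult_closed[OF sX(1) len]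
  have args: "slot_args A m (\<mu> X # Y) (bs' @ bs)"
    using sX s l l' \<mu>X by (intro slot_argsI) auto
  have "map Leaf as @ (map Leaf as' @ Hole # map Leaf bs') @ map Leaf bs
      = map Leaf (as @ as') @ Hole # map Leaf (bs' @ bs)"
    by simp
  also have "\<dots> = [] @ map Leaf X @ (map Leaf Y @ Hole # map Leaf (bs' @ bs))"
    unfolding eq by simp
  finally have r: "rebracket ?t ?t'"
    using assms(2) len by (intro rebracket.move) (auto simp: slot_args_def)
  have k: "contract \<mu> ?t' (slot_ctx (\<mu> X # Y) (bs' @ bs))"
    using contract.inside[OF contract.vertex[of \<mu> X], of "[]"] by (simp add: slot_ctx_def)
  have "?t' \<in> Ctx"
    using sX s l l' len by (auto simp: contexts_def comp_def)
  then show ?thesis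
    using cl_rebracket[OF sl_mult(2)[OF assms(1,2)] _ r] cl_contract[OF _ slot_ctx_contexts[OF args] k]
      sl_mult(1)[OF assms(1,2)] by simp
qed

lemma sl_mult_contract_right:
  assumes "slot_args A m as bs" "slot_args A m as' bs'"
    and eq: "bs' @ bs = Y @ X" and len: "length X = Suc m"
  shows "sl as bs \<otimes>\<^bsub>U\<^esub> sl as' bs' = sl (as @ as') (Y @ [\<mu> X])"
proof -
  let ?t = "Node (map Leaf as @ Node (map Leaf as' @ Hole # map Leaf bs') # map Leaf bs)"
  let ?t' = "Node ((map Leaf (as @ as') @ Hole # map Leaf Y) @ Node (map Leaf X) # [])"
  have l: "length as + length as' + (length bs' + length bs) = 2 * m"
    using assms(1,2) by (simp add: slot_args_def)
  have l': "length bs' + length bs = Suc m + length Y"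
    using arg_cong[OF eq, of length] len by simp
  have s: "set (as @ as') \<subseteq> carrier A" "set (bs' @ bs) \<subseteq> carrier A"
    using assms(1,2) by (auto simp: slot_args_def)
  have sX: "set X \<subseteq> carrier A" "set Y \<subseteq> carrier A"
    using s(2) unfolding eq by auto
  note \<mu>X = nary_mult_closed[OF sX(1) len]
  have args: "slot_args A m (as @ as') (Y @ [\<mu> X])"
    using sX s l l' \<mu>X by (intro slot_argsI) auto
  have "map Leaf as @ (map Leaf as' @ Hole # map Leaf bs') @ map Leaf bs
      = map Leaf (as @ as') @ Hole # map Leaf (bs' @ bs)"
    by simp
  also have "\<dots> = (map Leaf (as @ as') @ Hole # map Leaf Y) @ map Leaf X @ []"
    unfolding eq by simp
  finally have r: "rebracket ?t ?t'"
    using assms(2) len by (intro rebracket.move) (auto simp: slot_args_def)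
  have k: "contract \<mu> ?t' (slot_ctx (as @ as') (Y @ [\<mu> X]))"
    using contract.inside[OF contract.vertex[of \<mu> X], of "map Leaf (as @ as') @ Hole # map Leaf Y" "[]"]
    by (simp add: slot_ctx_def)
  have "?t' \<in> Ctx"
    using sX s l l' len by (auto simp: contexts_def comp_def)
  then show ?thesis
    using cl_rebracket[OF sl_mult(2)[OF assms(1,2)] _ r] cl_contract[OF _ slot_ctx_contexts[OF args] k]
      sl_mult(1)[OF assms(1,2)] by simp
qed

abbreviation ones where "ones k \<equiv> replicate k \<one>\<^bsub>A\<^esub>"

lemma nary_mult_ends:
  "\<lbrakk>x \<in> carrier A; y \<in> carrier A\<rbrakk> \<Longrightarrow> \<mu> (x # ones k @ [y]) = x \<otimes>\<^bsub>A\<^esub> c \<otimes>\<^bsub>A\<^esub> y"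
  by (simp add: nary_mult_def butlast_append twisted_prod_Cons)

lemma nary_mult_ends2:
  "\<lbrakk>x \<in> carrier A; y \<in> carrier A; w \<in> carrier A\<rbrakk>
    \<Longrightarrow> \<mu> (x # y # ones k @ [w]) = x \<otimes>\<^bsub>A\<^esub> \<sigma> y \<otimes>\<^bsub>A\<^esub> c \<otimes>\<^bsub>A\<^esub> w"
  by (simp add: nary_mult_def butlast_append twisted_prod_Cons)

text \<open>Under the isomorphism to be constructed, these three families correspond to \<open>a \<otimes> 1\<close>, \<open>1 \<otimes> b\<close> and
  \<open>u\<close>: in a bimodule with twisting operator \<open>S\<close> the three slot operations are
  \<open>x \<mapsto> a c\<inverse> S\<^sup>m(x) c = a x\<close>, \<open>x \<mapsto> x \<sigma>\<^sup>m(c\<inverse> b) c = x b\<close> and \<open>x \<mapsto> S(x) \<sigma>\<^sup>m(c\<inverse>) c = S(x)\<close>. The lemmas below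
  verify the relations of the crossed product for them.\<close>

definition left_gen where "left_gen a = sl (a \<otimes>\<^bsub>A\<^esub> c' # ones (m - 1)) []"
definition right_gen where "right_gen b = sl [] (ones (m - 1) @ [c' \<otimes>\<^bsub>A\<^esub> b])"
definition twist_gen where "twist_gen = sl [\<one>\<^bsub>A\<^esub>] (ones (m - 2) @ [c'])"

lemma left_gen_args: "a \<in> carrier A \<Longrightarrow> slot_args A m (a \<otimes>\<^bsub>A\<^esub> c' # ones (m - 1)) []"
  by (rule last_anchor_args) simp

lemma right_gen_args: "b \<in> carrier A \<Longrightarrow> slot_args A m [] (ones (m - 1) @ [c' \<otimes>\<^bsub>A\<^esub> b])"
  by (rule first_anchor_args) simp

lemma twist_gen_args: "slot_args A m [\<one>\<^bsub>A\<^esub>] (ones (m - 2) @ [c'])"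
  using m_ge_2 by (intro slot_argsI) auto

lemma U_gens_closed [simp]:
  "a \<in> carrier A \<Longrightarrow> left_gen a \<in> carrier U" "a \<in> carrier A \<Longrightarrow> right_gen a \<in> carrier U" "twist_gen \<in> carrier U"
  by (simp_all only: left_gen_def right_gen_def twist_gen_def sl_closed[OF left_gen_args] sl_closed[OF right_gen_args] sl_closed[OF twist_gen_args])

lemma U_gens_one: "left_gen \<one>\<^bsub>A\<^esub> = \<one>\<^bsub>U\<^esub>" "right_gen \<one>\<^bsub>A\<^esub> = \<one>\<^bsub>U\<^esub>"
  using cl_anchors by (simp_all add: left_gen_def right_gen_def)

lemma left_gen_mult_sl:
  assumes "slot_args A m (x # as) bs" "a \<in> carrier A"
  shows "left_gen a \<otimes>\<^bsub>U\<^esub> sl (x # as) bs = sl (a \<otimes>\<^bsub>A\<^esub> x # as) bs"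
proof -
  have x: "x \<in> carrier A" using assms(1) by (simp add: slot_args_def)
  have "left_gen a \<otimes>\<^bsub>U\<^esub> sl (x # as) bs = sl (\<mu> (a \<otimes>\<^bsub>A\<^esub> c' # ones (m - 1) @ [x]) # as) (bs @ [])"
    unfolding left_gen_def
    by (rule sl_mult_contract_left[OF left_gen_args[OF assms(2)] assms(1)]) (use m_ge_2 in simp_all)
  then show ?thesis using assms(2) x by (simp add: nary_mult_ends A.m_assoc)
qed

lemma right_gen_mult_sl:
  assumes "slot_args A m as (bs @ [y])" "b \<in> carrier A"
  shows "right_gen b \<otimes>\<^bsub>U\<^esub> sl as (bs @ [y]) = sl as (bs @ [y \<otimes>\<^bsub>A\<^esub> b])"
proof -
  have y: "y \<in> carrier A" using assms(1) by (simp add: slot_args_def)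
  have "right_gen b \<otimes>\<^bsub>U\<^esub> sl as (bs @ [y]) = sl ([] @ as) (bs @ [\<mu> (y # ones (m - 1) @ [c' \<otimes>\<^bsub>A\<^esub> b])])"
    unfolding right_gen_def
    by (rule sl_mult_contract_right[OF right_gen_args[OF assms(2)] assms(1)]) (use m_ge_2 in simp_all)
  then show ?thesis using assms(2) y by (simp add: nary_mult_ends A.m_assoc)
qed

lemma left_gen_mult: "\<lbrakk>a \<in> carrier A; b \<in> carrier A\<rbrakk> \<Longrightarrow> left_gen (a \<otimes>\<^bsub>A\<^esub> b) = left_gen a \<otimes>\<^bsub>U\<^esub> left_gen b"
  using left_gen_mult_sl[OF left_gen_args] by (simp add: left_gen_def[of b] left_gen_def[of "a \<otimes>\<^bsub>A\<^esub> b"] A.m_assoc)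

lemma right_gen_mult: "\<lbrakk>a \<in> carrier A; b \<in> carrier A\<rbrakk> \<Longrightarrow> right_gen (a \<otimes>\<^bsub>A\<^esub> b) = right_gen b \<otimes>\<^bsub>U\<^esub> right_gen a"
  using right_gen_mult_sl[OF right_gen_args] by (simp add: right_gen_def[of a] right_gen_def[of "a \<otimes>\<^bsub>A\<^esub> b"] A.m_assoc)

text \<open>Both products are bracketings of the word \<open>a c\<inverse>, 1, \<dots>, 1, \<star>, 1, \<dots>, 1, c\<inverse> b\<close>.\<close>

lemma left_gen_right_gen_commute: "\<lbrakk>a \<in> carrier A; b \<in> carrier A\<rbrakk> \<Longrightarrow> right_gen b \<otimes>\<^bsub>U\<^esub> left_gen a = left_gen a \<otimes>\<^bsub>U\<^esub> right_gen b"
  unfolding left_gen_def right_gen_def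
  by (rule sl_mult_swap[OF right_gen_args left_gen_args]) (use m_ge_2 in auto)

lemma twist_gen_left_gen:
  assumes a: "a \<in> carrier A"
  shows "twist_gen \<otimes>\<^bsub>U\<^esub> left_gen a = left_gen (\<sigma> a) \<otimes>\<^bsub>U\<^esub> twist_gen"
proof -
  have "ones (m - 2) @ [\<one>\<^bsub>A\<^esub>] = ones (m - 1)"
    using m_ge_2 replicate_append_same[of "m - 2" "\<one>\<^bsub>A\<^esub>"] by (simp add: numeral_2_eq_2 Suc_diff_Suc flip: replicate_Suc)
  then have "twist_gen \<otimes>\<^bsub>U\<^esub> left_gen a = sl (\<mu> (\<one>\<^bsub>A\<^esub> # a \<otimes>\<^bsub>A\<^esub> c' # ones (m - 2) @ [\<one>\<^bsub>A\<^esub>]) # []) ([] @ ones (m - 2) @ [c'])"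
    unfolding left_gen_def twist_gen_def
    by (intro sl_mult_contract_left[OF twist_gen_args left_gen_args[OF a]]) (use m_ge_2 in auto)
  also have "\<dots> = sl [\<sigma> a \<otimes>\<^bsub>A\<^esub> \<one>\<^bsub>A\<^esub>] (ones (m - 2) @ [c'])"
    using a by (simp add: nary_mult_ends2 alg_homD(2)[OF \<sigma>_hom] \<sigma>_c_inv A.m_assoc)
  also have "\<dots> = left_gen (\<sigma> a) \<otimes>\<^bsub>U\<^esub> twist_gen"
    unfolding twist_gen_def by (rule left_gen_mult_sl[OF twist_gen_args, symmetric]) (use a in simp)
  finally show ?thesis .
qed

lemma twist_gen_right_gen:
  assumes b: "b \<in> carrier A"
  shows "twist_gen \<otimes>\<^bsub>U\<^esub> right_gen b = right_gen (\<sigma> b) \<otimes>\<^bsub>U\<^esub> twist_gen"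
proof -
  have 1: "ones (m - 1) = ones (m - 2) @ [\<one>\<^bsub>A\<^esub>]"
    using m_ge_2 replicate_append_same[of "m - 2" "\<one>\<^bsub>A\<^esub>"] by (simp add: numeral_2_eq_2 Suc_diff_Suc flip: replicate_Suc)
  have "twist_gen \<otimes>\<^bsub>U\<^esub> right_gen b = sl ([\<one>\<^bsub>A\<^esub>] @ []) (ones (m - 2) @ [\<mu> (\<one>\<^bsub>A\<^esub> # c' \<otimes>\<^bsub>A\<^esub> b # ones (m - 2) @ [c'])])"
    unfolding right_gen_def twist_gen_def
    by (rule sl_mult_contract_right[OF twist_gen_args right_gen_args[OF b]]) (use m_ge_2 1 in auto)
  also have "\<dots> = sl [\<one>\<^bsub>A\<^esub>] (ones (m - 2) @ [c' \<otimes>\<^bsub>A\<^esub> \<sigma> b])"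
    using b by (simp add: nary_mult_ends2 alg_homD(2)[OF \<sigma>_hom] \<sigma>_c_inv A.m_assoc)
  also have "\<dots> = right_gen (\<sigma> b) \<otimes>\<^bsub>U\<^esub> twist_gen"
    unfolding twist_gen_def by (rule right_gen_mult_sl[OF twist_gen_args, symmetric]) (use b in simp)
  finally show ?thesis .
qed

lemma twist_gen_pow: "i < m \<Longrightarrow> twist_gen [^]\<^bsub>U\<^esub> i = sl (ones i) (ones (m - 1 - i) @ [c'])"
proof (induction i)
  case 0
  then show ?case using cl_anchors by simp
next
  case (Suc i)
  have args: "slot_args A m (ones i) (ones (m - 1 - i) @ [c'])"
    using Suc.prems by (intro slot_argsI) auto
  have 1: "ones (m - 1 - i) = ones (m - 1 - Suc i) @ [\<one>\<^bsub>A\<^esub>]"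
    using Suc.prems replicate_append_same[of "m - 1 - Suc i" "\<one>\<^bsub>A\<^esub>"]
    by (simp add: Suc_diff_Suc flip: replicate_Suc)
  have "twist_gen \<otimes>\<^bsub>U\<^esub> sl (ones i) (ones (m - 1 - i) @ [c'])
      = sl ([\<one>\<^bsub>A\<^esub>] @ ones i) (ones (m - 1 - Suc i) @ [\<mu> (\<one>\<^bsub>A\<^esub> # c' # ones (m - 2) @ [c'])])"
    unfolding twist_gen_def
    by (rule sl_mult_contract_right[OF twist_gen_args args]) (use m_ge_2 1 in auto)
  also have "\<dots> = sl (ones (Suc i)) (ones (m - 1 - Suc i) @ [c'])"
    by (simp add: nary_mult_ends2 \<sigma>_c_inv A.m_assoc)
  finally show ?case
    using Suc U.A.nat_pow_Suc2[of twist_gen i] by simp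
qed

text \<open>Multiplying a one-vertex context by an anchor, which is the unit, and then contracting the block
  consisting of all labels on one side of the hole and of part of the anchor, concentrates these labels
  in a single one and leaves units in the other places.\<close>

lemma sl_normal_left:
  assumes args: "slot_args A m as bs" and as: "as \<noteq> []"
  shows "\<exists>a \<in> carrier A. sl as bs = sl (a # ones (length as - 1)) bs"
proof -
  have len: "length as \<le> m" and s: "set as \<subseteq> carrier A" using args by (auto simp: slot_args_def)
  let ?X = "as @ c' # ones (m - length as)"
  have X: "set ?X \<subseteq> carrier A" "length ?X = Suc m" using s len by auto
  have "m - 1 = (m - length as) + (length as - 1)"
    using as len by (cases as) auto
  then have "ones (m - 1) = ones (m - length as) @ ones (length as - 1)"
    by (simp only: replicate_add)
  then have "sl as bs \<otimes>\<^bsub>U\<^esub> sl (c' # ones (m - 1)) [] = sl (\<mu> ?X # ones (length as - 1)) ([] @ bs)"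
    by (intro sl_mult_contract_left[OF args last_anchor_args]) (use X in simp_all)
  then have "sl as bs = sl (\<mu> ?X # ones (length as - 1)) bs"
    using args by (simp only: cl_anchors U.A.r_one sl_closed append_Nil)
  then show ?thesis using nary_mult_closed[OF X] by blast
qed

lemma sl_normal_right:
  assumes args: "slot_args A m as bs" and bs: "bs \<noteq> []"
  shows "sl as bs = sl as (ones (length bs - 1) @ [\<mu> (ones (m - length bs) @ c' # bs)])"
    and "\<mu> (ones (m - length bs) @ c' # bs) \<in> carrier A"
proof -
  have len: "length bs \<le> m" and s: "set bs \<subseteq> carrier A" using args by (auto simp: slot_args_def)
  let ?X = "ones (m - length bs) @ c' # bs"
  have X: "set ?X \<subseteq> carrier A" "length ?X = Suc m" using s len by auto
  have "m - 1 = (length bs - 1) + (m - length bs)"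
    using bs len by (cases bs) auto
  then have "ones (m - 1) = ones (length bs - 1) @ ones (m - length bs)"
    by (simp only: replicate_add)
  then have "sl as bs \<otimes>\<^bsub>U\<^esub> sl [] (ones (m - 1) @ [c']) = sl (as @ []) (ones (length bs - 1) @ [\<mu> ?X])"
    by (intro sl_mult_contract_right[OF args first_anchor_args]) (use X in simp_all)
  then show "sl as bs = sl as (ones (length bs - 1) @ [\<mu> ?X])"
    using args by (simp only: cl_anchors U.A.r_one sl_closed append_Nil2)
  show "\<mu> ?X \<in> carrier A" by (rule nary_mult_closed[OF X])
qed

text \<open>Up to the power \<open>m - 1\<close>, products of the twisting element contract to one-vertex contexts. In the
  last step there are \<open>m\<close> labels on either side of the hole, so no block of \<open>m + 1\<close> labels can be
  contracted; instead the inner vertex is moved to the left end of the word, which separates the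
  labels left and right of the hole.\<close>

lemma twist_gen_pow_m: "twist_gen [^]\<^bsub>U\<^esub> m = left_gen c \<otimes>\<^bsub>U\<^esub> right_gen c'"
proof -
  have m: "Suc (m - 1) = m" "m - 1 < m" using m_ge_2 by auto
  have args: "slot_args A m (ones (m - 1)) [c']"
    using m_ge_2 by (intro slot_argsI) auto
  have ones_m: "\<one>\<^bsub>A\<^esub> # ones (m - 1) = ones m" using m by (metis replicate_Suc)
  let ?bs = "c' # ones (m - 2) @ [c']"
  have bs: "slot_args A m [] ?bs" using m_ge_2 by (intro slot_argsI) auto
  have "twist_gen [^]\<^bsub>U\<^esub> m = twist_gen \<otimes>\<^bsub>U\<^esub> sl (ones (m - 1)) [c']"
    using U.A.nat_pow_Suc2[of twist_gen "m - 1"] twist_gen_pow[OF m(2)] m(1) by simp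
  also have "\<dots> = sl [] ?bs \<otimes>\<^bsub>U\<^esub> sl (ones m) []"
    unfolding twist_gen_def by (rule sl_mult_swap[OF twist_gen_args args]) (use m_ge_2 ones_m in auto)
  also have "sl (ones m) [] = left_gen c"
    using ones_m by (simp add: left_gen_def)
  also have "sl [] ?bs = right_gen c'"
  proof -
    have "length ?bs = m" using m_ge_2 by simp
    then have "sl [] ?bs = sl [] (ones (m - 1) @ [\<mu> (c' # ?bs)])"
      using sl_normal_right(1)[OF bs] by simp
    also have "\<mu> (c' # ?bs) = c' \<otimes>\<^bsub>A\<^esub> c'"
      by (simp add: nary_mult_ends2 \<sigma>_c_inv A.m_assoc)
    finally show ?thesis by (simp add: right_gen_def)
  qed
  finally show ?thesis by (simp add: left_gen_right_gen_commute)
qed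

text \<open>Concentrate the labels on each side of the hole in one label, which becomes the first or the last
  label of the context. These two are then split off as factors, which leaves a power of the
  twisting element.\<close>

lemma sl_generated:
  assumes args: "slot_args A m as bs"
  shows "\<exists>a \<in> carrier A. \<exists>b \<in> carrier A. \<exists>i < m. sl as bs = left_gen a \<otimes>\<^bsub>U\<^esub> right_gen b \<otimes>\<^bsub>U\<^esub> twist_gen [^]\<^bsub>U\<^esub> i"
proof (cases "bs = []")
  case True
  then have "length as = m" "as \<noteq> []" using args m_ge_2 by (auto simp: slot_args_def)
  then obtain x where x: "x \<in> carrier A" "sl as bs = sl (x # ones (m - 1)) []"
    using sl_normal_left[OF args] True by auto
  then have "sl as bs = left_gen (x \<otimes>\<^bsub>A\<^esub> c)" by (simp add: left_gen_def A.m_assoc)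
  then show ?thesis
    using x m_ge_2 by (intro bexI[of _ "x \<otimes>\<^bsub>A\<^esub> c"] bexI[of _ "\<one>\<^bsub>A\<^esub>"] exI[of _ 0]) (auto simp: U_gens_one)
next
  case False
  let ?i = "length as" and ?y = "\<mu> (ones (m - length bs) @ c' # bs)"
  have i: "?i + length bs = m" using args by (simp add: slot_args_def)
  then have l: "length bs - 1 = m - 1 - ?i" "?i < m" using False by (auto simp: Suc_le_eq)
  have y: "?y \<in> carrier A" by (rule sl_normal_right[OF args False])
  have s: "set as \<subseteq> carrier A" using args by (simp add: slot_args_def)
  have eq1: "sl as bs = sl as (ones (m - 1 - ?i) @ [?y])"
    using sl_normal_right(1)[OF args False] unfolding l(1) .
  have eq2: "sl (ones ?i) (ones (m - 1 - ?i) @ [?y]) = right_gen (c \<otimes>\<^bsub>A\<^esub> ?y) \<otimes>\<^bsub>U\<^esub> twist_gen [^]\<^bsub>U\<^esub> ?i"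
  proof -
    have "slot_args A m (ones ?i) (ones (m - 1 - ?i) @ [c'])"
      using l by (intro slot_argsI) auto
    from right_gen_mult_sl[OF this, of "c \<otimes>\<^bsub>A\<^esub> ?y"] show ?thesis
      using y by (simp add: twist_gen_pow[OF l(2)])
  qed
  show ?thesis
  proof (cases "as = []")
    case True
    then have *: "sl as bs = left_gen \<one>\<^bsub>A\<^esub> \<otimes>\<^bsub>U\<^esub> right_gen (c \<otimes>\<^bsub>A\<^esub> ?y) \<otimes>\<^bsub>U\<^esub> twist_gen [^]\<^bsub>U\<^esub> ?i"
      using eq1 eq2 y by (simp add: U_gens_one)
    show ?thesis
      by (rule bexI, rule bexI, rule exI, rule conjI, rule l(2), rule *) (simp_all add: y)
  next
    case False
    have "slot_args A m as (ones (m - 1 - ?i) @ [?y])"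
      using y l s by (intro slot_argsI) auto
    then obtain x where x: "x \<in> carrier A"
      "sl as (ones (m - 1 - ?i) @ [?y]) = sl (x # ones (?i - 1)) (ones (m - 1 - ?i) @ [?y])"
      using sl_normal_left False by blast
    have o: "\<one>\<^bsub>A\<^esub> # ones (?i - 1) = ones ?i"
      using False by (cases as) auto
    have "slot_args A m (\<one>\<^bsub>A\<^esub> # ones (?i - 1)) (ones (m - 1 - ?i) @ [?y])"
      unfolding o using y l by (intro slot_argsI) auto
    from left_gen_mult_sl[OF this x(1), unfolded o A.r_one[OF x(1)], symmetric]
    have "sl as bs = left_gen x \<otimes>\<^bsub>U\<^esub> (right_gen (c \<otimes>\<^bsub>A\<^esub> ?y) \<otimes>\<^bsub>U\<^esub> twist_gen [^]\<^bsub>U\<^esub> ?i)"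
      unfolding eq1 x(2) eq2 .
    also have "\<dots> = left_gen x \<otimes>\<^bsub>U\<^esub> right_gen (c \<otimes>\<^bsub>A\<^esub> ?y) \<otimes>\<^bsub>U\<^esub> twist_gen [^]\<^bsub>U\<^esub> ?i"
      using x y by (simp add: U.A.m_assoc)
    finally have *: "sl as bs = left_gen x \<otimes>\<^bsub>U\<^esub> right_gen (c \<otimes>\<^bsub>A\<^esub> ?y) \<otimes>\<^bsub>U\<^esub> twist_gen [^]\<^bsub>U\<^esub> ?i" .
    show ?thesis
      by (rule bexI, rule bexI, rule exI, rule conjI, rule l(2), rule *) (simp_all add: x y)
  qed
qed

lemma cl_place_linear:
  assumes "leaf_place K" "\<And>a. a \<in> carrier A \<Longrightarrow> K a \<in> Ctx"
  shows "(\<lambda>a. cl (K a)) \<in> lin_map R A U"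
  by (rule lin_mapI)
    (use assms cl_sum[OF _ _ _ place_leaf_sum[OF assms(1)]] cl_smult[OF _ _ _ place_leaf_smult[OF assms(1)]] in auto)

lemma left_gen_linear: "left_gen \<in> lin_map R A U"
proof -
  have "(\<lambda>a. cl (Node ([] @ Leaf a # (map Leaf (ones (m - 1)) @ [Hole])))) \<in> lin_map R A U"
    by (rule cl_place_linear[OF leaf_place.inside[OF leaf_place.leaf]])
      (use slot_ctx_contexts[OF last_anchor_args] in \<open>simp add: slot_ctx_def\<close>)
  from lin_map_comp[OF mult_right_linear[OF c_closed(2)] this] show ?thesis
    by (simp add: left_gen_def[abs_def] slot_ctx_def)
qed

lemma right_gen_linear: "right_gen \<in> lin_map R A U"
proof -
  have "(\<lambda>a. cl (Node ((Hole # map Leaf (ones (m - 1))) @ Leaf a # []))) \<in> lin_map R A U"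
    by (rule cl_place_linear[OF leaf_place.inside[OF leaf_place.leaf]])
      (use slot_ctx_contexts[OF first_anchor_args] in \<open>simp add: slot_ctx_def\<close>)
  from lin_map_comp[OF mult_left_linear[OF c_closed(2)] this] show ?thesis
    by (simp add: right_gen_def[abs_def] slot_ctx_def)
qed

lemma E_to_U: "\<exists>\<phi> \<in> alg_hom R E U. \<forall>a \<in> carrier A. \<forall>b \<in> carrier A. \<phi> (tens a b) = left_gen a \<otimes>\<^bsub>U\<^esub> right_gen b"
proof -
  have "\<exists>\<phi> \<in> alg_hom R env.T U. \<forall>a \<in> carrier A. \<forall>b \<in> carrier (opp_alg A). \<phi> (env.pure a b) = left_gen a \<otimes>\<^bsub>U\<^esub> right_gen b"
  proof (rule env.T_lift[OF U_algebra])
    fix b assume "b \<in> carrier (opp_alg A)"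
    then show "(\<lambda>a. left_gen a \<otimes>\<^bsub>U\<^esub> right_gen b) \<in> lin_map R A U"
      by (intro lin_map_comp[OF left_gen_linear U.mult_right_linear]) simp
  next
    fix a assume a: "a \<in> carrier A"
    have "(\<lambda>b. left_gen a \<otimes>\<^bsub>U\<^esub> right_gen b) \<in> lin_map R A U"
      by (rule lin_map_comp[OF right_gen_linear U.mult_left_linear]) (use a in simp)
    then show "(\<lambda>b. left_gen a \<otimes>\<^bsub>U\<^esub> right_gen b) \<in> lin_map R (opp_alg A) U"
      by (simp add: lin_map_def)
  next
    fix a a' b b' assume ab: "a \<in> carrier A" "a' \<in> carrier A" "b \<in> carrier (opp_alg A)" "b' \<in> carrier (opp_alg A)"
    then have "left_gen (a \<otimes>\<^bsub>A\<^esub> a') \<otimes>\<^bsub>U\<^esub> right_gen (b' \<otimes>\<^bsub>A\<^esub> b) = left_gen a \<otimes>\<^bsub>U\<^esub> (left_gen a' \<otimes>\<^bsub>U\<^esub> right_gen b) \<otimes>\<^bsub>U\<^esub> right_gen b'"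
      by (simp add: left_gen_mult right_gen_mult U.A.m_assoc)
    also have "left_gen a' \<otimes>\<^bsub>U\<^esub> right_gen b = right_gen b \<otimes>\<^bsub>U\<^esub> left_gen a'"
      using ab by (simp only: left_gen_right_gen_commute opp_alg_simps)
    also have "left_gen a \<otimes>\<^bsub>U\<^esub> (right_gen b \<otimes>\<^bsub>U\<^esub> left_gen a') \<otimes>\<^bsub>U\<^esub> right_gen b' = left_gen a \<otimes>\<^bsub>U\<^esub> right_gen b \<otimes>\<^bsub>U\<^esub> (left_gen a' \<otimes>\<^bsub>U\<^esub> right_gen b')"
      using ab by (simp add: U.A.m_assoc)
    finally show "left_gen (a \<otimes>\<^bsub>A\<^esub> a') \<otimes>\<^bsub>U\<^esub> right_gen (b \<otimes>\<^bsub>opp_alg A\<^esub> b')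
        = left_gen a \<otimes>\<^bsub>U\<^esub> right_gen b \<otimes>\<^bsub>U\<^esub> (left_gen a' \<otimes>\<^bsub>U\<^esub> right_gen b')"
      by simp
  qed (auto simp: U_gens_one)
  then show ?thesis by (simp add: env_alg_def)
qed

lemma C_to_U:
  "\<exists>\<psi> \<in> alg_hom R C U.
    (\<forall>a \<in> carrier A. \<forall>b \<in> carrier A. \<forall>r < m. \<psi> (monom (tens a b) r) = left_gen a \<otimes>\<^bsub>U\<^esub> right_gen b \<otimes>\<^bsub>U\<^esub> twist_gen [^]\<^bsub>U\<^esub> r)"
proof -
  obtain \<phi> where \<phi>: "\<phi> \<in> alg_hom R E U"
    and \<phi>t: "\<And>a b. \<lbrakk>a \<in> carrier A; b \<in> carrier A\<rbrakk> \<Longrightarrow> \<phi> (tens a b) = left_gen a \<otimes>\<^bsub>U\<^esub> right_gen b"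
    using E_to_U by blast
  have comm: "twist_gen \<otimes>\<^bsub>U\<^esub> \<phi> x = \<phi> (\<sigma>e x) \<otimes>\<^bsub>U\<^esub> twist_gen" if x: "x \<in> carrier E" for x
  proof (rule lin_map_eq_on_span[OF E.module_axioms U.module_axioms tensors_subset
        lin_map_comp[OF alg_hom_lin_map[OF \<phi>] U.mult_left_linear]
        lin_map_comp[OF alg_hom_lin_map[OF alg_hom_comp[OF \<sigma>e_hom \<phi>]] U.mult_right_linear]])
    fix s assume "s \<in> tensors"
    then obtain a b where s: "s = tens a b" and ab: "a \<in> carrier A" "b \<in> carrier A" by blast
    have "twist_gen \<otimes>\<^bsub>U\<^esub> (left_gen a \<otimes>\<^bsub>U\<^esub> right_gen b) = left_gen (\<sigma> a) \<otimes>\<^bsub>U\<^esub> (twist_gen \<otimes>\<^bsub>U\<^esub> right_gen b)"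
      using ab by (simp add: U.A.m_assoc[symmetric] twist_gen_left_gen)
    also have "\<dots> = left_gen (\<sigma> a) \<otimes>\<^bsub>U\<^esub> right_gen (\<sigma> b) \<otimes>\<^bsub>U\<^esub> twist_gen"
      using ab by (simp add: twist_gen_right_gen U.A.m_assoc)
    finally show "twist_gen \<otimes>\<^bsub>U\<^esub> \<phi> s = \<phi> (\<sigma>e s) \<otimes>\<^bsub>U\<^esub> twist_gen"
      using ab by (simp add: s \<phi>t \<sigma>e_tens)
  qed (use x E_span in auto)
  have "twist_gen [^]\<^bsub>U\<^esub> m = \<phi> z"
    by (simp add: \<phi>t twist_gen_pow_m)
  with C_lift[OF U_algebra \<phi> U_gens_closed(3) comm] obtain \<psi> where \<psi>: "\<psi> \<in> alg_hom R C U"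
    and \<psi>m: "\<forall>x \<in> carrier E. \<forall>r < m. \<psi> (monom x r) = \<phi> x \<otimes>\<^bsub>U\<^esub> twist_gen [^]\<^bsub>U\<^esub> r"
    by metis
  show ?thesis
    by (rule bexI[OF _ \<psi>]) (simp add: \<psi>m \<phi>t)
qed

section \<open>The isomorphism\<close>

abbreviation C_act where "C_act \<equiv> \<lambda>e x. monom e 0 \<otimes>\<^bsub>C\<^esub> x"
abbreviation C_S where "C_S \<equiv> \<lambda>x. u \<otimes>\<^bsub>C\<^esub> x"

lemma u_pow_mult: "x \<in> carrier C \<Longrightarrow> (C_S ^^ k) x = u [^]\<^bsub>C\<^esub> k \<otimes>\<^bsub>C\<^esub> x"
proof (induction k)
  case (Suc k)
  then have "(C_S ^^ Suc k) x = u \<otimes>\<^bsub>C\<^esub> u [^]\<^bsub>C\<^esub> k \<otimes>\<^bsub>C\<^esub> x"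
    by (simp add: C.A.m_assoc)
  then show ?case by (simp only: C.A.nat_pow_Suc2[OF u_closed])
qed simp

text \<open>The power \<open>u\<^sup>m\<close> is the invertible element \<open>z\<close> of the enveloping algebra.\<close>

lemma u_Units: "u \<in> Units C"
proof -
  note M = alg_homD[OF monom0_hom]
  let ?w = "u [^]\<^bsub>C\<^esub> (m - 1)" and ?z = "monom (tens c' c) 0"
  have m: "Suc (m - 1) = m" using m_ge_2 by simp
  have zz: "monom z 0 \<otimes>\<^bsub>C\<^esub> ?z = \<one>\<^bsub>C\<^esub>" "?z \<otimes>\<^bsub>C\<^esub> monom z 0 = \<one>\<^bsub>C\<^esub>"
    using M(2)[of z "tens c' c"] M(2)[of "tens c' c" z] by (simp_all add: z_inv M(5))
  have wu: "u \<otimes>\<^bsub>C\<^esub> ?w = monom z 0" "?w \<otimes>\<^bsub>C\<^esub> u = monom z 0"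
    using C.A.nat_pow_Suc2[of u "m - 1"] C.A.nat_pow_Suc[of u "m - 1"] u_pow_m m by simp_all
  have r: "u \<otimes>\<^bsub>C\<^esub> (?w \<otimes>\<^bsub>C\<^esub> ?z) = \<one>\<^bsub>C\<^esub>"
    using C.A.m_assoc[of u ?w ?z] unfolding wu zz by simp
  have l: "?z \<otimes>\<^bsub>C\<^esub> ?w \<otimes>\<^bsub>C\<^esub> u = \<one>\<^bsub>C\<^esub>"
    using C.A.m_assoc[of ?z ?w u] unfolding wu zz by simp
  have "?z \<otimes>\<^bsub>C\<^esub> ?w = ?w \<otimes>\<^bsub>C\<^esub> ?z"
    by (rule C.A.inv_unique[OF l r]) simp_all
  then show ?thesis
    using l r unfolding Units_def by (intro CollectI conjI bexI[of _ "?w \<otimes>\<^bsub>C\<^esub> ?z"]) simp_all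
qed

lemma C_twisted_bimodule: "twisted_bimodule R m A \<sigma> c C C_act C_S"
proof -
  note M = alg_homD[OF monom0_hom]
  let ?v = "inv\<^bsub>C\<^esub> u"
  have v: "?v \<in> carrier C" using u_Units by (rule C.A.Units_inv_closed)
  have uv: "u \<otimes>\<^bsub>C\<^esub> (?v \<otimes>\<^bsub>C\<^esub> x) = x" "?v \<otimes>\<^bsub>C\<^esub> (u \<otimes>\<^bsub>C\<^esub> x) = x" if "x \<in> carrier C" for x
    using C.A.m_assoc[of u ?v x] C.A.m_assoc[of ?v u x] that v
      C.A.Units_r_inv[OF u_Units] C.A.Units_l_inv[OF u_Units] by simp_all
  have bij: "bij_betw C_S (carrier C) (carrier C)"
    by (rule bij_betwI[where g = "\<lambda>x. ?v \<otimes>\<^bsub>C\<^esub> x"]) (use v uv in auto)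
  show ?thesis
  proof (intro twisted_bimodule.intro twisted_bimodule_axioms.intro alg_module.intro alg_module_axioms.intro)
    fix a b x assume ab: "a \<in> carrier A" "b \<in> carrier A" and x: "x \<in> carrier C"
    have "u \<otimes>\<^bsub>C\<^esub> (monom (tens a b) 0 \<otimes>\<^bsub>C\<^esub> x) = u \<otimes>\<^bsub>C\<^esub> monom (tens a b) 0 \<otimes>\<^bsub>C\<^esub> x"
      using ab x by (simp add: C.A.m_assoc)
    also have "\<dots> = monom (\<sigma>e (tens a b)) 0 \<otimes>\<^bsub>C\<^esub> u \<otimes>\<^bsub>C\<^esub> x"
      using ab by (simp only: u_commute tens_closed)
    finally show "u \<otimes>\<^bsub>C\<^esub> (monom (tens a b) 0 \<otimes>\<^bsub>C\<^esub> x) = monom (tens (\<sigma> a) (\<sigma> b)) 0 \<otimes>\<^bsub>C\<^esub> (u \<otimes>\<^bsub>C\<^esub> x)"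
      using ab x by (simp add: C.A.m_assoc \<sigma>e_tens)
  next
    fix x assume x: "x \<in> carrier C"
    then show "(C_S ^^ m) x = monom z 0 \<otimes>\<^bsub>C\<^esub> x"
      unfolding u_pow_mult[OF x] u_pow_m by simp
  next
    show "C_S \<in> lin_map R C C" by (rule C.mult_left_linear) simp
    show "bij_betw C_S (carrier C) (carrier C)" by (rule bij)
  next
    fix x assume "x \<in> carrier C"
    then show "monom \<one>\<^bsub>E\<^esub> 0 \<otimes>\<^bsub>C\<^esub> x = x" by (simp add: M(5))
  qed (simp_all add: cyclic_datum_axioms E_algebra C_module C.A.r_distr M C.A.l_distr C.A.m_assoc
      C.smult_mult_left)
qed

lemma canonical_isoD:
  assumes "canonical_iso R m A \<sigma> c \<Phi>"
  shows "\<Phi> \<in> alg_iso R U C" and "\<Phi> \<in> alg_hom R U C"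
    and "slot_args A m as bs \<Longrightarrow> \<Phi> (sl as bs) = monom (slot_tensor R A \<sigma> c as bs) 0 \<otimes>\<^bsub>C\<^esub> u [^]\<^bsub>C\<^esub> length as"
  using assms by (auto simp: canonical_iso_def Let_def alg_iso_def)

lemma slot_tensor_closed [simp]: "slot_args A m as bs \<Longrightarrow> slot_tensor R A \<sigma> c as bs \<in> carrier E"
  by (simp add: slot_tensor_def slot_args_def)

lemma slot_tensor_last:
  "a \<in> carrier A \<Longrightarrow> slot_tensor R A \<sigma> c (a \<otimes>\<^bsub>A\<^esub> c' # ones (m - 1)) [] = tens (a \<otimes>\<^bsub>A\<^esub> c') c"
  by (simp add: slot_tensor_def twisted_prod_Cons)

lemma slot_tensor_first:
  assumes "b \<in> carrier A"
  shows "slot_tensor R A \<sigma> c [] (ones (m - 1) @ [c' \<otimes>\<^bsub>A\<^esub> b]) = tens \<one>\<^bsub>A\<^esub> b"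
proof -
  have "Suc 0 + (m - 1) = m" using m_ge_2 by simp
  then have "tp (Suc 0) (ones (m - 1) @ [c' \<otimes>\<^bsub>A\<^esub> b]) \<otimes>\<^bsub>A\<^esub> c = b"
    using assms by (simp add: tp_append twisted_prod_Cons c_commute[symmetric])
  then show ?thesis by (simp add: slot_tensor_def)
qed

lemma slot_tensor_second: "slot_tensor R A \<sigma> c [\<one>\<^bsub>A\<^esub>] (ones (m - 2) @ [c']) = \<one>\<^bsub>E\<^esub>"
proof -
  have "tp (Suc (Suc 0)) (ones (m - 2) @ [c']) \<otimes>\<^bsub>A\<^esub> c = \<one>\<^bsub>A\<^esub>"
    using m_ge_2 by (simp add: tp_append twisted_prod_Cons \<sigma>_c_inv)
  then show ?thesis by (simp add: slot_tensor_def twisted_prod_Cons tens_one)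
qed

text \<open>The crossed product is a bimodule over \<open>A\<close> with twisting operator left multiplication by \<open>u\<close>, hence
  an anchored slot module and a module over the envelope. The action of the envelope commutes with
  right multiplications, because the slot operations do; so acting on \<open>1\<close> is multiplicative.\<close>

lemma U_to_C:
  "\<exists>\<Phi> \<in> alg_hom R U C. \<forall>as bs. slot_args A m as bs \<longrightarrow>
    \<Phi> (sl as bs) = monom (slot_tensor R A \<sigma> c as bs) 0 \<otimes>\<^bsub>C\<^esub> u [^]\<^bsub>C\<^esub> length as"
proof -
  interpret T: twisted_bimodule R m A \<sigma> c C C_act C_S by (rule C_twisted_bimodule)
  interpret L: anchored_slot_module R m A \<sigma> c C T.lam by (rule T.anchored)
  let ?End = "end_algebra R C"
  interpret End: assoc_algebra R ?End by (rule CM.End_algebra)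
  obtain \<rho> where \<rho>: "\<rho> \<in> alg_hom R U ?End"
    and \<rho>op: "\<And>t x. \<lbrakk>t \<in> Ctx; x \<in> carrier C\<rbrakk> \<Longrightarrow> \<rho> (cl t) x = L.op t x"
    using L.envelope_representation by blast
  note \<rho>' = alg_homD[OF \<rho>] and cl = CM.EndD(1)[OF alg_homD(1)[OF \<rho>]]
  have slot_eq: "\<rho> (sl as bs) x = monom (slot_tensor R A \<sigma> c as bs) 0 \<otimes>\<^bsub>C\<^esub> (u [^]\<^bsub>C\<^esub> length as \<otimes>\<^bsub>C\<^esub> x)"
    if "slot_args A m as bs" "x \<in> carrier C" for as bs x
    using \<rho>op[OF slot_ctx_contexts[OF that(1)] that(2)] L.op_slot[OF that]
    unfolding slot_action_def u_pow_mult[OF that(2)] by simp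
  have right: "\<rho> X y = \<rho> X \<one>\<^bsub>C\<^esub> \<otimes>\<^bsub>C\<^esub> y" if X: "X \<in> carrier U" and y: "y \<in> carrier C" for X y
  proof -
    have lin: "(\<lambda>X. \<rho> X y) \<in> lin_map R U C" if "y \<in> carrier C" for y
      by (rule lin_mapI) (use that \<rho>' cl in \<open>auto simp: CM.End_apply\<close>)
    show ?thesis
    proof (rule lin_map_eq_on_span[OF U.module_axioms C_module _ lin[OF y]
          lin_map_comp[OF lin[OF C.A.one_closed] C.mult_right_linear[OF y]]])
      fix Y assume "Y \<in> cl ` Ctx"
      then obtain t where t: "t \<in> Ctx" "Y = cl t" by blast
      show "\<rho> Y y = \<rho> Y \<one>\<^bsub>C\<^esub> \<otimes>\<^bsub>C\<^esub> y"
        unfolding t(2) using t(1)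
      proof (induction rule: cl_induct)
        case one
        show ?case using y by (simp add: \<rho>' CM.End_apply)
      next
        case (slot as bs X)
        have "\<rho> (sl as bs \<otimes>\<^bsub>U\<^esub> X) w
            = monom (slot_tensor R A \<sigma> c as bs) 0 \<otimes>\<^bsub>C\<^esub> (u [^]\<^bsub>C\<^esub> length as \<otimes>\<^bsub>C\<^esub> \<rho> X w)"
          if "w \<in> carrier C" for w
          using that slot(1,2) slot_eq[OF slot(1) cl[OF slot(2) that]]
          by (simp add: \<rho>'(2) slot_ctx_contexts CM.End_apply(1))
        then show ?case
          using y slot cl[OF slot(2) C.A.one_closed] by (simp add: C.A.m_assoc)
      qed
    qed (use U_span X in auto)
  qed
  have "(\<lambda>X. \<rho> X \<one>\<^bsub>C\<^esub>) \<in> alg_hom R U C"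
  proof (rule alg_homI)
    fix X Y assume X: "X \<in> carrier U" and Y: "Y \<in> carrier U"
    have "\<rho> (X \<otimes>\<^bsub>U\<^esub> Y) \<one>\<^bsub>C\<^esub> = \<rho> X (\<rho> Y \<one>\<^bsub>C\<^esub>)"
      using X Y by (simp add: \<rho>' CM.End_apply)
    then show "\<rho> (X \<otimes>\<^bsub>U\<^esub> Y) \<one>\<^bsub>C\<^esub> = \<rho> X \<one>\<^bsub>C\<^esub> \<otimes>\<^bsub>C\<^esub> \<rho> Y \<one>\<^bsub>C\<^esub>"
      using right[OF X, of "\<rho> Y \<one>\<^bsub>C\<^esub>"] cl[OF Y] by simp
  qed (use \<rho>' cl in \<open>auto simp: CM.End_apply\<close>)
  then show ?thesis
    using slot_eq[OF _ C.A.one_closed] by (intro bexI[of _ "\<lambda>X. \<rho> X \<one>\<^bsub>C\<^esub>"]) auto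
qed

text \<open>The homomorphism \<open>\<psi>\<close> from the crossed product given by its presentation is a section of the map \<open>\<Phi>\<close>,
  since the composite fixes \<open>a \<otimes> 1\<close>, \<open>1 \<otimes> b\<close> and \<open>u\<close>. It is onto, because its image contains the
  one-vertex contexts. Hence \<open>\<Phi>\<close> and \<open>\<psi>\<close> are inverse to each other.\<close>

lemma canonical_iso_exists: "\<exists>\<Phi>. canonical_iso R m A \<sigma> c \<Phi>"
proof -
  obtain \<Phi> where \<Phi>: "\<Phi> \<in> alg_hom R U C"
    and slot: "\<And>as bs. slot_args A m as bs \<Longrightarrow>
      \<Phi> (sl as bs) = monom (slot_tensor R A \<sigma> c as bs) 0 \<otimes>\<^bsub>C\<^esub> u [^]\<^bsub>C\<^esub> length as"
    using U_to_C by blast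
  obtain \<psi> where \<psi>: "\<psi> \<in> alg_hom R C U"
    and \<psi>m: "\<And>a b r. \<lbrakk>a \<in> carrier A; b \<in> carrier A; r < m\<rbrakk>
      \<Longrightarrow> \<psi> (monom (tens a b) r) = left_gen a \<otimes>\<^bsub>U\<^esub> right_gen b \<otimes>\<^bsub>U\<^esub> twist_gen [^]\<^bsub>U\<^esub> r"
    using C_to_U by blast
  note \<Phi>' = alg_homD[OF \<Phi>] and \<psi>' = alg_homD[OF \<psi>] and M = alg_homD[OF monom0_hom]
  have \<Phi>left_gen: "\<Phi> (left_gen a) = monom (tens a \<one>\<^bsub>A\<^esub>) 0" if a: "a \<in> carrier A" for a
  proof -
    have "Suc (m - 1) = m" using m_ge_2 by simp
    then have "\<Phi> (left_gen a) = monom (tens (a \<otimes>\<^bsub>A\<^esub> c') c) 0 \<otimes>\<^bsub>C\<^esub> u [^]\<^bsub>C\<^esub> m"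
      using slot[OF left_gen_args[OF a]] slot_tensor_last[OF a] by (simp add: left_gen_def)
    also have "\<dots> = monom (tens (a \<otimes>\<^bsub>A\<^esub> c') c \<otimes>\<^bsub>E\<^esub> z) 0"
      unfolding u_pow_m using a by (simp add: M(2))
    finally show ?thesis using a by (simp add: tens_mult A.m_assoc)
  qed
  have \<Phi>right_gen: "\<Phi> (right_gen b) = monom (tens \<one>\<^bsub>A\<^esub> b) 0" if b: "b \<in> carrier A" for b
    using slot[OF right_gen_args[OF b]] slot_tensor_first[OF b] b by (simp add: right_gen_def)
  have \<Phi>twist_gen: "\<Phi> twist_gen = u"
    using slot[OF twist_gen_args] slot_tensor_second by (simp add: twist_gen_def M(5))
  have \<Phi>\<psi>: "\<Phi> (\<psi> x) = x" if x: "x \<in> carrier C" for x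
  proof -
    have lin: "(\<lambda>x. \<Phi> (\<psi> x)) \<in> lin_map R C C" "(\<lambda>x. x) \<in> lin_map R C C"
      by (rule alg_hom_lin_map[OF alg_hom_comp[OF \<psi> \<Phi>]]) (rule lin_mapI; simp)
    have mono: "\<Phi> (\<psi> (monom e r)) = monom e r" if e: "e \<in> carrier E" and r: "r < m" for e r
    proof (rule lin_map_eq_on_span[OF E.module_axioms C_module tensors_subset
          lin_map_comp[OF monom_linear lin(1)] monom_linear])
      fix s assume "s \<in> tensors"
      then obtain a b where s: "s = tens a b" and ab: "a \<in> carrier A" "b \<in> carrier A" by blast
      have "\<Phi> (\<psi> (monom s r)) = monom (tens a \<one>\<^bsub>A\<^esub>) 0 \<otimes>\<^bsub>C\<^esub> monom (tens \<one>\<^bsub>A\<^esub> b) 0 \<otimes>\<^bsub>C\<^esub> u [^]\<^bsub>C\<^esub> r"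
        using ab r alg_hom_pow[OF \<Phi> U.A.is_monoid C.A.is_monoid, of twist_gen r]
        by (simp add: s \<psi>m \<Phi>' \<Phi>left_gen \<Phi>right_gen \<Phi>twist_gen)
      also have "\<dots> = monom (tens a b) 0 \<otimes>\<^bsub>C\<^esub> u [^]\<^bsub>C\<^esub> r"
        using ab by (simp add: M(2)[symmetric] tens_mult)
      finally show "\<Phi> (\<psi> (monom s r)) = monom s r"
        using ab r monom_eq[of "tens a b" r] by (simp add: s)
    qed (use e E_span in auto)
    show ?thesis
      by (rule lin_map_eq_on_span[OF C_module C_module monoms_subset lin])
        (use mono C_span x in auto)
  qed
  have surj: "\<exists>x \<in> carrier C. X = \<psi> x" if "X \<in> carrier U" for X
  proof -
    have cl: "\<exists>x \<in> carrier C. cl t = \<psi> x" if "t \<in> Ctx" for t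
      using that
    proof (induction rule: cl_induct)
      case one
      show ?case by (rule bexI[of _ "\<one>\<^bsub>C\<^esub>"]) (simp_all add: \<psi>')
    next
      case (slot as bs X)
      then obtain x where x: "x \<in> carrier C" "X = \<psi> x" by blast
      obtain a b r where ab: "a \<in> carrier A" "b \<in> carrier A" "r < m"
        "sl as bs = left_gen a \<otimes>\<^bsub>U\<^esub> right_gen b \<otimes>\<^bsub>U\<^esub> twist_gen [^]\<^bsub>U\<^esub> r"
        using sl_generated[OF slot(1)] by blast
      then have "sl as bs \<otimes>\<^bsub>U\<^esub> X = \<psi> (monom (tens a b) r \<otimes>\<^bsub>C\<^esub> x)"
        using x by (simp add: \<psi>'(2) \<psi>m)
      then show ?case using ab x by (intro bexI[of _ "monom (tens a b) r \<otimes>\<^bsub>C\<^esub> x"]) auto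
    qed
    have "X \<in> lin_span R U (cl ` Ctx)" using U_span that by blast
    then show ?thesis
    proof induction
      case zero
      have "\<psi> \<zero>\<^bsub>C\<^esub> = \<zero>\<^bsub>U\<^esub>"
        by (rule lin_map_zero[OF alg_hom_lin_map[OF \<psi>] C_module U.module_axioms])
      then show ?case by (intro bexI[of _ "\<zero>\<^bsub>C\<^esub>"]) simp_all
    next
      case (base s)
      then show ?case using cl by blast
    next
      case (add X Y)
      then obtain x y where "x \<in> carrier C" "X = \<psi> x" "y \<in> carrier C" "Y = \<psi> y" by blast
      then show ?case by (intro bexI[of _ "x \<oplus>\<^bsub>C\<^esub> y"]) (simp_all add: \<psi>')
    next
      case (smult r X)
      then obtain x where "x \<in> carrier C" "X = \<psi> x" by blast
      then show ?case using smult(1) by (intro bexI[of _ "r \<odot>\<^bsub>C\<^esub> x"]) (simp_all add: \<psi>')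
    qed
  qed
  have \<psi>\<Phi>: "\<psi> (\<Phi> X) = X" if X: "X \<in> carrier U" for X
  proof -
    obtain x where x: "x \<in> carrier C" "X = \<psi> x" using surj[OF X] by blast
    show ?thesis unfolding x(2) \<Phi>\<psi>[OF x(1)] ..
  qed
  have "bij_betw \<Phi> (carrier U) (carrier C)"
    by (rule bij_betwI[where g = \<psi>]) (simp_all add: Pi_iff \<Phi>'(1) \<psi>'(1) \<Phi>\<psi> \<psi>\<Phi>)
  then show ?thesis
    using \<Phi> slot by (intro exI[of _ \<Phi>]) (simp add: canonical_iso_def Let_def alg_iso_def)
qed

end

section \<open>Naturality in the cyclic datum\<close>

lemma map_ctx_graft: "map_ctx f (graft t D) = graft (map_ctx f t) (map_ctx f D)"
  by (induction t) auto

lemma map_ctx_invariants: "holes (map_ctx f t) = holes t" "full n (map_ctx f t) = full n t"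
  by (induction t) (auto simp: comp_def cong: map_cong)

lemma map_ctx_contexts:
  assumes "\<And>a. a \<in> carrier A \<Longrightarrow> f a \<in> carrier B" "t \<in> contexts A n"
  shows "map_ctx f t \<in> contexts B n"
  using assms by (auto simp: contexts_def map_ctx_invariants ctx.set_map)

lemma map_ctx_slot: "map_ctx f (slot_ctx as bs) = slot_ctx (map f as) (map f bs)"
  by (simp add: slot_ctx_def)

lemma map_ctx_place:
  assumes "leaf_place K"
  shows "\<exists>K'. leaf_place K' \<and> (\<forall>a. map_ctx f (K a) = K' (f a))"
  using assms
proof induction
  case leaf
  show ?case by (rule exI[of _ Leaf]) (simp add: leaf_place.leaf)
next
  case (inside K us ws)
  then obtain K' where "leaf_place K'" "\<And>a. map_ctx f (K a) = K' (f a)" by blast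
  then show ?case
    by (intro exI[of _ "\<lambda>a. Node (map (map_ctx f) us @ K' a # map (map_ctx f) ws)"])
      (simp add: leaf_place.inside)
qed

lemma map_ctx_rebracket: "rebracket t t' \<Longrightarrow> rebracket (map_ctx f t) (map_ctx f t')"
proof (induction rule: rebracket.induct)
  case (move us vs ws us' vs' ws')
  have "map (map_ctx f) us @ map (map_ctx f) vs @ map (map_ctx f) ws
      = map (map_ctx f) us' @ map (map_ctx f) vs' @ map (map_ctx f) ws'"
    using arg_cong[OF move(1), of "map (map_ctx f)"] by simp
  then show ?case using move(2) by (simp add: rebracket.move)
qed (simp add: rebracket.inside)

lemma map_ctx_contract:
  assumes "contract \<mu> t t'"
    and "\<And>as. \<lbrakk>set as \<subseteq> X; length as = n\<rbrakk> \<Longrightarrow> f (\<mu> as) = \<mu>' (map f as)"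
  shows "\<lbrakk>full n t; set_ctx t \<subseteq> X\<rbrakk> \<Longrightarrow> contract \<mu>' (map_ctx f t) (map_ctx f t')"
  using assms(1)
proof (induction rule: contract.induct)
  case (vertex as)
  then have "f (\<mu> as) = \<mu>' (map f as)" by (intro assms(2)) auto
  then show ?case using contract.vertex[of \<mu>' "map f as"] by (simp add: comp_def)
next
  case (inside t t' us ws)
  then show ?case by (simp add: contract.inside)
qed

locale cyclic_datum_hom = A: cyclic_datum R m A \<sigma> c + B: cyclic_datum R m B \<tau> d
  for R (structure) and m and A :: "('r, 'a) module" and \<sigma> c and B :: "('r, 'b) module" and \<tau> d +
  fixes f
  assumes f: "datum_morphism R A \<sigma> c B \<tau> d f"
begin

lemma f_hom: "f \<in> alg_hom R A B" and f_\<sigma>: "a \<in> carrier A \<Longrightarrow> f (\<sigma> a) = \<tau> (f a)" and f_c: "f c = d"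
  using f by (auto simp: datum_morphism_def)

lemmas f_simps = alg_homD[OF f_hom]

lemma f_c': "f A.c' = B.c'"
  using alg_hom_inv(2)[OF f_hom A.A.is_monoid B.A.is_monoid A.c_unit] by (simp add: f_c)

lemma f_\<sigma>_pow: "a \<in> carrier A \<Longrightarrow> f ((\<sigma> ^^ k) a) = (\<tau> ^^ k) (f a)"
  by (induction k) (simp_all add: f_\<sigma>)

lemma f_tp: "set as \<subseteq> carrier A \<Longrightarrow> f (A.tp j as) = B.tp j (map f as)"
  by (induction as arbitrary: j) (simp_all add: twisted_prod_Cons f_simps f_\<sigma>_pow)

lemma f_set: "set as \<subseteq> carrier A \<Longrightarrow> set (map f as) \<subseteq> carrier B"
  using f_simps(1) by auto

lemma f_nary_mult:
  assumes "set as \<subseteq> carrier A" "length as = Suc m"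
  shows "f (A.\<mu> as) = B.\<mu> (map f as)"
  using assms by (simp add: A.nary_mult_eq B.nary_mult_eq[OF f_set] f_simps f_tp f_c)

abbreviation fe where "fe \<equiv> env_alg_map R B f"

lemma fe_hom: "fe \<in> alg_hom R A.E B.E"
  and fe_tens: "\<lbrakk>a \<in> carrier A; b \<in> carrier A\<rbrakk> \<Longrightarrow> fe (A.tens a b) = B.tens (f a) (f b)"
  using env_alg_map_hom[OF A.assoc_algebra_axioms B.assoc_algebra_axioms f_hom] by auto

lemma fe_\<sigma>e:
  assumes "x \<in> carrier A.E"
  shows "fe ((A.\<sigma>e ^^ k) x) = (B.\<sigma>e ^^ k) (fe x)"
  by (rule lin_map_eq_on_span[OF A.E.module_axioms B.E.module_axioms A.tensors_subset
      alg_hom_lin_map[OF alg_hom_comp[OF A.\<sigma>e_pow_hom fe_hom]]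
      alg_hom_lin_map[OF alg_hom_comp[OF fe_hom B.\<sigma>e_pow_hom]]])
    (use assms A.E_span in \<open>auto simp: A.\<sigma>e_pow_tens fe_tens B.\<sigma>e_pow_tens f_\<sigma>_pow f_simps\<close>)

abbreviation fC where "fC \<equiv> crossed_map R m B f"

lemma fC_monom: "x \<in> carrier A.E \<Longrightarrow> fC (A.monom x r) = B.monom (fe x) r"
  using lin_map_zero[OF alg_hom_lin_map[OF fe_hom] A.E.module_axioms B.E.module_axioms]
  by (auto simp: crossed_map_def crossed_monom_def intro!: restrict_ext)

lemma fC_linear: "fC \<in> lin_map R A.C B.C"
proof (rule lin_mapI)
  note fe = alg_homD[OF fe_hom]
  have cl: "fC x \<in> carrier B.C" if "x \<in> carrier A.C" for x
    unfolding crossed_map_def by (rule B.C_memI) (simp add: fe A.C_memD[OF that])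
  then show "\<And>x. x \<in> carrier A.C \<Longrightarrow> fC x \<in> carrier B.C" .
  fix x assume x: "x \<in> carrier A.C"
  show "fC (x \<oplus>\<^bsub>A.C\<^esub> y) = fC x \<oplus>\<^bsub>B.C\<^esub> fC y" if y: "y \<in> carrier A.C" for y
    using A.C_memD[OF x] A.C_memD[OF y]
    by (auto simp: crossed_map_def A.C_simps(2) B.C_simps(2) fe intro!: restrict_ext)
  show "fC (r \<odot>\<^bsub>A.C\<^esub> x) = r \<odot>\<^bsub>B.C\<^esub> fC x" if r: "r \<in> carrier R" for r
    using A.C_memD[OF x] r
    by (auto simp: crossed_map_def A.C_simps(3) B.C_simps(3) fe intro!: restrict_ext)
qed

lemma fC_hom: "fC \<in> alg_hom R A.C B.C"
proof (rule alg_homI_span[OF A.C_algebra B.C_algebra fC_linear A.monoms_subset A.C_span])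
  note fe = alg_homD[OF fe_hom]
  have fz: "fe (A.z [^]\<^bsub>A.E\<^esub> (k::nat)) = B.z [^]\<^bsub>B.E\<^esub> k" for k
    using alg_hom_pow[OF fe_hom A.E.A.is_monoid B.E.A.is_monoid, of A.z k] by (simp add: fe_tens f_c f_c')
  fix x y assume "x \<in> A.monoms" "y \<in> A.monoms"
  then obtain a r b s where *: "x = A.monom a r" "y = A.monom b s"
    "a \<in> carrier A.E" "b \<in> carrier A.E" "r < m" "s < m"
    by blast
  then show "fC (x \<otimes>\<^bsub>A.C\<^esub> y) = fC x \<otimes>\<^bsub>B.C\<^esub> fC y"
    by (simp add: A.monom_mult B.monom_mult fC_monom fe fe_\<sigma>e fz)
next
  show "fC \<one>\<^bsub>A.C\<^esub> = \<one>\<^bsub>B.C\<^esub>"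
    by (simp add: A.C_simps(5) B.C_simps(5) fC_monom alg_homD[OF fe_hom])
qed

abbreviation fU where "fU \<equiv> envelope_map R m B \<tau> d f"

lemma map_ctx_closed: "t \<in> A.Ctx \<Longrightarrow> map_ctx f t \<in> B.Ctx"
  using map_ctx_contexts f_simps(1) by metis

lemma fU_hom: "fU \<in> alg_hom R A.U B.U"
  and fU_cl: "t \<in> A.Ctx \<Longrightarrow> fU (A.cl t) = B.cl (map_ctx f t)"
proof -
  let ?h = "push_forward R (map_ctx f)"
  let ?RA = "envelope_rels R m A \<sigma> c \<union> anchor_rels R m A c"
  let ?RB = "envelope_rels R m B \<tau> d \<union> anchor_rels R m B d"
  note pf = push_forward_alg_hom[OF A.K.monoid_ring_axioms B.K.monoid_ring_axioms,
      where \<phi> = "map_ctx f", simplified, OF map_ctx_closed map_ctx_graft]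
  have h: "?h \<in> alg_hom R A.KF B.KF" and hb: "\<And>t. t \<in> A.Ctx \<Longrightarrow> ?h (basis_el R t) = basis_el R (map_ctx f t)"
    using pf by (simp_all add: ctx_algebra_def)
  note hm = alg_hom_minus[OF h A.KF_algebra B.KF_algebra] alg_homD[OF h] A.ctx_el_closed hb
    slot_ctx_contexts[OF A.first_anchor_args] slot_ctx_contexts[OF A.last_anchor_args]
  have "?h s \<in> ?RB" if "s \<in> ?RA" for s
    using that
  proof (cases rule: A.envelope_relsE)
    case (sum t t1 t2)
    then obtain K a b where K: "leaf_place K" "t = K (a \<oplus>\<^bsub>A\<^esub> b)" "t1 = K a" "t2 = K b"
      using leaf_sum_place by blast
    have ab: "a \<in> carrier A" "b \<in> carrier A"
      using leaf_place_label[OF K(1)] sum K by (auto simp: contexts_def)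
    obtain K' where "leaf_place K'" "\<And>a. map_ctx f (K a) = K' (f a)"
      using map_ctx_place[OF K(1)] by metis
    then have "leaf_sum B (map_ctx f t) (map_ctx f t1) (map_ctx f t2)"
      using ab by (simp add: K f_simps place_leaf_sum)
    then show ?thesis
      using sum B.envelope_relsI(1)[OF map_ctx_closed map_ctx_closed map_ctx_closed] by (simp add: hm del: Un_iff)
  next
    case (smult r t t')
    obtain K a where K: "leaf_place K" "t = K (r \<odot>\<^bsub>A\<^esub> a)" "t' = K a"
      using leaf_smult_place[OF smult(4)] by (elim exE conjE) (rule that)
    have a: "a \<in> carrier A"
      using leaf_place_label[OF K(1)] smult K by (auto simp: contexts_def)
    obtain K' where "leaf_place K'" "\<And>a. map_ctx f (K a) = K' (f a)"
      using map_ctx_place[OF K(1)] by metis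
    then have "leaf_smult B r (map_ctx f t) (map_ctx f t')"
      using a smult(1) by (simp add: K f_simps place_leaf_smult)
    then show ?thesis
      using smult B.envelope_relsI(2)[OF _ map_ctx_closed map_ctx_closed] by (simp add: hm del: Un_iff)
  next
    case (contract t t')
    have "contract B.\<mu> (map_ctx f t) (map_ctx f t')"
      by (rule map_ctx_contract[OF contract(3), of "carrier A" "Suc m"])
        (use f_nary_mult contract in \<open>auto simp: contexts_def\<close>)
    then show ?thesis
      using contract B.envelope_relsI(3)[OF map_ctx_closed map_ctx_closed] by (simp add: hm del: Un_iff)
  next
    case (rebracket t t')
    then show ?thesis
      using B.envelope_relsI(4)[OF map_ctx_closed map_ctx_closed map_ctx_rebracket] by (simp add: hm del: Un_iff)
  next
    case first
    then show ?thesis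
      using B.envelope_relsI(5) by (simp add: hm map_ctx_slot f_c' f_simps del: Un_iff One_nat_def)
  next
    case last
    then show ?thesis
      using B.envelope_relsI(6) by (simp add: hm map_ctx_slot f_c' f_simps del: Un_iff One_nat_def)
  qed
  then have hS: "?h s \<in> B.Uq.I" if "s \<in> ?RA" for s
    using that B.KF.A.genideal_self[OF B.Uq.S_subset] by blast
  note qm = quotient_map_alg_hom[OF A.Uq.alg_quotient_axioms B.Uq.alg_quotient_axioms h]
  show "fU \<in> alg_hom R A.U B.U"
    using qm(1) hS by (simp add: envelope_map_def anchored_envelope_def envelope_ideal_def)
  show "fU (A.cl t) = B.cl (map_ctx f t)" if "t \<in> A.Ctx"
    using qm(2)[OF _ A.ctx_el_closed[OF that]] hS hb[OF that]
    by (simp add: envelope_map_def ctx_class_def envelope_ideal_def)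
qed

lemma fe_slot_tensor:
  "slot_args A m as bs \<Longrightarrow> fe (slot_tensor R A \<sigma> c as bs) = slot_tensor R B \<tau> d (map f as) (map f bs)"
  by (simp add: slot_tensor_def slot_args_def fe_tens f_simps f_tp f_c)

text \<open>Two homomorphisms from the envelope that agree on one-vertex contexts are equal.\<close>

lemma square:
  assumes \<Phi>: "canonical_iso R m A \<sigma> c \<Phi>" and \<Psi>: "canonical_iso R m B \<tau> d \<Psi>" and X: "X \<in> carrier A.U"
  shows "\<Psi> (fU X) = fC (\<Phi> X)"
proof (rule A.alg_hom_eq_on_slots[OF B.C_algebra alg_hom_comp[OF fU_hom B.canonical_isoD(2)[OF \<Psi>]]
      alg_hom_comp[OF A.canonical_isoD(2)[OF \<Phi>] fC_hom] _ X])
  fix as bs assume s: "slot_args A m as bs"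
  then have s': "slot_args B m (map f as) (map f bs)"
    using f_set by (simp add: slot_args_def)
  have "fC A.u = B.u"
    using fC_monom[of "\<one>\<^bsub>A.E\<^esub>" 1] by (simp add: alg_homD[OF fe_hom])
  then have "fC (\<Phi> (A.sl as bs))
      = B.monom (slot_tensor R B \<tau> d (map f as) (map f bs)) 0 \<otimes>\<^bsub>B.C\<^esub> B.u [^]\<^bsub>B.C\<^esub> length as"
    using s A.u_closed alg_hom_pow[OF fC_hom A.C.A.is_monoid B.C.A.is_monoid A.u_closed]
    by (simp only: A.canonical_isoD(3)[OF \<Phi> s] alg_homD(2)[OF fC_hom] A.monom_closed A.slot_tensor_closed
        A.C.A.nat_pow_closed fC_monom fe_slot_tensor)
  then show "\<Psi> (fU (A.sl as bs)) = fC (\<Phi> (A.sl as bs))"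
    by (simp only: fU_cl[OF slot_ctx_contexts[OF s]] map_ctx_slot B.canonical_isoD(3)[OF \<Psi> s'] length_map)
qed

end

section \<open>Slot modules are twisted bimodules\<close>

context twisted_bimodule
begin

lemma M_module: "module R M" ..

text \<open>The two-sided action and the twisting operator are themselves composites of slot operations.
  Hence the slot operations determine them, and a map that commutes with the former commutes with
  the latter.\<close>

lemma S_eq_lam: "x \<in> carrier M \<Longrightarrow> S x = lam [\<one>\<^bsub>A\<^esub>] x (ones (m - 2) @ [c'])"
  using slot_tensor_second lin_mapD(1)[OF S_linear] by (simp add: slot_action_def E.one_act)

lemma act_eq_lam:
  assumes x: "x \<in> carrier M" and a: "a \<in> carrier A" and b: "b \<in> carrier A"
  shows "act (tens a b) x
    = lam (a \<otimes>\<^bsub>A\<^esub> c' # ones (m - 1)) (lam [] x (ones (m - 1) @ [c' \<otimes>\<^bsub>A\<^esub> b])) []"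
proof -
  have m: "length (a \<otimes>\<^bsub>A\<^esub> c' # ones (m - 1)) = m" using m_ge_2 by simp
  have 1: "lam [] x (ones (m - 1) @ [c' \<otimes>\<^bsub>A\<^esub> b]) = act (tens \<one>\<^bsub>A\<^esub> b) x"
    using slot_tensor_first[OF b] by (simp add: slot_action_def)
  have 2: "lam (a \<otimes>\<^bsub>A\<^esub> c' # ones (m - 1)) y [] = act (tens a \<one>\<^bsub>A\<^esub>) y" if y: "y \<in> carrier M" for y
    unfolding slot_action_def slot_tensor_last[OF a] m S_pow_m[OF y]
    using a y by (simp add: E.mult_act[symmetric] tens_mult A.m_assoc)
  have "act (tens \<one>\<^bsub>A\<^esub> b) x \<in> carrier M"
    using b x by (simp add: E.act_closed)
  then show ?thesis
    unfolding 1 using 2 a b x by (simp add: E.mult_act[symmetric] tens_mult)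
qed

end

lemma slot_morphism_iff:
  assumes M: "twisted_bimodule R m A \<sigma> c M act S" and N: "twisted_bimodule R m A \<sigma> c N act' S'"
  shows "slot_morphism R m A M (slot_action R A \<sigma> c act S) N (slot_action R A \<sigma> c act' S') f
    \<longleftrightarrow> bimodule_morphism R A M act S N act' S' f"
proof -
  interpret M: twisted_bimodule R m A \<sigma> c M act S by fact
  interpret N: twisted_bimodule R m A \<sigma> c N act' S' by fact
  interpret L: anchored_slot_module R m A \<sigma> c M M.lam by (rule M.anchored)
  show ?thesis
  proof
    assume "slot_morphism R m A M M.lam N N.lam f"
    then have f: "f \<in> lin_map R M N"
      and fl: "\<And>as bs x. \<lbrakk>x \<in> carrier M; slot_args A m as bs\<rbrakk> \<Longrightarrow> f (M.lam as x bs) = N.lam as (f x) bs"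
      by (auto simp: slot_morphism_def)
    have "f (act e x) = act' e (f x)" if x: "x \<in> carrier M" and e: "e \<in> carrier M.E" for e x
    proof (rule lin_map_eq_on_span[OF assoc_algebra_module[OF M.E_algebra] N.M_module M.tensors_subset
          lin_map_comp[OF M.act_linear_left[OF x] f] N.act_linear_left[OF lin_mapD(1)[OF f x]]])
      fix s assume "s \<in> M.tensors"
      then obtain a b where s: "s = M.tens a b" and ab: "a \<in> carrier A" "b \<in> carrier A" by blast
      show "f (act s x) = act' s (f x)"
        unfolding s M.act_eq_lam[OF x ab] N.act_eq_lam[OF lin_mapD(1)[OF f x] ab]
        using fl[OF L.lam_closed[OF M.right_gen_args[OF ab(2)] x] M.left_gen_args[OF ab(1)]]
          fl[OF x M.right_gen_args[OF ab(2)]] by simp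
    qed (use M.E_span e in auto)
    moreover have "f (S x) = S' (f x)" if x: "x \<in> carrier M" for x
      using fl[OF x M.twist_gen_args] M.S_eq_lam[OF x] N.S_eq_lam[OF lin_mapD(1)[OF f x]] by simp
    ultimately show "bimodule_morphism R A M act S N act' S' f"
      using f by (simp add: bimodule_morphism_def)
  next
    assume "bimodule_morphism R A M act S N act' S' f"
    then have f: "f \<in> lin_map R M N"
      and fa: "\<And>e x. \<lbrakk>e \<in> carrier M.E; x \<in> carrier M\<rbrakk> \<Longrightarrow> f (act e x) = act' e (f x)"
      and fS: "\<And>x. x \<in> carrier M \<Longrightarrow> f (S x) = S' (f x)"
      by (auto simp: bimodule_morphism_def)
    have "f ((S ^^ k) x) = (S' ^^ k) (f x)" if "x \<in> carrier M" for k x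
      by (induction k) (use that in \<open>simp_all add: fS\<close>)
    then show "slot_morphism R m A M M.lam N N.lam f"
      using f by (simp add: slot_morphism_def slot_action_def fa)
  qed
qed

text \<open>A slot module is a module over the envelope, hence, through the inverse of the isomorphism, over
  the crossed product. Restricting this action to the enveloping algebra and to \<open>u\<close> gives the
  bimodule structure and \<open>S\<close>, and the values of the isomorphism on one-vertex contexts give the
  formula for the slot operations.\<close>

lemma (in anchored_slot_module) twisted_bimodule_exists:
  "\<exists>act S. twisted_bimodule R m A \<sigma> c M act S \<and>
    (\<forall>as bs. \<forall>x \<in> carrier M. slot_args A m as bs \<longrightarrow> lam as x bs = slot_action R A \<sigma> c act S as x bs)"
proof -
  interpret End: assoc_algebra R M.EndM by (rule M.End_algebra)
  obtain \<Phi> where \<Phi>: "canonical_iso R m A \<sigma> c \<Phi>" using canonical_iso_exists by blast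
  obtain \<rho> where \<rho>: "\<rho> \<in> alg_hom R U M.EndM"
    and \<rho>op: "\<And>t x. \<lbrakk>t \<in> Ctx; x \<in> carrier M\<rbrakk> \<Longrightarrow> \<rho> (cl t) x = op t x"
    using envelope_representation by blast
  define \<chi> where "\<chi> x = \<rho> (inv_into (carrier U) \<Phi> x)" for x
  note inv = alg_iso_inverse[OF U_algebra canonical_isoD(1)[OF \<Phi>]]
  have \<chi>: "\<chi> \<in> alg_hom R C M.EndM"
    unfolding \<chi>_def by (rule alg_hom_comp[OF inv(1) \<rho>])
  have \<chi>0: "(\<lambda>e. \<chi> (monom e 0)) \<in> alg_hom R E M.EndM"
    by (rule alg_hom_comp[OF monom0_hom \<chi>])
  define act where "act e = \<chi> (monom e 0)" for e
  have act: "act \<in> alg_hom R E M.EndM"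
    using \<chi>0 by (simp add: act_def[abs_def])
  define S where "S = \<chi> u"
  note \<chi>' = alg_homD[OF \<chi>] and act' = alg_homD[OF act]
  note actE = M.EndD[OF act'(1)]
  have S: "S \<in> carrier M.EndM" unfolding S_def by (rule \<chi>'(1)) simp
  have S_pow: "(S ^^ k) x = \<chi> (u [^]\<^bsub>C\<^esub> k) x" if "x \<in> carrier M" for k x
    using M.End_pow[OF S that, of k] alg_hom_pow[OF \<chi> C.A.is_monoid End.A.is_monoid u_closed, of k]
    by (simp only: S_def)
  have slot: "lam as x bs = act (slot_tensor R A \<sigma> c as bs) ((S ^^ length as) x)"
    if args: "slot_args A m as bs" and x: "x \<in> carrier M" for as bs x
  proof -
    have "lam as x bs = \<rho> (sl as bs) x"
      using \<rho>op[OF slot_ctx_contexts[OF args] x] op_slot[OF args x] by simp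
    also have "\<rho> (sl as bs) = \<chi> (\<Phi> (sl as bs))"
      unfolding \<chi>_def using inv(2)[of "sl as bs"] args by (simp add: slot_ctx_contexts)
    also have "\<dots> = act (slot_tensor R A \<sigma> c as bs) \<otimes>\<^bsub>M.EndM\<^esub> \<chi> (u [^]\<^bsub>C\<^esub> length as)"
      unfolding canonical_isoD(3)[OF \<Phi> args] act_def
      by (rule \<chi>'(2)[OF monom_closed[OF slot_tensor_closed[OF args]] C.A.nat_pow_closed[OF u_closed]])
    finally show ?thesis
      using x by (simp only: M.End_apply S_pow)
  qed
  have inv_u: "\<chi> (inv\<^bsub>C\<^esub> u) \<in> carrier M.EndM"
    by (rule \<chi>'(1)) (rule C.A.Units_inv_closed[OF u_Units])
  have bij: "bij_betw S (carrier M) (carrier M)"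
  proof (rule bij_betwI[where g = "\<chi> (inv\<^bsub>C\<^esub> u)"])
    have "\<chi> (inv\<^bsub>C\<^esub> u) \<otimes>\<^bsub>M.EndM\<^esub> S = \<one>\<^bsub>M.EndM\<^esub>" "S \<otimes>\<^bsub>M.EndM\<^esub> \<chi> (inv\<^bsub>C\<^esub> u) = \<one>\<^bsub>M.EndM\<^esub>"
      unfolding S_def using u_Units C.A.Units_inv_closed[OF u_Units]
      by (simp_all only: \<chi>'(2)[symmetric] u_closed C.A.Units_l_inv C.A.Units_r_inv \<chi>'(5))
    then show "\<chi> (inv\<^bsub>C\<^esub> u) (S x) = x" "S (\<chi> (inv\<^bsub>C\<^esub> u) x) = x" if "x \<in> carrier M" for x
      using that M.End_apply(1,2)[OF that] by metis+
  qed (use M.EndD(1)[OF S] M.EndD(1)[OF inv_u] in auto)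
  have "twisted_bimodule R m A \<sigma> c M act S"
  proof (intro twisted_bimodule.intro twisted_bimodule_axioms.intro alg_module.intro alg_module_axioms.intro)
    fix a b x assume a: "a \<in> carrier A" and b: "b \<in> carrier A" and x: "x \<in> carrier M"
    have "S \<otimes>\<^bsub>M.EndM\<^esub> act (tens a b) = act (tens (\<sigma> a) (\<sigma> b)) \<otimes>\<^bsub>M.EndM\<^esub> S"
      unfolding S_def act_def
      using a b by (simp only: \<chi>'(2)[symmetric] u_closed monom_closed tens_closed \<sigma>_closed u_commute \<sigma>e_tens)
    then show "S (act (tens a b) x) = act (tens (\<sigma> a) (\<sigma> b)) (S x)"
      using M.End_apply(1)[OF x] by metis
  next
    fix x assume x: "x \<in> carrier M"
    show "(S ^^ m) x = act z x"
      unfolding S_pow[OF x] u_pow_m act_def ..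
  next
    show "S \<in> lin_map R M M" by (rule M.End_lin[OF S])
  qed (simp_all add: cyclic_datum_axioms E_algebra M.module_axioms bij actE act' M.End_apply)
  then show ?thesis
    using slot by (intro exI[of _ act] exI[of _ S]) (simp add: slot_action_def)
qed

text \<open>The identity is a morphism of slot modules, hence of bimodules with twisting operators.\<close>

lemma (in anchored_slot_module) twisted_bimodule_unique:
  assumes M: "twisted_bimodule R m A \<sigma> c M act S" "twisted_bimodule R m A \<sigma> c M act' S'"
    and lam: "\<And>as bs x. \<lbrakk>slot_args A m as bs; x \<in> carrier M\<rbrakk> \<Longrightarrow> lam as x bs = slot_action R A \<sigma> c act S as x bs"
      "\<And>as bs x. \<lbrakk>slot_args A m as bs; x \<in> carrier M\<rbrakk> \<Longrightarrow> lam as x bs = slot_action R A \<sigma> c act' S' as x bs"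
    and x: "x \<in> carrier M"
  shows "S' x = S x" and "e \<in> carrier E \<Longrightarrow> act' e x = act e x"
proof -
  have "slot_morphism R m A M (slot_action R A \<sigma> c act' S') M (slot_action R A \<sigma> c act S) (\<lambda>x. x)"
    using lam by (auto simp: slot_morphism_def intro: lin_mapI)
  then have "bimodule_morphism R A M act' S' M act S (\<lambda>x. x)"
    by (simp only: slot_morphism_iff[OF M(2,1)])
  then show "S' x = S x" "e \<in> carrier E \<Longrightarrow> act' e x = act e x"
    using x by (auto simp: bimodule_morphism_def)
qed

theorem theorem3p3:
  fixes R :: "'r ring" and A :: "('r, 'a) module" and \<sigma> :: "'a \<Rightarrow> 'a" and c :: 'a and m :: nat
  assumes "cyclic_datum R m A \<sigma> c"
  shows
    "assoc_algebra R (anchored_envelope R m A \<sigma> c) \<and>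
     assoc_algebra R (crossed_product R m A \<sigma> c) \<and>
     (\<exists>\<Phi>. canonical_iso R m A \<sigma> c \<Phi>) \<and>
     (\<forall>(B :: ('r, 'b) module) \<tau> d f \<Phi> \<Psi>.
        cyclic_datum R m B \<tau> d \<and> datum_morphism R A \<sigma> c B \<tau> d f \<and>
        canonical_iso R m A \<sigma> c \<Phi> \<and> canonical_iso R m B \<tau> d \<Psi> \<longrightarrow>
        envelope_map R m B \<tau> d f
          \<in> alg_hom R (anchored_envelope R m A \<sigma> c) (anchored_envelope R m B \<tau> d) \<and>
        crossed_map R m B f
          \<in> alg_hom R (crossed_product R m A \<sigma> c) (crossed_product R m B \<tau> d) \<and>
        (\<forall>\<xi> \<in> carrier (anchored_envelope R m A \<sigma> c).
           \<Psi> (envelope_map R m B \<tau> d f \<xi>) = crossed_map R m B f (\<Phi> \<xi>))) \<and>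
     (\<forall>(M :: ('r, 'm) module) act S.
        twisted_bimodule R m A \<sigma> c M act S \<longrightarrow>
        anchored_slot_module R m A \<sigma> c M (slot_action R A \<sigma> c act S)) \<and>
     (\<forall>(M :: ('r, 'm) module) lam.
        anchored_slot_module R m A \<sigma> c M lam \<longrightarrow>
        (\<exists>act S. twisted_bimodule R m A \<sigma> c M act S \<and>
           (\<forall>as bs. \<forall>x \<in> carrier M. slot_args A m as bs \<longrightarrow>
              lam as x bs = slot_action R A \<sigma> c act S as x bs) \<and>
           (\<forall>act' S'. twisted_bimodule R m A \<sigma> c M act' S' \<and>
              (\<forall>as bs. \<forall>x \<in> carrier M. slot_args A m as bs \<longrightarrow>
                 lam as x bs = slot_action R A \<sigma> c act' S' as x bs) \<longrightarrow>
              (\<forall>x \<in> carrier M. S' x = S x \<and>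
                 (\<forall>e \<in> carrier (env_alg R A). act' e x = act e x))))) \<and>
     (\<forall>(M :: ('r, 'm) module) act S (N :: ('r, 'n) module) act' S' f.
        twisted_bimodule R m A \<sigma> c M act S \<and> twisted_bimodule R m A \<sigma> c N act' S' \<longrightarrow>
        (slot_morphism R m A M (slot_action R A \<sigma> c act S) N (slot_action R A \<sigma> c act' S') f
           \<longleftrightarrow> bimodule_morphism R A M act S N act' S' f))"
proof (intro conjI allI impI)
  interpret cyclic_datum R m A \<sigma> c by fact
  show "assoc_algebra R (anchored_envelope R m A \<sigma> c)" by (rule U_algebra)
  show "assoc_algebra R (crossed_product R m A \<sigma> c)" by (rule C_algebra)
  show "\<exists>\<Phi>. canonical_iso R m A \<sigma> c \<Phi>" by (rule canonical_iso_exists)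
next
  fix B :: "('r, 'b) module" and \<tau> d f \<Phi> \<Psi>
  assume *: "cyclic_datum R m B \<tau> d \<and> datum_morphism R A \<sigma> c B \<tau> d f \<and>
    canonical_iso R m A \<sigma> c \<Phi> \<and> canonical_iso R m B \<tau> d \<Psi>"
  then interpret cyclic_datum_hom R m A \<sigma> c B \<tau> d f
    using assms by (intro cyclic_datum_hom.intro cyclic_datum_hom_axioms.intro) auto
  show "envelope_map R m B \<tau> d f
    \<in> alg_hom R (anchored_envelope R m A \<sigma> c) (anchored_envelope R m B \<tau> d)" by (rule fU_hom)
  show "crossed_map R m B f
    \<in> alg_hom R (crossed_product R m A \<sigma> c) (crossed_product R m B \<tau> d)" by (rule fC_hom)
  show "\<forall>\<xi> \<in> carrier (anchored_envelope R m A \<sigma> c).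
    \<Psi> (envelope_map R m B \<tau> d f \<xi>) = crossed_map R m B f (\<Phi> \<xi>)"
    using * square by blast
next
  fix M :: "('r, 'm) module" and act S
  assume "twisted_bimodule R m A \<sigma> c M act S"
  then show "anchored_slot_module R m A \<sigma> c M (slot_action R A \<sigma> c act S)"
    by (rule twisted_bimodule.anchored)
next
  fix M :: "('r, 'm) module" and lam
  assume M: "anchored_slot_module R m A \<sigma> c M lam"
  then interpret anchored_slot_module R m A \<sigma> c M lam .
  obtain act S where *: "twisted_bimodule R m A \<sigma> c M act S"
    "\<And>as bs x. \<lbrakk>slot_args A m as bs; x \<in> carrier M\<rbrakk> \<Longrightarrow> lam as x bs = slot_action R A \<sigma> c act S as x bs"
    using twisted_bimodule_exists by blast
  show "\<exists>act S. twisted_bimodule R m A \<sigma> c M act S \<and>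
           (\<forall>as bs. \<forall>x \<in> carrier M. slot_args A m as bs \<longrightarrow>
              lam as x bs = slot_action R A \<sigma> c act S as x bs) \<and>
           (\<forall>act' S'. twisted_bimodule R m A \<sigma> c M act' S' \<and>
              (\<forall>as bs. \<forall>x \<in> carrier M. slot_args A m as bs \<longrightarrow>
                 lam as x bs = slot_action R A \<sigma> c act' S' as x bs) \<longrightarrow>
              (\<forall>x \<in> carrier M. S' x = S x \<and>
                 (\<forall>e \<in> carrier (env_alg R A). act' e x = act e x)))"
    using * twisted_bimodule_unique[OF *(1) _ *(2)] by (intro exI[of _ act] exI[of _ S]) blast
next
  fix M :: "('r, 'm) module" and act S and N :: "('r, 'n) module" and act' S' f
  assume "twisted_bimodule R m A \<sigma> c M act S \<and> twisted_bimodule R m A \<sigma> c N act' S'"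
  then have *: "twisted_bimodule R m A \<sigma> c M act S" "twisted_bimodule R m A \<sigma> c N act' S'" by auto
  show "slot_morphism R m A M (slot_action R A \<sigma> c act S) N (slot_action R A \<sigma> c act' S') f
    \<longleftrightarrow> bimodule_morphism R A M act S N act' S' f"
    by (rule slot_morphism_iff[OF *])
qed

end
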